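(* There is a residual subset $\mathcal{R}$ of the space $\mathrm{Homeo}(S^1)$ of all circle homeomorphisms such that every $f\in\mathcal{R}$ is wonderful. Moreover, for every $f \in \mathcal{R}$ the set of physical measures of $f$ is countably infinite and each physical measure of $f$ is a periodic Dirac measure.
   Context: $\mathrm{Homeo}(S^1)$ carries the $C^0$ topology, induced by $d_{C^0}(f,g)=\sup_{x\in S^1}d(f(x),g(x))$. A subset of a topological space $X$ is residual if it contains the intersection of a countable family of open and dense subsets of $X$. $m$ is Lebesgue measure on $S^1$ (a fixed volume probability). For continuous $f:S^1\to S^1$ and $x\in S^1$, the Birkhoff limit of $x$, when it exists, is the probability measure $\mu_x=\lim_{n\to\infty}\frac1n\sum_{j=1}^n\delta_{f^j(x)}$ (weak* limit). The basin of a Borel probability $\mu$ is $B(\mu)=\{x:\mu_x\text{ is well defined and }\mu_x=\mu\}$; $\mu$ is a physical measure of $f$ if $m(B(\mu))>0$. If $p$ is a periodic point of $f$ of period $k$, the periodic Dirac measure on its orbit is $\mu_p=\frac1k\sum_{j=0}^{k-1}\delta_{f^j(p)}$. $f$ is wonderful if there exists a finite or countable family of physical measures $\mu_n$ of $f$ such that $m\left(\bigcup_n B(\mu_n)\right)=1$. *)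

theory Defs
  imports "HOL-Probability.Probability"
begin

abbreviation circle :: "complex set" ("S\<^sup>1") where
  "S\<^sup>1 \<equiv> sphere 0 1"

text \<open>
  \<^const>\<open>cfunspace\<close> carries the supremum distance. Its elements are extensional functions, so that
  each circle map is represented by exactly one function on the complex plane.
\<close>
definition Homeo_circle :: "(complex \<Rightarrow> complex) metric" where
  "Homeo_circle =
     submetric (cfunspace (top_of_set S\<^sup>1) (submetric euclidean_metric S\<^sup>1))
       {f. homeomorphic_map (top_of_set S\<^sup>1) (top_of_set S\<^sup>1) f}"

definition residual :: "'a topology \<Rightarrow> 'a set \<Rightarrow> bool" where
  "residual X R \<longleftrightarrow>
     R \<subseteq> topspace X \<and>
     (\<exists>\<U>. countable \<U> \<and> (\<forall>U\<in>\<U>. openin X U \<and> X closure_of U = topspace X) \<and>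
          topspace X \<inter> \<Inter>\<U> \<subseteq> R)"

definition borel_circle :: "complex measure" where
  "borel_circle = restrict_space borel S\<^sup>1"

definition lebesgue_circle :: "complex measure" where
  "lebesgue_circle =
     distr (uniform_measure lborel {0..<1}) borel_circle (\<lambda>t. cis (2 * pi * t))"

text \<open>
  For finite nonempty \<open>J\<close>, the measure \<open>(1 / card J) * (\<Sum>j\<in>J. \<delta>\<^bsub>y j\<^esub>)\<close>; see the lemma
  \<open>emeasure_dirac_average\<close> below.
\<close>
definition dirac_average :: "nat set \<Rightarrow> (nat \<Rightarrow> complex) \<Rightarrow> complex measure" where
  "dirac_average J y = distr (uniform_count_measure J) borel_circle y"

definition weak_star_limit :: "(nat \<Rightarrow> complex measure) \<Rightarrow> complex measure \<Rightarrow> bool" where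
  "weak_star_limit M \<mu> \<longleftrightarrow>
     (\<forall>\<phi> :: complex \<Rightarrow> real. continuous_on S\<^sup>1 \<phi> \<longrightarrow>
        (\<lambda>n. \<integral>x. \<phi> x \<partial>M n) \<longlonglongrightarrow> (\<integral>x. \<phi> x \<partial>\<mu>))"

definition borel_probability :: "complex measure \<Rightarrow> bool" where
  "borel_probability \<mu> \<longleftrightarrow> prob_space \<mu> \<and> sets \<mu> = sets borel_circle"

definition has_birkhoff_limit ::
    "(complex \<Rightarrow> complex) \<Rightarrow> complex \<Rightarrow> complex measure \<Rightarrow> bool" where
  "has_birkhoff_limit f x \<mu> \<longleftrightarrow>
     borel_probability \<mu> \<and>
     weak_star_limit (\<lambda>n. dirac_average {1..n} (\<lambda>j. (f ^^ j) x)) \<mu>"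

definition basin :: "(complex \<Rightarrow> complex) \<Rightarrow> complex measure \<Rightarrow> complex set" where
  "basin f \<mu> = {x \<in> S\<^sup>1. has_birkhoff_limit f x \<mu>}"

definition physical_measure :: "(complex \<Rightarrow> complex) \<Rightarrow> complex measure \<Rightarrow> bool" where
  "physical_measure f \<mu> \<longleftrightarrow> borel_probability \<mu> \<and> emeasure lebesgue_circle (basin f \<mu>) > 0"

definition wonderful :: "(complex \<Rightarrow> complex) \<Rightarrow> bool" where
  "wonderful f \<longleftrightarrow>
     (\<exists>\<M>. countable \<M> \<and> (\<forall>\<mu>\<in>\<M>. physical_measure f \<mu>) \<and>
          emeasure lebesgue_circle (\<Union>\<mu>\<in>\<M>. basin f \<mu>) = 1)"

definition periodic_point :: "(complex \<Rightarrow> complex) \<Rightarrow> complex \<Rightarrow> nat \<Rightarrow> bool" where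
  "periodic_point f p k \<longleftrightarrow>
     p \<in> S\<^sup>1 \<and> k > 0 \<and> (f ^^ k) p = p \<and> (\<forall>j. 0 < j \<and> j < k \<longrightarrow> (f ^^ j) p \<noteq> p)"

definition periodic_dirac :: "(complex \<Rightarrow> complex) \<Rightarrow> complex \<Rightarrow> nat \<Rightarrow> complex measure" where
  "periodic_dirac f p k = dirac_average {..<k} (\<lambda>j. (f ^^ j) p)"

lemma space_borel_circle [simp]: "space borel_circle = S\<^sup>1"
  by (simp add: borel_circle_def space_restrict_space)

lemma mspace_Homeo_circle:
  "mspace Homeo_circle =
     {f \<in> extensional S\<^sup>1. homeomorphic_map (top_of_set S\<^sup>1) (top_of_set S\<^sup>1) f}"
proof -
  have top: "mtopology_of (submetric euclidean_metric S\<^sup>1) = top_of_set S\<^sup>1"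
    by (simp add: mtopology_of_submetric)
  have "Metric_space.mbounded S\<^sup>1 dist (f ` S\<^sup>1)"
    if "homeomorphic_map (top_of_set S\<^sup>1) (top_of_set S\<^sup>1) f" for f
  proof -
    interpret Metric_space "S\<^sup>1" dist
      by unfold_locales (auto simp: dist_commute dist_triangle)
    have "f ` S\<^sup>1 \<subseteq> mcball 1 2"
    proof
      fix y assume "y \<in> f ` S\<^sup>1"
      then have "y \<in> S\<^sup>1" using homeomorphic_imp_surjective_map[OF that] by simp
      moreover have "dist 1 y \<le> norm (1::complex) + norm y"
        by (simp only: dist_norm norm_triangle_ineq4)
      ultimately show "y \<in> mcball 1 2" by (simp add: mcball_def)
    qed
    then show ?thesis unfolding mbounded_def by blast
  qed
  then show ?thesis
    using homeomorphic_imp_continuous_map homeomorphic_imp_surjective_map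
    by (fastforce simp: Homeo_circle_def top)
qed

lemma mdist_Homeo_circle:
  assumes "f \<in> mspace Homeo_circle" "g \<in> mspace Homeo_circle"
  shows "mdist Homeo_circle f g = (SUP x\<in>S\<^sup>1. dist (f x) (g x))"
proof -
  interpret Metric_space "S\<^sup>1" dist
    by unfold_locales (auto simp: dist_commute dist_triangle)
  have "f \<in> fspace S\<^sup>1" "g \<in> fspace S\<^sup>1"
    using assms by (auto simp: Homeo_circle_def fspace_def)
  moreover have "(1::complex) \<in> S\<^sup>1" by simp
  ultimately show ?thesis
    by (auto simp: Homeo_circle_def mdist_cfunspace_eq_mdist_funspace fdist_def)
qed

lemma prob_space_lebesgue_circle: "prob_space lebesgue_circle"
proof -
  have "prob_space (uniform_measure lborel {0..<1::real})"
    by (rule prob_space_uniform_measure) auto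
  moreover have "(\<lambda>t. cis (2 * pi * t)) \<in> uniform_measure lborel {0..<1} \<rightarrow>\<^sub>M borel_circle"
    unfolding borel_circle_def
    by (intro measurable_restrict_space2)
       (auto intro!: borel_measurable_continuous_onI continuous_intros
             simp: measurable_cong_sets[OF sets_uniform_measure refl])
  ultimately show ?thesis
    unfolding lebesgue_circle_def by (rule prob_space.prob_space_distr)
qed

lemma emeasure_dirac_average:
  assumes "finite J" "J \<noteq> {}" "\<And>j. j \<in> J \<Longrightarrow> y j \<in> S\<^sup>1" "A \<in> sets borel_circle"
  shows "emeasure (dirac_average J y) A =
           (\<Sum>j\<in>J. emeasure (return borel_circle (y j)) A) / card J"
proof -
  have y: "y \<in> uniform_count_measure J \<rightarrow>\<^sub>M borel_circle"
    using assms(3) by (auto simp: measurable_def space_uniform_count_measure sets_uniform_count_measure)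
  have "(\<Sum>j\<in>J. emeasure (return borel_circle (y j)) A) = of_nat (card (y -` A \<inter> J))"
    using assms by (simp add: indicator_def sum.If_cases Int_commute vimage_def Collect_conj_eq)
  moreover have "card J > 0" using assms by (simp add: card_gt_0_iff)
  ultimately show ?thesis
    using assms y
    by (simp add: dirac_average_def emeasure_distr space_uniform_count_measure
        emeasure_uniform_count_measure divide_ennreal ennreal_of_nat_eq_real_of_nat)
qed

end

(* Call a closed set K mapped by f into an open subset V of K a trap. A trap of f is also one of every
   C^0-small perturbation of f. Suppose that for every N some trap K has measure above 1 - 1/N while
   V has measure below 1/N, and that f has N pairwise disjoint traps.
   A periodic point in K lies in f(K), so the periodic points form a null set. The components of the
   interior of K are arcs permuted eventually periodically by f, so f has a periodic point p. Cutting
   the circle at p makes some iterate f^q an increasing interval map, and then every orbit converges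
   to a periodic orbit, with constant limit on intervals of points not fixed by f^q. These intervals
   have positive measure and contain rationals, so the physical measures are countably many periodic
   Dirac measures whose basins have full measure. N disjoint traps carry N distinct ones.

   For density, crush finitely many short arcs into points whose images avoid the endpoints of the
   arcs. Precomposing with such a homeomorphism moves f little and creates a large trap with small
   image, hence a periodic point. Close to that point a second perturbation makes an iterate equal
   to the identity on an arc. This yields arbitrarily many periodic orbits, which a final crushing
   turns into disjoint traps. *)

theory Submission
  imports Defs
begin

section \<open>Circle homeomorphisms and their lifts\<close>

text \<open>Two obstacles shape the argument. First, a homeomorphism may have no periodic point at
  all, as an irrational rotation shows, and a large trap gives one such point but no direct lower
  bound on the number of physical measures. This is why disjoint traps are demanded separately, and
  why they cannot be produced by a single crushing: the final one needs many disjoint finite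
  invariant sets, which the perturbation to a local identity has to supply. Second, orientation may
  be reversed. An iterate can fix \<open>p\<close> and still exchange its two sides, so a full
  neighbourhood of \<open>p\<close> may return to itself too early. All work near \<open>p\<close>
  therefore takes place on a one-sided arc, with returns counted only when they preserve
  orientation. Crushing is done by precomposition: a homeomorphism that keeps each short arc in
  place moves every point little, and uniform continuity of f turns this into a small change of f,
  however violent the contraction inside the arcs is.\<close>

definition arc_point :: "complex \<Rightarrow> real \<Rightarrow> complex" where
  "arc_point a t = a * cis (2 * pi * t)"

definition arc_coord :: "complex \<Rightarrow> complex \<Rightarrow> real" where
  "arc_coord a x = Arg2pi (x / a) / (2 * pi)"

lemma arc_point_0 [simp]: "arc_point a 0 = a"
  and arc_point_1 [simp]: "arc_point a 1 = a"
  by (simp_all add: arc_point_def)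

lemma norm_arc_point [simp]: "norm (arc_point a t) = norm a"
  by (simp add: arc_point_def norm_mult)

lemma arc_point_in_circle: "a \<in> S\<^sup>1 \<Longrightarrow> arc_point a t \<in> S\<^sup>1"
  by simp

lemma continuous_on_arc_point [continuous_intros]:
  "continuous_on A f \<Longrightarrow> continuous_on A (\<lambda>t. arc_point a (f t))"
  unfolding arc_point_def by (intro continuous_intros)

text \<open>A chord is twice the sine of half the angle, hence at most the arc. This transfers
  estimates on coordinates to the chordal metric.\<close>

lemma dist_arc_point_le:
  assumes "a \<in> S\<^sup>1"
  shows "dist (arc_point a s) (arc_point a t) \<le> 2 * pi * \<bar>s - t\<bar>"
proof -
  have "a * cis (2 * pi * s) - a * cis (2 * pi * t) = a * (cis (2 * pi * t) * (cis (2 * pi * (s-t)) - 1))"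
    by (simp add: algebra_simps cis_mult)
  then have "dist (arc_point a s) (arc_point a t) = norm (cis (2 * pi * (s-t)) - 1)"
    using assms by (simp add: arc_point_def dist_norm norm_mult)
  also have "\<dots> = 2 * \<bar>sin (2 * pi * (s-t) / 2)\<bar>"
    using dist_exp_i_1[of "2 * pi * (s-t)"] by (simp add: cis_conv_exp)
  also have "\<dots> \<le> 2 * \<bar>2 * pi * (s-t) / 2\<bar>"
    by (intro mult_left_mono abs_sin_x_le_abs_x) auto
  also have "\<dots> = 2 * pi * \<bar>s - t\<bar>"
    by (simp add: abs_mult)
  finally show ?thesis .
qed

lemma arc_coord_bounds: "0 \<le> arc_coord a x" "arc_coord a x < 1"
  using Arg2pi[of "x / a"] by (auto simp: arc_coord_def)

lemma arc_point_arc_coord [simp]: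
  assumes "a \<in> S\<^sup>1" "x \<in> S\<^sup>1"
  shows "arc_point a (arc_coord a x) = x"
proof -
  have "a \<noteq> 0" using assms by auto
  have "norm (x / a) = 1" using assms by (simp add: norm_divide)
  then have "cis (Arg2pi (x / a)) = x / a"
    by (simp add: complex_norm_eq_1_exp cis_conv_exp)
  with \<open>a \<noteq> 0\<close> show ?thesis
    by (simp add: arc_point_def arc_coord_def)
qed

lemma arc_coord_arc_point [simp]:
  assumes "a \<in> S\<^sup>1" "0 \<le> t" "t < 1"
  shows "arc_coord a (arc_point a t) = t"
proof -
  have "a \<noteq> 0" using assms by auto
  moreover have "Arg2pi (cis (2 * pi * t)) = 2 * pi * t"
    using assms by (intro Arg2pi_unique[of 1]) (auto simp: cis_conv_exp)
  ultimately show ?thesis by (simp add: arc_point_def arc_coord_def)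
qed

lemma arc_coord_pos: "a \<in> S\<^sup>1 \<Longrightarrow> x \<in> S\<^sup>1 \<Longrightarrow> x \<noteq> a \<Longrightarrow> 0 < arc_coord a x"
  by (metis arc_coord_bounds(1) arc_point_0 arc_point_arc_coord less_eq_real_def)

lemma arc_point_eq_iff:
  assumes "a \<in> S\<^sup>1" "0 \<le> s" "s < 1" "0 \<le> t" "t < 1"
  shows "arc_point a s = arc_point a t \<longleftrightarrow> s = t"
  using assms by (metis arc_coord_arc_point)

lemma arc_point_eq_base_iff:
  assumes "a \<in> S\<^sup>1" "0 \<le> t" "t \<le> 1"
  shows "arc_point a t = a \<longleftrightarrow> t = 0 \<or> t = 1"
  using arc_point_eq_iff[of a t 0] assms by (cases "t = 1") auto

lemma circle_eq_arc_point_image: "a \<in> S\<^sup>1 \<Longrightarrow> S\<^sup>1 = arc_point a ` {0..1}"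
proof (intro equalityI subsetI)
  fix x assume "a \<in> S\<^sup>1" "x \<in> S\<^sup>1"
  then show "x \<in> arc_point a ` {0..1}"
    using arc_coord_bounds[of a x] by (intro image_eqI[where x = "arc_coord a x"]) auto
qed auto

text \<open>The coordinate jumps from 1 to 0 at the base point only: \<open>x / a\<close> has norm
  1, so it meets the cut of \<open>Arg2pi\<close> just when \<open>x = a\<close>.\<close>

lemma continuous_on_arc_coord:
  assumes "a \<in> S\<^sup>1"
  shows "continuous_on (S\<^sup>1 - {a}) (arc_coord a)"
proof -
  have "continuous (at (x / a)) Arg2pi" if "x \<in> S\<^sup>1 - {a}" for x
  proof (rule continuous_at_Arg2pi)
    show "x / a \<notin> \<real>\<^sub>\<ge>\<^sub>0"
    proof
      assume "x / a \<in> \<real>\<^sub>\<ge>\<^sub>0"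
      then obtain r where r: "0 \<le> r" "x / a = of_real r" by (auto simp: nonneg_Reals_def)
      moreover have "norm (x / a) = 1" using that assms by (simp add: norm_divide)
      ultimately have "x / a = 1" by (simp split: if_splits)
      then show False using that assms by auto
    qed
  qed
  then have "continuous_on ((\<lambda>x. x / a) ` (S\<^sup>1 - {a})) Arg2pi"
    by (intro continuous_at_imp_continuous_on) auto
  moreover have "continuous_on (S\<^sup>1 - {a}) (\<lambda>x. x / a)"
    using assms by (intro continuous_intros) auto
  ultimately have "continuous_on (S\<^sup>1 - {a}) (\<lambda>x. Arg2pi (x / a))"
    using continuous_on_compose2[of _ Arg2pi _ "\<lambda>x. x / a"] by blast
  then show ?thesis unfolding arc_coord_def by (intro continuous_intros) auto
qed

text \<open>The bounds on \<open>u\<close> and \<open>v\<close> keep the arc away from the base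
  point, so it is a preimage under the continuous coordinate of the punctured circle.\<close>

lemma openin_arc_point_image:
  assumes "a \<in> S\<^sup>1" "0 \<le> u" "v \<le> 1"
  shows "openin (top_of_set S\<^sup>1) (arc_point a ` {u<..<v})"
proof -
  have "openin (top_of_set (S\<^sup>1 - {a})) ((S\<^sup>1 - {a}) \<inter> arc_coord a -` {u<..<v})"
    using continuous_on_arc_coord[OF assms(1)] by (simp add: continuous_openin_preimage_gen)
  moreover have "(S\<^sup>1 - {a}) \<inter> arc_coord a -` {u<..<v} = arc_point a ` {u<..<v}"
  proof (intro equalityI subsetI)
    fix x assume "x \<in> (S\<^sup>1 - {a}) \<inter> arc_coord a -` {u<..<v}"
    then show "x \<in> arc_point a ` {u<..<v}"
      using assms by (intro image_eqI[where x = "arc_coord a x"]) auto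
  next
    fix x assume "x \<in> arc_point a ` {u<..<v}"
    then obtain t where "x = arc_point a t" "u < t" "t < v" by auto
    then show "x \<in> (S\<^sup>1 - {a}) \<inter> arc_coord a -` {u<..<v}"
      using assms arc_point_eq_base_iff[of a t] by auto
  qed
  moreover have "openin (top_of_set S\<^sup>1) (S\<^sup>1 - {a})"
    by (simp add: openin_delete)
  ultimately show ?thesis using openin_trans by metis
qed

text \<open>The circle is compact and Hausdorff, so the inverse is automatically continuous. Values
  off the circle are left free, which lets composites and iterates be formed without
  restriction.\<close>

definition circle_homeo :: "(complex \<Rightarrow> complex) \<Rightarrow> bool" where
  "circle_homeo f \<longleftrightarrow> continuous_on S\<^sup>1 f \<and> f ` S\<^sup>1 = S\<^sup>1 \<and> inj_on f S\<^sup>1"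

lemma homeomorphic_map_circle_iff:
  "homeomorphic_map (top_of_set S\<^sup>1) (top_of_set S\<^sup>1) f \<longleftrightarrow> circle_homeo f"
proof
  assume "homeomorphic_map (top_of_set S\<^sup>1) (top_of_set S\<^sup>1) f"
  then show "circle_homeo f"
    using homeomorphic_imp_continuous_map homeomorphic_imp_surjective_map homeomorphic_imp_injective_map
    by (fastforce simp: circle_homeo_def)
next
  assume f: "circle_homeo f"
  show "homeomorphic_map (top_of_set S\<^sup>1) (top_of_set S\<^sup>1) f"
    using f by (intro continuous_imp_homeomorphic_map)
      (auto simp: circle_homeo_def compact_space_subtopology Hausdorff_space_subtopology)
qed

lemma circle_homeoD:
  assumes "circle_homeo f"
  shows "continuous_on S\<^sup>1 f" "f ` S\<^sup>1 = S\<^sup>1" "inj_on f S\<^sup>1" "x \<in> S\<^sup>1 \<Longrightarrow> f x \<in> S\<^sup>1"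
  using assms by (auto simp: circle_homeo_def)

lemma circle_homeo_comp:
  assumes "circle_homeo f" "circle_homeo g"
  shows "circle_homeo (f \<circ> g)"
  unfolding circle_homeo_def
proof (intro conjI)
  show "continuous_on S\<^sup>1 (f \<circ> g)"
    using circle_homeoD[OF assms(1)] circle_homeoD[OF assms(2)] by (simp only: continuous_on_compose)
  show "(f \<circ> g) ` S\<^sup>1 = S\<^sup>1"
    using circle_homeoD[OF assms(1)] circle_homeoD[OF assms(2)] by (simp only: image_comp [symmetric])
  show "inj_on (f \<circ> g) S\<^sup>1"
    using circle_homeoD[OF assms(1)] circle_homeoD[OF assms(2)] by (simp only: comp_inj_on)
qed

lemma circle_homeo_id: "circle_homeo id"
  by (simp add: circle_homeo_def)

lemma circle_homeo_funpow: "circle_homeo f \<Longrightarrow> circle_homeo (f ^^ n)"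
  by (induction n) (auto intro: circle_homeo_comp circle_homeo_id simp flip: id_def)

lemma circle_homeo_cong:
  assumes "circle_homeo f" "\<And>x. x \<in> S\<^sup>1 \<Longrightarrow> f x = g x"
  shows "circle_homeo g"
  using assms unfolding circle_homeo_def
  by (metis continuous_on_cong image_cong inj_on_cong)

lemma circle_homeo_inverse:
  assumes "circle_homeo f"
  obtains g where "circle_homeo g" "\<And>x. x \<in> S\<^sup>1 \<Longrightarrow> g (f x) = x" "\<And>x. x \<in> S\<^sup>1 \<Longrightarrow> f (g x) = x"
proof -
  have "homeomorphic_map (top_of_set S\<^sup>1) (top_of_set S\<^sup>1) f"
    using assms by (simp add: homeomorphic_map_circle_iff)
  then obtain g where g: "homeomorphic_maps (top_of_set S\<^sup>1) (top_of_set S\<^sup>1) f g"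
    by (auto simp: homeomorphic_map_maps)
  then have "homeomorphic_map (top_of_set S\<^sup>1) (top_of_set S\<^sup>1) g"
    using homeomorphic_maps_map by blast
  with g that show thesis
    by (auto simp: homeomorphic_map_circle_iff homeomorphic_maps_def)
qed

text \<open>The parametrisation of the circle by \<open>[0, 1]\<close> is a quotient map, which gives continuity at the
  base point.\<close>
lemma circle_homeo_of_interval_homeo:
  assumes a: "a \<in> S\<^sup>1" and cont: "continuous_on {0..1} \<Phi>"
    and mono: "strict_mono_on {0..1} \<Phi>" and ends: "\<Phi> 0 = 0" "\<Phi> 1 = 1"
  obtains \<phi> where "circle_homeo \<phi>" "\<And>t. t \<in> {0..1} \<Longrightarrow> \<phi> (arc_point a t) = arc_point a (\<Phi> t)"
proof
  define \<phi> where "\<phi> x = arc_point a (\<Phi> (arc_coord a x))" for x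
  have \<Phi>: "\<Phi> t \<in> {0..<1}" if "t \<in> {0..<1}" for t
  proof -
    have "\<Phi> t < \<Phi> 1" using that by (intro strict_mono_onD[OF mono]) auto
    moreover have "\<Phi> 0 \<le> \<Phi> t"
      using that strict_mono_onD[OF mono, of 0 t] by (cases "t = 0") auto
    ultimately show ?thesis using ends by auto
  qed
  show eq: "\<phi> (arc_point a t) = arc_point a (\<Phi> t)" if "t \<in> {0..1}" for t
    using that a ends arc_coord_arc_point[of a 0] by (cases "t = 1") (auto simp: \<phi>_def)
  have quot: "quotient_map (top_of_set {0..1}) (top_of_set S\<^sup>1) (arc_point a)"
    using a circle_eq_arc_point_image[OF a]
    by (intro continuous_imp_quotient_map)
       (auto simp: compact_space_subtopology Hausdorff_space_subtopology intro!: continuous_intros)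
  have "continuous_on {0..1} (\<lambda>t. arc_point a (\<Phi> t))"
    by (intro continuous_intros cont)
  then have "continuous_on {0..1} (\<phi> \<circ> arc_point a)"
    by (rule continuous_on_eq) (simp add: eq)
  then have "continuous_map (top_of_set {0..1}) (top_of_set S\<^sup>1) (\<phi> \<circ> arc_point a)"
    using a by (auto simp: \<phi>_def)
  with quot have "continuous_map (top_of_set S\<^sup>1) (top_of_set S\<^sup>1) \<phi>"
    by (rule continuous_compose_quotient_map)
  moreover have "\<phi> ` S\<^sup>1 = S\<^sup>1"
  proof (intro equalityI subsetI)
    fix y assume y: "y \<in> S\<^sup>1"
    have "\<exists>t\<ge>0. t \<le> 1 \<and> \<Phi> t = arc_coord a y"
      using arc_coord_bounds[of a y] ends cont by (intro IVT') auto
    then obtain t where "t \<in> {0..1}" "\<Phi> t = arc_coord a y" by auto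
    then have "\<phi> (arc_point a t) = y" using eq[of t] y a by simp
    then show "y \<in> \<phi> ` S\<^sup>1" using a by force
  qed (use a in \<open>auto simp: \<phi>_def\<close>)
  moreover have "inj_on \<phi> S\<^sup>1"
  proof (rule inj_onI)
    fix x y assume xy: "x \<in> S\<^sup>1" "y \<in> S\<^sup>1" "\<phi> x = \<phi> y"
    have "\<Phi> (arc_coord a x) = \<Phi> (arc_coord a y)"
      using xy(3) \<Phi>[of "arc_coord a x"] \<Phi>[of "arc_coord a y"] arc_coord_bounds[of a] a
      by (simp add: \<phi>_def arc_point_eq_iff)
    then have "arc_coord a x = arc_coord a y"
      using strict_mono_on_imp_inj_on[OF mono] arc_coord_bounds[of a]
      by (auto dest!: inj_onD simp: less_imp_le)
    then show "x = y" using xy a by (metis arc_point_arc_coord)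
  qed
  ultimately show "circle_homeo \<phi>" by (auto simp: circle_homeo_def)
qed

text \<open>Removing the fixed point leaves an invariant open arc, which \<open>arc_coord p\<close>
  identifies with the open unit interval. A continuous injection there is monotone, decreasing when
  \<open>G\<close> reverses the orientation.\<close>

lemma circle_homeo_fixing_lift:
  assumes G: "circle_homeo G" and p: "p \<in> S\<^sup>1" "G p = p"
  obtains H where "\<And>t. t \<in> {0<..<1} \<Longrightarrow> G (arc_point p t) = arc_point p (H t)"
    "bij_betw H {0<..<1} {0<..<1}"
    "strict_mono_on {0<..<1} H \<or> strict_antimono_on {0<..<1} H"
proof
  define H where "H t = arc_coord p (G (arc_point p t))" for t
  have ne: "G (arc_point p t) \<in> S\<^sup>1 - {p}" if "t \<in> {0<..<1}" for t
  proof -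
    have "arc_point p t \<noteq> p" using that p arc_point_eq_base_iff[of p t] by auto
    then show ?thesis
      using p circle_homeoD[OF G] by (metis DiffI arc_point_in_circle inj_onD singletonD)
  qed
  show eq: "G (arc_point p t) = arc_point p (H t)" if "t \<in> {0<..<1}" for t
    using ne[OF that] p by (simp add: H_def)
  have into: "H t \<in> {0<..<1}" if "t \<in> {0<..<1}" for t
    using ne[OF that] p arc_coord_bounds[of p] arc_coord_pos[of p] by (auto simp: H_def)
  have inj: "inj_on H {0<..<1}"
  proof (rule inj_onI)
    fix s t assume st: "s \<in> {0<..<1}" "t \<in> {0<..<1}" "H s = H t"
    then have "G (arc_point p s) = G (arc_point p t)" using eq by metis
    then have "arc_point p s = arc_point p t"
      using p circle_homeoD(3)[OF G] by (metis arc_point_in_circle inj_onD)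
    then show "s = t" using st p by (auto simp: arc_point_eq_iff)
  qed
  have surj: "\<exists>t\<in>{0<..<1}. H t = u" if u: "u \<in> {0<..<1}" for u
  proof -
    have "arc_point p u \<in> G ` S\<^sup>1" using p circle_homeoD(2)[OF G] by simp
    then obtain x where x: "x \<in> S\<^sup>1" "G x = arc_point p u" by auto
    have "x \<noteq> p" using x p u arc_point_eq_base_iff[of p u] by auto
    then show ?thesis
      using x p u arc_coord_bounds[of p x] arc_coord_pos[of p x]
      by (intro bexI[where x = "arc_coord p x"]) (auto simp: H_def)
  qed
  show "bij_betw H {0<..<1} {0<..<1}"
    unfolding bij_betw_def using inj into surj by (auto simp: image_iff) (metis greaterThanLessThan_iff)
  have "continuous_on {0<..<1} (\<lambda>t. G (arc_point p t))"
    by (rule continuous_on_compose2[OF circle_homeoD(1)[OF G]]) (use p in \<open>auto intro!: continuous_intros\<close>)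
  then have "continuous_on {0<..<1} H"
    unfolding H_def
    by (rule continuous_on_compose2[OF continuous_on_arc_coord[OF p(1)]]) (use ne in auto)
  then show "strict_mono_on {0<..<1} H \<or> strict_antimono_on {0<..<1} H"
    using inj injective_eq_monotone_map[of "{0<..<1}" H] by (simp add: is_interval_convex_1)
qed

section \<open>Lebesgue measure on the circle\<close>

lemma sets_borel_circleI: "B \<in> sets borel \<Longrightarrow> B \<subseteq> S\<^sup>1 \<Longrightarrow> B \<in> sets borel_circle"
  by (auto simp: borel_circle_def sets_restrict_space_iff)

lemma openin_sets_borel_circle: "openin (top_of_set S\<^sup>1) B \<Longrightarrow> B \<in> sets borel_circle"
proof -
  assume "openin (top_of_set S\<^sup>1) B"
  then obtain T where "open T" "B = S\<^sup>1 \<inter> T" by (auto simp: openin_open)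
  then show ?thesis by (simp add: sets_borel_circleI borel_open borel_closed sets.Int)
qed

lemma sets_lebesgue_circle [simp, measurable_cong]: "sets lebesgue_circle = sets borel_circle"
  by (simp add: lebesgue_circle_def)

lemma space_lebesgue_circle [simp]: "space lebesgue_circle = S\<^sup>1"
  by (simp add: lebesgue_circle_def)

interpretation lebesgue_circle: prob_space lebesgue_circle
  by (rule prob_space_lebesgue_circle)

text \<open>The base point 1 matches the parametrisation in \<open>lebesgue_circle\<close>, and the
  interval has length 1, so the normalisation of the uniform measure disappears.\<close>

lemma emeasure_lebesgue_circle:
  assumes "A \<in> sets borel_circle"
  shows "emeasure lebesgue_circle A = emeasure lborel ({0..<1} \<inter> arc_point 1 -` A)"
proof -
  have cont: "(\<lambda>t. cis (2 * pi * t)) \<in> borel \<rightarrow>\<^sub>M borel_circle"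
    unfolding borel_circle_def
    by (intro measurable_restrict_space2)
       (auto intro!: borel_measurable_continuous_onI continuous_intros)
  then have meas: "(\<lambda>t. cis (2 * pi * t)) \<in> uniform_measure lborel {0..<1} \<rightarrow>\<^sub>M borel_circle"
    by (simp add: measurable_cong_sets[OF sets_uniform_measure refl])
  have "(\<lambda>t. cis (2 * pi * t)) -` A \<in> sets borel"
    using measurable_sets[OF cont assms] by simp
  with meas assms show ?thesis
    by (simp add: lebesgue_circle_def emeasure_distr arc_point_def vimage_def divide_ennreal_def)
qed

lemma emeasure_lebesgue_circle_singleton [simp]: "emeasure lebesgue_circle {c} = 0"
proof (cases "c \<in> S\<^sup>1")
  case True
  have "{0..<1} \<inter> arc_point 1 -` {c} \<subseteq> {arc_coord 1 c}"
    by (auto simp: arc_coord_arc_point)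
  then have "emeasure lborel ({0..<1} \<inter> arc_point 1 -` {c}) \<le> emeasure lborel {arc_coord 1 c}"
    by (intro emeasure_mono) auto
  then show ?thesis
    using True by (subst emeasure_lebesgue_circle) (auto intro: sets_borel_circleI)
next
  case False
  then have "{c} \<notin> sets lebesgue_circle"
    using sets.sets_into_space[of "{c}" lebesgue_circle] by auto
  then show ?thesis by (rule emeasure_notin_sets)
qed

lemma emeasure_lebesgue_circle_finite:
  assumes "finite X"
  shows "emeasure lebesgue_circle (X \<inter> S\<^sup>1) = 0"
  using assms
proof (induction rule: finite_induct)
  case (insert c X)
  have "emeasure lebesgue_circle ({c} \<inter> S\<^sup>1) = 0"
    by (cases "c \<in> S\<^sup>1") auto
  moreover have "Y \<inter> S\<^sup>1 \<in> sets lebesgue_circle" if "finite Y" for Y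
    using that by (simp add: sets_borel_circleI borel_closed finite_imp_closed)
  ultimately have "emeasure lebesgue_circle ((X \<inter> S\<^sup>1) \<union> ({c} \<inter> S\<^sup>1)) = 0"
    using insert by (subst emeasure_Un_null_set) (auto simp: null_sets_def)
  moreover have "insert c X \<inter> S\<^sup>1 = (X \<inter> S\<^sup>1) \<union> ({c} \<inter> S\<^sup>1)" by blast
  ultimately show ?case by (simp only:)
qed simp

text \<open>The closed neighbourhoods of radius \<open>inverse (Suc n)\<close> decrease to a finite,
  hence null, set; continuity of the measure from above does the rest.\<close>

lemma emeasure_lebesgue_circle_near_finite:
  fixes \<epsilon> :: real
  assumes "finite X" "\<epsilon> > 0"
  obtains \<rho> where "\<rho> > 0" "emeasure lebesgue_circle {x \<in> S\<^sup>1. \<exists>c\<in>X. dist x c \<le> \<rho>} < ennreal \<epsilon>"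
proof -
  define A where "A n = {x \<in> S\<^sup>1. \<exists>c\<in>X. dist x c \<le> inverse (real (Suc n))}" for n
  have A_eq: "A n = (\<Union>c\<in>X. cball c (inverse (real (Suc n))) \<inter> S\<^sup>1)" for n
    by (auto simp: A_def dist_commute)
  have "closed (A n)" for n
    using assms(1) unfolding A_eq by (intro closed_UN closed_Int) auto
  then have sets: "A n \<in> sets lebesgue_circle" for n
    by (auto intro!: sets_borel_circleI borel_closed) (auto simp: A_def)
  have dec: "decseq A"
  proof (rule decseq_SucI, rule subsetI)
    fix n x assume "x \<in> A (Suc n)"
    moreover have "inverse (real (Suc (Suc n))) \<le> inverse (real (Suc n))" by simp
    ultimately show "x \<in> A n" unfolding A_def by (force intro: order_trans)
  qed
  have "(\<Inter>n. A n) = X \<inter> S\<^sup>1"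
  proof (intro equalityI subsetI)
    fix x assume x: "x \<in> (\<Inter>n. A n)"
    have "x \<in> X"
    proof (rule ccontr)
      assume "x \<notin> X"
      then obtain d where d: "d > 0" "\<forall>c\<in>X. d \<le> dist x c"
        using finite_set_avoid[OF assms(1), of x] by metis
      obtain n where "inverse (real (Suc n)) < d" using reals_Archimedean[OF d(1)] by auto
      moreover have "x \<in> A n" using x by auto
      ultimately show False using d(2) by (force simp: A_def)
    qed
    with x show "x \<in> X \<inter> S\<^sup>1" by (auto simp: A_def)
  qed (auto simp: A_def intro!: bexI)
  then have "(\<lambda>n. emeasure lebesgue_circle (A n)) \<longlonglongrightarrow> 0"
    using Lim_emeasure_decseq[of A lebesgue_circle] sets dec
    by (auto simp: emeasure_lebesgue_circle_finite[OF assms(1)] image_subset_iff)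
  then have "\<forall>\<^sub>F n in sequentially. emeasure lebesgue_circle (A n) < ennreal \<epsilon>"
    using assms(2) by (intro order_tendstoD) auto
  then obtain n where "emeasure lebesgue_circle (A n) < ennreal \<epsilon>"
    by (auto simp: eventually_sequentially)
  then show thesis by (intro that[of "inverse (real (Suc n))"]) (auto simp: A_def)
qed

lemma emeasure_lebesgue_circle_openin_pos:
  assumes "openin (top_of_set S\<^sup>1) U" "U \<noteq> {}"
  shows "emeasure lebesgue_circle U > 0"
proof -
  obtain O' where O': "open O'" "U = S\<^sup>1 \<inter> O'" using assms(1) by (auto simp: openin_open)
  obtain x where x: "x \<in> U" using assms(2) by auto
  define t where "t = arc_coord 1 x"
  have t: "0 \<le> t" "t < 1" "arc_point 1 t = x"
    using x O' by (simp_all add: t_def arc_coord_bounds)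
  have "continuous_on UNIV (arc_point 1)" by (intro continuous_intros)
  then have "open (arc_point 1 -` O')" using O'(1) by (rule open_vimage[rotated])
  moreover have "t \<in> arc_point 1 -` O'" using t x O' by auto
  ultimately obtain d where d: "d > 0" "ball t d \<subseteq> arc_point 1 -` O'"
    using open_contains_ball by metis
  \<comment> \<open>Only the right half of the ball around \<open>t\<close> is used, because
    \<open>t\<close> may be 0. It is cut off at 1, where the parametrisation closes up.\<close>
  define u where "u = min 1 (t + d)"
  have "{t<..<u} \<subseteq> {0..<1} \<inter> arc_point 1 -` U"
    using d t O' by (auto simp: u_def dist_real_def subset_eq)
  moreover have "arc_point 1 -` U \<in> sets borel"
    using O' \<open>open (arc_point 1 -` O')\<close> by (simp add: vimage_def)
  ultimately have "emeasure lborel {t<..<u} \<le> emeasure lebesgue_circle U"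
    using openin_sets_borel_circle[OF assms(1)]
    by (subst emeasure_lebesgue_circle) (auto intro!: emeasure_mono)
  moreover have "emeasure lborel {t<..<u} > 0" using t d by (simp add: u_def)
  ultimately show ?thesis by order
qed

lemma null_set_circle_not_openin:
  assumes "F \<in> null_sets lebesgue_circle" "openin (top_of_set S\<^sup>1) U" "U \<noteq> {}"
  obtains x where "x \<in> U" "x \<notin> F"
proof -
  have "\<not> U \<subseteq> F"
    using assms emeasure_mono[of U F lebesgue_circle] emeasure_lebesgue_circle_openin_pos[of U]
    by (auto simp: null_sets_def)
  with that show thesis by auto
qed

section \<open>Weak limits and Birkhoff averages\<close>

lemma integral_dirac_average:
  fixes \<phi> :: "complex \<Rightarrow> real"
  assumes "continuous_on S\<^sup>1 \<phi>" "finite J" "\<And>j. j \<in> J \<Longrightarrow> y j \<in> S\<^sup>1"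
  shows "(\<integral>x. \<phi> x \<partial>dirac_average J y) = (\<Sum>j\<in>J. \<phi> (y j)) / card J"
proof -
  have "y \<in> uniform_count_measure J \<rightarrow>\<^sub>M borel_circle"
    using assms(3) by (auto simp: measurable_def space_uniform_count_measure sets_uniform_count_measure)
  moreover have "\<phi> \<in> borel_measurable borel_circle"
    unfolding borel_circle_def by (rule borel_measurable_continuous_on_restrict[OF assms(1)])
  ultimately show ?thesis
    using assms(2) by (simp add: dirac_average_def integral_distr integral_uniform_count_measure)
qed

lemma borel_probability_dirac_average:
  assumes "finite J" "J \<noteq> {}" "\<And>j. j \<in> J \<Longrightarrow> y j \<in> S\<^sup>1"
  shows "borel_probability (dirac_average J y)"
proof -
  interpret prob_space "uniform_count_measure J"
    using assms by (intro prob_space_uniform_count_measure)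
  have "y \<in> uniform_count_measure J \<rightarrow>\<^sub>M borel_circle"
    using assms(3) by (auto simp: measurable_def space_uniform_count_measure sets_uniform_count_measure)
  then show ?thesis
    by (simp add: borel_probability_def dirac_average_def prob_space_distr)
qed

lemma borel_circle_eq_sigma_sets: "sets borel_circle = sigma_sets S\<^sup>1 {C. closed C \<and> C \<subseteq> S\<^sup>1}"
proof -
  have borel: "sets (borel :: complex measure) = sigma_sets UNIV (Collect closed)"
    by (simp add: borel_eq_closed)
  have "sets borel_circle = (\<inter>) S\<^sup>1 ` sigma_sets UNIV (Collect closed)"
    by (simp only: borel_circle_def sets_restrict_space borel)
  also have "\<dots> = sigma_sets S\<^sup>1 ((\<inter>) S\<^sup>1 ` Collect closed)"
    by (intro sigma_sets_Int sigma_sets.Basic) auto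
  also have "(\<inter>) S\<^sup>1 ` Collect closed = {S\<^sup>1 \<inter> C | C. closed C}" by blast
  also have "{S\<^sup>1 \<inter> C | C. closed C} = {C. closed C \<and> C \<subseteq> S\<^sup>1}"
    using closed_Int[OF closed_sphere] by (auto simp: Int_absorb1 subset_eq)
  finally show ?thesis .
qed

text \<open>These continuous tents decrease to the indicator of the closed set, so integrals of
  continuous functions determine the measure of \<open>C\<close>. The empty set is excluded because
  \<open>infdist x {}\<close> is 0, which would make every tent constantly 1.\<close>

lemma borel_probability_integral_closed_limit:
  assumes \<mu>: "borel_probability \<mu>" and C: "closed C" "C \<subseteq> S\<^sup>1" "C \<noteq> {}"
  shows "(\<lambda>n. \<integral>x. max 0 (1 - real n * infdist x C) \<partial>\<mu>) \<longlonglongrightarrow> measure \<mu> C"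
proof -
  have sets: "sets \<mu> = sets borel_circle" and "prob_space \<mu>"
    using \<mu> by (simp_all add: borel_probability_def)
  interpret prob_space \<mu> by fact
  have C': "C \<in> sets \<mu>" using C by (simp add: sets sets_borel_circleI)
  have "(\<lambda>n. \<integral>x. max 0 (1 - real n * infdist x C) \<partial>\<mu>) \<longlonglongrightarrow> (\<integral>x. indicator C x \<partial>\<mu>)"
  proof (rule integral_dominated_convergence[where w = "\<lambda>_. 1"])
    show "(\<lambda>x. max 0 (1 - real n * infdist x C)) \<in> borel_measurable \<mu>" for n
    proof -
      have "continuous_on S\<^sup>1 (\<lambda>x. max 0 (1 - real n * infdist x C))"
        by (intro continuous_intros)
      then have "(\<lambda>x. max 0 (1 - real n * infdist x C)) \<in> borel_measurable borel_circle"
        unfolding borel_circle_def by (rule borel_measurable_continuous_on_restrict)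
      then show ?thesis by (simp add: measurable_cong_sets[OF sets refl])
    qed
    show "AE x in \<mu>. (\<lambda>n. max 0 (1 - real n * infdist x C)) \<longlonglongrightarrow> indicator C x"
    proof (rule AE_I2)
      fix x
      show "(\<lambda>n. max 0 (1 - real n * infdist x C)) \<longlonglongrightarrow> indicator C x"
      proof (cases "x \<in> C")
        case False
        then have "infdist x C > 0" using C by (simp add: infdist_pos_not_in_closed)
        then have "\<forall>\<^sub>F n in sequentially. 1 / infdist x C \<le> real n"
          using filterlim_real_sequentially by (auto simp: filterlim_at_top)
        then have "\<forall>\<^sub>F n in sequentially. max 0 (1 - real n * infdist x C) = 0"
          by (rule eventually_mono) (use \<open>infdist x C > 0\<close> in \<open>simp add: field_simps\<close>)
        then show ?thesis using False by (simp add: tendsto_eventually)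
      qed simp
    qed
    show "AE x in \<mu>. norm (max 0 (1 - real n * infdist x C)) \<le> 1" for n
      by (auto simp: infdist_nonneg)
  qed (use C' in simp_all)
  then show ?thesis using C' by simp
qed

text \<open>Closed sets are stable under intersection and generate the Borel sets, and the tents
  carry the equality over to them. The purpose is uniqueness of Birkhoff limits.\<close>

lemma borel_probability_eqI:
  assumes "borel_probability \<mu>" "borel_probability \<nu>"
    and eq: "\<And>\<phi> :: complex \<Rightarrow> real. continuous_on S\<^sup>1 \<phi> \<Longrightarrow> (\<integral>x. \<phi> x \<partial>\<mu>) = (\<integral>x. \<phi> x \<partial>\<nu>)"
  shows "\<mu> = \<nu>"
proof -
  interpret \<mu>: prob_space \<mu> using assms by (simp add: borel_probability_def)
  interpret \<nu>: prob_space \<nu> using assms by (simp add: borel_probability_def)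
  have closed: "emeasure \<mu> C = emeasure \<nu> C" if C: "closed C" "C \<subseteq> S\<^sup>1" for C
  proof (cases "C = {}")
    case False
    have "(\<integral>x. max 0 (1 - real n * infdist x C) \<partial>\<mu>) = (\<integral>x. max 0 (1 - real n * infdist x C) \<partial>\<nu>)" for n
      by (intro eq continuous_intros)
    then have "measure \<mu> C = measure \<nu> C"
      using borel_probability_integral_closed_limit[OF assms(1) C False]
        borel_probability_integral_closed_limit[OF assms(2) C False]
      by (simp add: LIMSEQ_unique)
    then show ?thesis by (simp add: \<mu>.emeasure_eq_measure \<nu>.emeasure_eq_measure)
  qed simp
  show ?thesis
  proof (rule measure_eqI_generator_eq[where \<Omega> = "S\<^sup>1" and E = "{C. closed C \<and> C \<subseteq> S\<^sup>1}" and A = "\<lambda>_. S\<^sup>1"])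
    show "Int_stable {C. closed C \<and> C \<subseteq> (S\<^sup>1 :: complex set)}" by (auto simp: Int_stable_def)
  qed (use assms closed in \<open>auto simp: borel_probability_def borel_circle_eq_sigma_sets\<close>)
qed

lemma has_birkhoff_limit_unique:
  assumes "has_birkhoff_limit f x \<mu>" "has_birkhoff_limit f x \<nu>"
  shows "\<mu> = \<nu>"
proof (rule borel_probability_eqI)
  fix \<phi> :: "complex \<Rightarrow> real" assume "continuous_on S\<^sup>1 \<phi>"
  with assms show "(\<integral>x. \<phi> x \<partial>\<mu>) = (\<integral>x. \<phi> x \<partial>\<nu>)"
    by (auto simp: has_birkhoff_limit_def weak_star_limit_def intro: LIMSEQ_unique)
qed (use assms in \<open>simp_all add: has_birkhoff_limit_def\<close>)

lemma cesaro_mean_tendsto_0: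
  fixes u :: "nat \<Rightarrow> real"
  assumes "u \<longlonglongrightarrow> 0"
  shows "(\<lambda>n. (\<Sum>j=1..n. u j) / n) \<longlonglongrightarrow> 0"
proof (rule LIMSEQ_I)
  fix r :: real assume "r > 0"
  then obtain N where N: "\<And>n. n \<ge> N \<Longrightarrow> \<bar>u n\<bar> < r / 2"
    using LIMSEQ_D[OF assms, of "r / 2"] by auto
  define B where "B = (\<Sum>j=1..N. \<bar>u j\<bar>)"
  have "B \<ge> 0" by (simp add: B_def sum_nonneg)
  have bound: "\<bar>\<Sum>j=1..n. u j\<bar> \<le> B + n * (r / 2)" for n
  proof -
    have "\<bar>\<Sum>j=1..n. u j\<bar> \<le> (\<Sum>j=1..n. \<bar>u j\<bar>)" by (rule sum_abs)
    also have "\<dots> \<le> (\<Sum>j=1..n. (if j \<le> N then \<bar>u j\<bar> else 0) + r / 2)"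
      using N \<open>r > 0\<close> by (intro sum_mono) (auto simp: less_imp_le)
    also have "\<dots> = (\<Sum>j\<in>{1..n} \<inter> {..N}. \<bar>u j\<bar>) + n * (r / 2)"
      by (simp only: sum.distrib sum.inter_restrict[OF finite_atLeastAtMost]) (simp add: atMost_def)
    also have "(\<Sum>j\<in>{1..n} \<inter> {..N}. \<bar>u j\<bar>) \<le> B"
      unfolding B_def by (intro sum_mono2) auto
    finally show ?thesis by simp
  qed
  obtain M where M: "real M > 2 * B / r" using reals_Archimedean2 by blast
  show "\<exists>no. \<forall>n\<ge>no. norm ((\<Sum>j=1..n. u j) / n - 0) < r"
  proof (intro exI[of _ "Suc M"] allI impI)
    fix n assume n: "n \<ge> Suc M"
    then have "real n > 2 * B / r" using M by linarith
    then have "B < n * (r / 2)" using \<open>r > 0\<close> by (simp add: field_simps)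
    with bound[of n] have "\<bar>\<Sum>j=1..n. u j\<bar> < n * r" by (simp add: field_simps)
    with n show "norm ((\<Sum>j=1..n. u j) / n - 0) < r" by (simp add: field_simps)
  qed
qed

text \<open>The deviation \<open>D n\<close> of the partial sum from its linear trend is
  \<open>k\<close>-periodic, hence bounded, and disappears after division by
  \<open>n\<close>.\<close>

lemma cesaro_mean_periodic:
  fixes u :: "nat \<Rightarrow> real"
  assumes "k > 0" and per: "\<And>j. u (j + k) = u j"
  shows "(\<lambda>n. (\<Sum>j=1..n. u j) / n) \<longlonglongrightarrow> (\<Sum>j<k. u j) / k"
proof -
  define c where "c = (\<Sum>j<k. u j) / k"
  define D where "D n = (\<Sum>j=1..n. u j) - n * c" for n
  \<comment> \<open>Used from \<open>Suc n\<close> on, this reconciles averages that start at 1 with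
    the sum over one period, which starts at 0.\<close>
  have window: "(\<Sum>j=n..<n+k. u j) = (\<Sum>j<k. u j)" for n
  proof (induction n)
    case (Suc n)
    have "(\<Sum>j=n..<Suc (n+k). u j) = u n + (\<Sum>j=Suc n..<Suc n+k. u j)"
      using \<open>k > 0\<close> by (subst sum.atLeast_Suc_lessThan) auto
    moreover have "(\<Sum>j=n..<Suc (n+k). u j) = (\<Sum>j=n..<n+k. u j) + u (n + k)"
      by (subst sum.atLeastLessThan_Suc) auto
    ultimately show ?case using Suc per[of n] by simp
  qed (simp add: atLeast0LessThan)
  have D_per: "D (n + k) = D n" for n
  proof -
    have "(\<Sum>j=1..n+k. u j) = (\<Sum>j=1..n. u j) + (\<Sum>j=Suc n..<Suc n + k. u j)"
      using sum.ub_add_nat[of 1 n u k] by (simp add: atLeastLessThanSuc_atLeastAtMost)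
    then show ?thesis
      using window[of "Suc n"] \<open>k > 0\<close> by (simp only: D_def c_def) (simp add: field_simps)
  qed
  have D_bound: "\<bar>D n\<bar> \<le> (\<Sum>j<k. \<bar>D j\<bar>)" for n
  proof (induction n rule: less_induct)
    case (less n)
    show ?case
    proof (cases "n < k")
      case True
      then show ?thesis by (intro member_le_sum) auto
    next
      case False
      then show ?thesis using less[of "n - k"] D_per[of "n - k"] \<open>k > 0\<close> by simp
    qed
  qed
  have "(\<lambda>n. (\<Sum>j<k. \<bar>D j\<bar>) / real n) \<longlonglongrightarrow> 0"
    by (rule lim_const_over_n)
  then have "(\<lambda>n. D n / real n) \<longlonglongrightarrow> 0"
    by (rule Lim_null_comparison[rotated]) (auto intro!: always_eventually divide_right_mono D_bound)
  then have "(\<lambda>n. c + D n / real n) \<longlonglongrightarrow> c + 0" by (intro tendsto_intros)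
  moreover have "\<forall>\<^sub>F n in sequentially. c + D n / real n = (\<Sum>j=1..n. u j) / n"
    using eventually_gt_at_top[of 0] by eventually_elim (simp add: D_def field_simps)
  ultimately show ?thesis
    unfolding c_def by (auto intro: Lim_transform_eventually)
qed

text \<open>Bridges the convergence known for the iterates of f^q and the Birkhoff averages, which
  run over all iterates of f.\<close>

lemma tendsto_of_residue_classes:
  fixes u :: "nat \<Rightarrow> real"
  assumes "q > 0" "\<And>r. r < q \<Longrightarrow> (\<lambda>m. u (m * q + r)) \<longlonglongrightarrow> 0"
  shows "u \<longlonglongrightarrow> 0"
proof (rule LIMSEQ_I)
  fix e :: real assume "e > 0"
  then have "\<exists>M. \<forall>m\<ge>M. norm (u (m * q + r) - 0) < e" if "r < q" for r
    using LIMSEQ_D[OF assms(2)[OF that]] by blast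
  then obtain M where M: "\<And>r m. r < q \<Longrightarrow> m \<ge> M r \<Longrightarrow> norm (u (m * q + r) - 0) < e"
    by metis
  \<comment> \<open>The sum of all \<open>M r\<close> serves as a common upper bound of the finitely
    many thresholds; the factor \<open>q\<close> converts it from quotients to indices.\<close>
  show "\<exists>no. \<forall>n\<ge>no. norm (u n - 0) < e"
  proof (intro exI[of _ "(\<Sum>r<q. M r) * q"] allI impI)
    fix n assume "n \<ge> (\<Sum>r<q. M r) * q"
    then have "n div q \<ge> (\<Sum>r<q. M r)"
      using assms(1) by (metis div_le_mono div_mult_self_is_m)
    moreover have "n mod q < q" using assms(1) by simp
    moreover have "M (n mod q) \<le> (\<Sum>r<q. M r)" using assms(1) by (intro member_le_sum) auto
    ultimately have "norm (u (n div q * q + n mod q) - 0) < e" by (intro M) auto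
    then show "norm (u n - 0) < e" by simp
  qed
qed

section \<open>Circle homeomorphisms with a periodic point\<close>

lemma emeasure_dirac_average_eq_1:
  assumes "finite J" "J \<noteq> {}" "A \<in> sets borel_circle" "\<And>j. j \<in> J \<Longrightarrow> y j \<in> A"
  shows "emeasure (dirac_average J y) A = 1"
proof -
  have "y j \<in> S\<^sup>1" if "j \<in> J" for j
    using assms(4)[OF that] sets.sets_into_space[OF assms(3)] by auto
  then have "emeasure (dirac_average J y) A = (\<Sum>j\<in>J. emeasure (return borel_circle (y j)) A) / card J"
    using assms by (intro emeasure_dirac_average)
  also have "(\<Sum>j\<in>J. emeasure (return borel_circle (y j)) A) = (\<Sum>j\<in>J. 1)"
    using assms by (intro sum.cong) auto
  finally show ?thesis
    using assms by (simp add: ennreal_divide_self card_gt_0_iff ennreal_of_nat_eq_real_of_nat)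
qed

lemma emeasure_dirac_average_eq_0:
  assumes "finite J" "J \<noteq> {}" "A \<in> sets borel_circle" "\<And>j. j \<in> J \<Longrightarrow> y j \<in> S\<^sup>1 - A"
  shows "emeasure (dirac_average J y) A = 0"
proof -
  have "emeasure (dirac_average J y) A = (\<Sum>j\<in>J. emeasure (return borel_circle (y j)) A) / card J"
    using assms by (intro emeasure_dirac_average) auto
  also have "(\<Sum>j\<in>J. emeasure (return borel_circle (y j)) A) = (\<Sum>j\<in>J. 0)"
    using assms by (intro sum.cong) auto
  finally show ?thesis by simp
qed

section \<open>Measures carried by periodic orbits\<close>

definition minimal_period :: "(complex \<Rightarrow> complex) \<Rightarrow> complex \<Rightarrow> nat" where
  "minimal_period f y = (LEAST k. k > 0 \<and> (f ^^ k) y = y)"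

definition orbit_measure :: "(complex \<Rightarrow> complex) \<Rightarrow> complex \<Rightarrow> complex measure" where
  "orbit_measure f y = periodic_dirac f y (minimal_period f y)"

lemma minimal_period:
  assumes "q > 0" "(f ^^ q) y = y"
  shows "minimal_period f y > 0" "(f ^^ minimal_period f y) y = y"
    "\<And>j. 0 < j \<Longrightarrow> j < minimal_period f y \<Longrightarrow> (f ^^ j) y \<noteq> y"
proof -
  have "minimal_period f y > 0 \<and> (f ^^ minimal_period f y) y = y"
    unfolding minimal_period_def by (rule LeastI[of _ q]) (use assms in auto)
  then show "minimal_period f y > 0" "(f ^^ minimal_period f y) y = y" by auto
  show "(f ^^ j) y \<noteq> y" if "0 < j" "j < minimal_period f y" for j
    using not_less_Least that unfolding minimal_period_def by blast
qed

lemma periodic_point_minimal_period: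
  "y \<in> S\<^sup>1 \<Longrightarrow> q > 0 \<Longrightarrow> (f ^^ q) y = y \<Longrightarrow> periodic_point f y (minimal_period f y)"
  using minimal_period[of q f y] by (auto simp: periodic_point_def)

lemma orbit_measure_emeasure:
  assumes f: "circle_homeo f" and y: "y \<in> S\<^sup>1" "q > 0" "(f ^^ q) y = y" and A: "A \<in> sets borel_circle"
  shows "(\<And>j. (f ^^ j) y \<in> A) \<Longrightarrow> emeasure (orbit_measure f y) A = 1"
    and "(\<And>j. (f ^^ j) y \<notin> A) \<Longrightarrow> emeasure (orbit_measure f y) A = 0"
proof -
  have "{..<minimal_period f y} \<noteq> {}"
    using minimal_period(1)[OF y(2,3)] by (simp add: lessThan_empty_iff)
  moreover have "(f ^^ j) y \<in> S\<^sup>1" for j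
    using circle_homeo_funpow[OF f] y circle_homeoD(4) by blast
  ultimately show "(\<And>j. (f ^^ j) y \<in> A) \<Longrightarrow> emeasure (orbit_measure f y) A = 1"
    and "(\<And>j. (f ^^ j) y \<notin> A) \<Longrightarrow> emeasure (orbit_measure f y) A = 0"
    unfolding orbit_measure_def periodic_dirac_def
    using A by (auto intro!: emeasure_dirac_average_eq_1 emeasure_dirac_average_eq_0)
qed

text \<open>The f-orbit of \<open>x\<close> is asymptotic to that of \<open>y\<close>: along each
  residue class modulo \<open>q\<close> this is continuity of f^r at \<open>y\<close>. A continuous
  observable therefore has the same averages along both orbits, and those of \<open>y\<close> are
  periodic. The given \<open>q\<close> may be any multiple of the minimal period.\<close>

lemma has_birkhoff_limit_orbit_measure:
  assumes f: "circle_homeo f" and x: "x \<in> S\<^sup>1" and y: "y \<in> S\<^sup>1" "q > 0" "(f ^^ q) y = y"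
    and lim: "(\<lambda>n. ((f ^^ q) ^^ n) x) \<longlonglongrightarrow> y"
  shows "has_birkhoff_limit f x (orbit_measure f y)"
proof -
  define k where "k = minimal_period f y"
  have k: "k > 0" "(f ^^ k) y = y" using minimal_period[OF y(2,3)] by (auto simp: k_def)
  have in_circle: "(f ^^ n) z \<in> S\<^sup>1" if "z \<in> S\<^sup>1" for n z
    using circle_homeo_funpow[OF f] that circle_homeoD(4) by blast
  have weak: "(\<lambda>n. \<integral>z. \<phi> z \<partial>dirac_average {1..n} (\<lambda>j. (f ^^ j) x)) \<longlonglongrightarrow> (\<integral>z. \<phi> z \<partial>orbit_measure f y)"
    if \<phi>: "continuous_on S\<^sup>1 \<phi>" for \<phi> :: "complex \<Rightarrow> real"
  proof -
    define u where "u n = \<phi> ((f ^^ n) x) - \<phi> ((f ^^ n) y)" for n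
    have "u \<longlonglongrightarrow> 0"
    proof (rule tendsto_of_residue_classes[OF y(2)])
      fix r assume "r < q"
      have cont: "continuous_on S\<^sup>1 (\<lambda>z. \<phi> ((f ^^ r) z))"
        by (rule continuous_on_compose2[OF \<phi> circle_homeoD(1)[OF circle_homeo_funpow[OF f]]])
          (use in_circle in auto)
      have "((f ^^ q) ^^ n) x \<in> S\<^sup>1" for n
        using in_circle x by (simp add: funpow_mult)
      then have "(\<lambda>m. \<phi> ((f ^^ r) (((f ^^ q) ^^ m) x))) \<longlonglongrightarrow> \<phi> ((f ^^ r) y)"
        by (intro continuous_on_tendsto_compose[OF cont lim y(1)]) auto
      moreover have "(f ^^ (m * q + r)) y = (f ^^ r) y" for m
      proof (induction m)
        case (Suc m)
        have "(f ^^ (Suc m * q + r)) y = (f ^^ (m * q + r)) ((f ^^ q) y)"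
          by (simp add: algebra_simps flip: funpow_add[unfolded o_def, THEN fun_cong])
        then show ?case using Suc y by simp
      qed simp
      moreover have "(f ^^ (m * q + r)) x = (f ^^ r) (((f ^^ q) ^^ m) x)" for m
        by (simp add: add.commute mult.commute funpow_add funpow_mult)
      ultimately show "(\<lambda>m. u (m * q + r)) \<longlonglongrightarrow> 0"
        by (simp add: u_def LIM_zero)
    qed
    then have "(\<lambda>n. (\<Sum>j=1..n. u j) / n) \<longlonglongrightarrow> 0" by (rule cesaro_mean_tendsto_0)
    moreover have "(\<lambda>n. (\<Sum>j=1..n. \<phi> ((f ^^ j) y)) / n) \<longlonglongrightarrow> (\<Sum>j<k. \<phi> ((f ^^ j) y)) / k"
      by (rule cesaro_mean_periodic) (use k in \<open>simp_all add: funpow_add\<close>)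
    ultimately have "(\<lambda>n. (\<Sum>j=1..n. u j) / n + (\<Sum>j=1..n. \<phi> ((f ^^ j) y)) / n)
        \<longlonglongrightarrow> 0 + (\<Sum>j<k. \<phi> ((f ^^ j) y)) / k"
      by (rule tendsto_add)
    moreover have "(\<Sum>j=1..n. u j) / n + (\<Sum>j=1..n. \<phi> ((f ^^ j) y)) / n = (\<Sum>j=1..n. \<phi> ((f ^^ j) x)) / n" for n
      by (simp add: u_def sum_subtractf diff_divide_distrib)
    moreover have "(\<integral>z. \<phi> z \<partial>dirac_average {1..n} (\<lambda>j. (f ^^ j) x)) = (\<Sum>j=1..n. \<phi> ((f ^^ j) x)) / n" for n
      using \<phi> in_circle[OF x] by (subst integral_dirac_average) auto
    moreover have "(\<integral>z. \<phi> z \<partial>orbit_measure f y) = (\<Sum>j<k. \<phi> ((f ^^ j) y)) / k"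
      unfolding orbit_measure_def periodic_dirac_def k_def[symmetric]
      using \<phi> in_circle[OF y(1)] by (subst integral_dirac_average) auto
    ultimately show ?thesis by simp
  qed
  have "borel_probability (orbit_measure f y)"
    unfolding orbit_measure_def periodic_dirac_def k_def[symmetric]
    by (rule borel_probability_dirac_average) (use k in_circle[OF y(1)] in \<open>auto simp: lessThan_empty_iff\<close>)
  with weak show ?thesis by (simp add: has_birkhoff_limit_def weak_star_limit_def)
qed

section \<open>Iteration of increasing interval maps\<close>

locale interval_homeo =
  fixes H :: "real \<Rightarrow> real"
  assumes bij: "bij_betw H {0<..<1} {0<..<1}" and mono: "strict_mono_on {0<..<1} H"
begin

lemma in_interval: "t \<in> {0<..<1} \<Longrightarrow> H t \<in> {0<..<1}"
  using bij by (auto simp: bij_betw_def)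

lemma funpow_in_interval: "t \<in> {0<..<1} \<Longrightarrow> (H ^^ n) t \<in> {0<..<1}"
  by (induction n) (use in_interval in auto)

lemma funpow_mono: "s \<in> {0<..<1} \<Longrightarrow> t \<in> {0<..<1} \<Longrightarrow> s \<le> t \<Longrightarrow> (H ^^ n) s \<le> (H ^^ n) t"
proof (induction n)
  case (Suc n)
  then show ?case
    using strict_mono_on_leD[OF mono] funpow_in_interval by simp
qed simp

text \<open>One comparison of \<open>t\<close> with \<open>H t\<close> decides the direction of the
  whole orbit, since \<open>H\<close> is increasing. The limit may be an endpoint of the
  interval.\<close>

lemma funpow_convergent:
  assumes t: "t \<in> {0<..<1}"
  shows "convergent (\<lambda>n. (H ^^ n) t)"
proof -
  have "monoseq (\<lambda>n. (H ^^ n) t)"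
  proof (cases "t \<le> H t")
    case True
    then show ?thesis
      using funpow_mono[OF t in_interval[OF t]]
      by (auto simp: monoseq_Suc funpow_swap1)
  next
    case False
    then show ?thesis
      using funpow_mono[OF in_interval[OF t] t]
      by (auto simp: monoseq_Suc funpow_swap1)
  qed
  moreover have "Bseq (\<lambda>n. (H ^^ n) t)"
    using funpow_in_interval[OF t] by (intro BseqI'[where K = 1]) (auto simp: less_imp_le)
  ultimately show ?thesis by (rule Bseq_monoseq_convergent[rotated])
qed

text \<open>The orbit of \<open>u\<close> is squeezed between the orbit of \<open>t\<close> and the
  same orbit shifted by one step.\<close>

lemma funpow_same_limit:
  assumes t: "t \<in> {0<..<1}" "u \<in> {0<..<1}" and u: "t \<le> u \<and> u \<le> H t \<or> H t \<le> u \<and> u \<le> t"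
    and lim: "(\<lambda>n. (H ^^ n) t) \<longlonglongrightarrow> l"
  shows "(\<lambda>n. (H ^^ n) u) \<longlonglongrightarrow> l"
proof -
  have lim': "(\<lambda>n. (H ^^ n) (H t)) \<longlonglongrightarrow> l"
    using LIMSEQ_Suc[OF lim] by (simp add: funpow_swap1)
  from u show ?thesis
  proof
    assume u: "t \<le> u \<and> u \<le> H t"
    show ?thesis
      by (rule tendsto_sandwich[OF _ _ lim lim'])
         (use u funpow_mono[OF t] funpow_mono[OF t(2) in_interval[OF t(1)]] in auto)
  next
    assume u: "H t \<le> u \<and> u \<le> t"
    show ?thesis
      by (rule tendsto_sandwich[OF _ _ lim' lim])
         (use u funpow_mono[OF t(2,1)] funpow_mono[OF in_interval[OF t(1)] t(2)] in auto)
  qed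
qed

end

text \<open>Squaring the return map makes its lift increasing even when \<open>f\<close> reverses orientation.\<close>
lemma increasing_return_lift:
  assumes f: "circle_homeo f" and p: "p \<in> S\<^sup>1" "k > 0" "(f ^^ k) p = p"
  obtains q H where "q > 0" "(f ^^ q) p = p" "interval_homeo H"
    "\<And>t. t \<in> {0<..<1} \<Longrightarrow> (f ^^ q) (arc_point p t) = arc_point p (H t)"
proof -
  obtain H where H: "\<And>t. t \<in> {0<..<1} \<Longrightarrow> (f ^^ k) (arc_point p t) = arc_point p (H t)"
      "bij_betw H {0<..<1} {0<..<1}" "strict_mono_on {0<..<1} H \<or> strict_antimono_on {0<..<1} H"
    using circle_homeo_fixing_lift[OF circle_homeo_funpow[OF f] p(1,3)] by metis
  have into: "H t \<in> {0<..<1}" if "t \<in> {0<..<1}" for t using H(2) that by (auto simp: bij_betw_def)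
  from H(3) show thesis
  proof
    assume "strict_mono_on {0<..<1} H"
    with H p that[of k H] show thesis by (simp add: interval_homeo_def)
  next
    assume anti: "strict_antimono_on {0<..<1} H"
    have "strict_mono_on {0<..<1} (H \<circ> H)"
      using anti into by (auto simp: monotone_on_def)
    moreover have "bij_betw (H \<circ> H) {0<..<1} {0<..<1}" using H(2) by (rule bij_betw_trans) (rule H(2))
    moreover have "(f ^^ (k + k)) (arc_point p t) = arc_point p ((H \<circ> H) t)" if "t \<in> {0<..<1}" for t
      using H(1) into that by (simp add: funpow_add)
    moreover have "(f ^^ (k + k)) p = p" using p by (simp add: funpow_add)
    ultimately show thesis using p that[of "k + k" "H \<circ> H"] by (simp add: interval_homeo_def)
  qed
qed

locale periodic_circle_homeo = interval_homeo H for H +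
  fixes f :: "complex \<Rightarrow> complex" and p :: complex and q :: nat
  assumes f: "circle_homeo f" and p: "p \<in> S\<^sup>1" and q: "q > 0" and fix_p: "(f ^^ q) p = p"
    and lift: "\<And>t. t \<in> {0<..<1} \<Longrightarrow> (f ^^ q) (arc_point p t) = arc_point p (H t)"
begin

lemma return_homeo: "circle_homeo (f ^^ q)"
  using f by (rule circle_homeo_funpow)

lemma funpow_in_circle: "x \<in> S\<^sup>1 \<Longrightarrow> (f ^^ n) x \<in> S\<^sup>1"
  using circle_homeo_funpow[OF f] circle_homeoD(4) by blast

lemma return_funpow_in_circle: "x \<in> S\<^sup>1 \<Longrightarrow> ((f ^^ q) ^^ n) x \<in> S\<^sup>1"
  by (simp only: funpow_mult funpow_in_circle)

lemma return_funpow_lift: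
  "t \<in> {0<..<1} \<Longrightarrow> ((f ^^ q) ^^ n) (arc_point p t) = arc_point p ((H ^^ n) t)"
  by (induction n) (use lift funpow_in_interval in auto)

lemma coord_in_interval: "x \<in> S\<^sup>1 \<Longrightarrow> x \<noteq> p \<Longrightarrow> arc_coord p x \<in> {0<..<1}"
  using arc_coord_pos[OF p] arc_coord_bounds by auto

definition fixed_points :: "complex set" where
  "fixed_points = {x \<in> S\<^sup>1. (f ^^ q) x = x}"

definition orbit_limit :: "complex \<Rightarrow> complex" where
  "orbit_limit x = lim (\<lambda>n. ((f ^^ q) ^^ n) x)"

text \<open>The coordinates converge in the closed unit interval. Both of its ends are sent to
  \<open>p\<close> by \<open>arc_point p\<close>, so orbits that leave through an end converge as
  well.\<close>

lemma return_funpow_convergent: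
  assumes x: "x \<in> S\<^sup>1"
  shows "convergent (\<lambda>n. ((f ^^ q) ^^ n) x)"
proof (cases "x = p")
  case True
  have "((f ^^ q) ^^ n) p = p" for n by (induction n) (use fix_p in auto)
  with True show ?thesis by (simp add: convergent_const)
next
  case False
  obtain l where l: "(\<lambda>n. (H ^^ n) (arc_coord p x)) \<longlonglongrightarrow> l"
    using funpow_convergent[OF coord_in_interval[OF x False]] by (auto simp: convergent_def)
  have "continuous_on UNIV (arc_point p)" by (intro continuous_intros)
  then have "(\<lambda>n. arc_point p ((H ^^ n) (arc_coord p x))) \<longlonglongrightarrow> arc_point p l"
    using l by (auto intro: continuous_on_tendsto_compose)
  then show ?thesis
    using return_funpow_lift[OF coord_in_interval[OF x False]] x p by (auto simp: convergent_def)
qed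

lemma orbit_limit_tendsto: "x \<in> S\<^sup>1 \<Longrightarrow> (\<lambda>n. ((f ^^ q) ^^ n) x) \<longlonglongrightarrow> orbit_limit x"
  unfolding orbit_limit_def using return_funpow_convergent by (simp add: convergent_LIMSEQ_iff)

lemma orbit_limit_in_closed:
  assumes "x \<in> S\<^sup>1" "closed D" "\<And>n. ((f ^^ q) ^^ n) x \<in> D"
  shows "orbit_limit x \<in> D"
  by (rule closed_sequentially[OF assms(2,3) orbit_limit_tendsto[OF assms(1)]])

lemma orbit_limit_fixed:
  assumes x: "x \<in> S\<^sup>1"
  shows "orbit_limit x \<in> fixed_points"
proof -
  have L: "orbit_limit x \<in> S\<^sup>1"
    using x return_funpow_in_circle[OF x] by (intro orbit_limit_in_closed) auto
  have "(\<lambda>n. (f ^^ q) (((f ^^ q) ^^ n) x)) \<longlonglongrightarrow> (f ^^ q) (orbit_limit x)"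
    using return_funpow_in_circle[OF x]
    by (intro continuous_on_tendsto_compose[OF circle_homeoD(1)[OF return_homeo] orbit_limit_tendsto[OF x] L]) auto
  moreover have "(\<lambda>n. (f ^^ q) (((f ^^ q) ^^ n) x)) \<longlonglongrightarrow> orbit_limit x"
    using LIMSEQ_Suc[OF orbit_limit_tendsto[OF x]] by simp
  ultimately show ?thesis using L by (auto simp: fixed_points_def intro: LIMSEQ_unique)
qed

lemma birkhoff_orbit_limit:
  assumes x: "x \<in> S\<^sup>1"
  shows "has_birkhoff_limit f x (orbit_measure f (orbit_limit x))"
  using orbit_limit_fixed[OF x] q orbit_limit_tendsto[OF x]
  by (intro has_birkhoff_limit_orbit_measure[OF f x]) (auto simp: fixed_points_def)

lemma basin_orbit_measure:
  "basin f \<mu> = {x \<in> S\<^sup>1. orbit_measure f (orbit_limit x) = \<mu>}"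
  unfolding basin_def using birkhoff_orbit_limit has_birkhoff_limit_unique by blast

text \<open>The orbit of \<open>y\<close> is itself the test set: it has mass 1 for
  \<open>y\<close>, and mass 0 for every \<open>z\<close> whose orbit avoids it.\<close>

lemma orbit_measure_eq_imp_same_orbit:
  assumes "y \<in> fixed_points" "z \<in> fixed_points" "orbit_measure f y = orbit_measure f z"
  shows "z \<in> (\<lambda>j. (f ^^ j) y) ` {..<q}"
proof (rule ccontr)
  define A where "A = (\<lambda>j. (f ^^ j) y) ` {..<q}"
  have A: "(f ^^ j) y \<in> A" for j
  proof -
    have "(f ^^ (j mod q)) y = (f ^^ j) y"
      using assms(1) by (intro funpow_mod_eq) (simp add: fixed_points_def)
    then show ?thesis unfolding A_def using q by (metis imageI lessThan_iff mod_less_divisor)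
  qed
  have sets: "A \<in> sets borel_circle"
    using assms(1) funpow_in_circle
    by (auto simp: A_def fixed_points_def intro!: sets_borel_circleI borel_closed finite_imp_closed)
  assume z: "z \<notin> (\<lambda>j. (f ^^ j) y) ` {..<q}"
  have "(f ^^ j) z \<notin> A" for j
  proof
    assume "(f ^^ j) z \<in> A"
    then obtain i where i: "(f ^^ j) z = (f ^^ i) y" by (auto simp: A_def)
    \<comment> \<open>On points fixed by f^q the power \<open>j * q - j\<close> of f undoes the
      power \<open>j\<close>. Hence a visit of the orbit of \<open>z\<close> to \<open>A\<close>
      would put \<open>z\<close> itself into \<open>A\<close>.\<close>
    have "(f ^^ (j * q)) z = z"
    proof -
      have "((f ^^ q) ^^ n) z = z" for n
        by (induction n) (use assms(2) in \<open>auto simp: fixed_points_def\<close>)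
      then show ?thesis by (simp add: funpow_mult mult.commute)
    qed
    moreover have "(f ^^ (j * q)) z = (f ^^ (j * q - j)) ((f ^^ j) z)"
      using q by (simp flip: funpow_add[unfolded o_def, THEN fun_cong])
    ultimately have "z = (f ^^ (j * q - j + i)) y" by (simp add: i funpow_add)
    with A z show False by (auto simp: A_def[symmetric])
  qed
  then have "emeasure (orbit_measure f z) A = 0"
    using assms(2) q sets by (intro orbit_measure_emeasure(2)[OF f]) (auto simp: fixed_points_def)
  moreover have "emeasure (orbit_measure f y) A = 1"
    using assms(1) q sets A by (intro orbit_measure_emeasure(1)[OF f]) (auto simp: fixed_points_def)
  ultimately show False using assms(3) by simp
qed

lemma orbit_limit_measurable: "orbit_limit \<in> borel_measurable borel_circle"
proof (rule borel_measurable_LIMSEQ_metric)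
  show "(\<lambda>x. ((f ^^ q) ^^ n) x) \<in> borel_measurable borel_circle" for n
    unfolding borel_circle_def
    by (rule borel_measurable_continuous_on_restrict) (rule circle_homeoD(1)[OF circle_homeo_funpow[OF return_homeo]])
qed (use orbit_limit_tendsto in auto)

text \<open>A measure determines its orbit, so only finitely many limit points lead to \<mu>. The
  basin is the preimage of this finite set under the measurable map
  \<open>orbit_limit\<close>.\<close>

lemma basin_measurable: "basin f \<mu> \<in> sets borel_circle"
proof (cases "basin f \<mu> = {}")
  case False
  then obtain x where x: "x \<in> S\<^sup>1" "orbit_measure f (orbit_limit x) = \<mu>"
    by (auto simp: basin_orbit_measure)
  define B where "B = {y \<in> fixed_points. orbit_measure f y = \<mu>}"
  have "B \<subseteq> (\<lambda>j. (f ^^ j) (orbit_limit x)) ` {..<q}"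
    using orbit_measure_eq_imp_same_orbit orbit_limit_fixed[OF x(1)] x(2) by (auto simp: B_def)
  then have "finite B" by (rule finite_subset) auto
  then have "orbit_limit -` B \<inter> space borel_circle \<in> sets borel_circle"
    by (intro measurable_sets[OF orbit_limit_measurable]) (auto intro: borel_closed finite_imp_closed)
  moreover have "basin f \<mu> = orbit_limit -` B \<inter> space borel_circle"
    using orbit_limit_fixed by (auto simp: basin_orbit_measure B_def)
  ultimately show ?thesis by simp
qed simp

text \<open>Between \<open>t\<close> and \<open>H t\<close> lies a fundamental domain of the
  dynamics, all of whose points share the limit of \<open>t\<close>. Minimum and maximum cover both
  directions of motion.\<close>

lemma wandering_interval:
  assumes x: "x \<in> S\<^sup>1 - fixed_points"
  obtains a b where "0 \<le> a" "a < b" "b \<le> 1"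
    "\<And>u. u \<in> {a<..<b} \<Longrightarrow> orbit_limit (arc_point p u) = orbit_limit x"
proof -
  define t where "t = arc_coord p x"
  have "x \<noteq> p" using x p fix_p by (auto simp: fixed_points_def)
  then have t: "t \<in> {0<..<1}" using x coord_in_interval by (auto simp: t_def)
  have xt: "x = arc_point p t" using x p by (simp add: t_def)
  have "H t \<noteq> t" using x xt lift[OF t] by (auto simp: fixed_points_def)
  have same: "orbit_limit (arc_point p u) = orbit_limit x" if u: "u \<in> {min t (H t)<..<max t (H t)}" for u
  proof -
    obtain l where l: "(\<lambda>n. (H ^^ n) t) \<longlonglongrightarrow> l"
      using funpow_convergent[OF t] by (auto simp: convergent_def)
    have u': "u \<in> {0<..<1}" using u t in_interval[OF t] by auto
    have l': "(\<lambda>n. (H ^^ n) u) \<longlonglongrightarrow> l"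
      by (rule funpow_same_limit[OF t u' _ l]) (use u in auto)
    have cont: "continuous_on UNIV (arc_point p)" by (intro continuous_intros)
    have "orbit_limit (arc_point p v) = arc_point p l"
      if "v \<in> {0<..<1}" "(\<lambda>n. (H ^^ n) v) \<longlonglongrightarrow> l" for v
    proof -
      have "(\<lambda>n. arc_point p ((H ^^ n) v)) \<longlonglongrightarrow> arc_point p l"
        using that cont by (auto intro: continuous_on_tendsto_compose)
      then show ?thesis
        using return_funpow_lift[OF that(1)] by (simp add: orbit_limit_def limI)
    qed
    then show ?thesis using t u' l l' xt by metis
  qed
  show thesis
    by (rule that[of "min t (H t)" "max t (H t)"]) (use same t in_interval[OF t] \<open>H t \<noteq> t\<close> in auto)
qed

lemma physical_orbit_measure:
  assumes x: "x \<in> S\<^sup>1 - fixed_points"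
  shows "physical_measure f (orbit_measure f (orbit_limit x))"
proof -
  obtain a b where ab: "0 \<le> a" "a < b" "b \<le> 1"
    "\<And>u. u \<in> {a<..<b} \<Longrightarrow> orbit_limit (arc_point p u) = orbit_limit x"
    using wandering_interval[OF x] by metis
  let ?U = "arc_point p ` {a<..<b}" and ?B = "basin f (orbit_measure f (orbit_limit x))"
  have "emeasure lebesgue_circle ?U > 0"
    using ab p by (intro emeasure_lebesgue_circle_openin_pos openin_arc_point_image) auto
  moreover have "emeasure lebesgue_circle ?U \<le> emeasure lebesgue_circle ?B"
    using ab p basin_measurable by (intro emeasure_mono) (auto simp: basin_orbit_measure)
  moreover have "borel_probability (orbit_measure f (orbit_limit x))"
    using birkhoff_orbit_limit x by (auto simp: has_birkhoff_limit_def)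
  ultimately show ?thesis by (simp add: physical_measure_def order.strict_trans2)
qed

text \<open>A basin of positive measure cannot be contained in the null set of fixed points, so it
  contains a wandering point, and with it an entire open arc.\<close>

lemma physical_measures_eq:
  assumes null: "emeasure lebesgue_circle fixed_points = 0" "fixed_points \<in> sets borel_circle"
  shows "{\<mu>. physical_measure f \<mu>} = (\<lambda>x. orbit_measure f (orbit_limit x)) ` (S\<^sup>1 - fixed_points)"
proof (intro equalityI subsetI)
  fix \<mu> assume "\<mu> \<in> {\<mu>. physical_measure f \<mu>}"
  then have "emeasure lebesgue_circle (basin f \<mu>) > 0" by (simp add: physical_measure_def)
  then have "\<not> basin f \<mu> \<subseteq> fixed_points"
    using emeasure_mono[of "basin f \<mu>" fixed_points lebesgue_circle] null by auto
  then show "\<mu> \<in> (\<lambda>x. orbit_measure f (orbit_limit x)) ` (S\<^sup>1 - fixed_points)"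
    by (auto simp: basin_orbit_measure)
qed (use physical_orbit_measure in auto)

lemma countable_limits: "countable (orbit_limit ` (S\<^sup>1 - fixed_points))"
proof (rule countable_subset)
  show "orbit_limit ` (S\<^sup>1 - fixed_points) \<subseteq> (\<lambda>r. orbit_limit (arc_point p r)) ` \<rat>"
  proof (rule image_subsetI)
    fix x assume "x \<in> S\<^sup>1 - fixed_points"
    then obtain a b where ab: "0 \<le> a" "a < b" "b \<le> 1"
      "\<And>u. u \<in> {a<..<b} \<Longrightarrow> orbit_limit (arc_point p u) = orbit_limit x"
      using wandering_interval by metis
    obtain r where "r \<in> \<rat>" "a < r" "r < b" using Rats_dense_in_real[OF ab(2)] by auto
    with ab(4)[of r] show "orbit_limit x \<in> (\<lambda>r. orbit_limit (arc_point p r)) ` \<rat>" by force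
  qed
qed (simp add: countable_rat)

text \<open>Each trap contains an open set, hence a point that f^q does not fix. Its limit stays in
  the closed trap, so the resulting measure has mass 1 there and mass 0 on the other traps.
  Finiteness is a premise because \<open>card\<close> is 0 on infinite sets.\<close>

lemma disjoint_traps_le_card_physical:
  assumes null: "emeasure lebesgue_circle fixed_points = 0" "fixed_points \<in> sets borel_circle"
    and D: "\<And>l. l < N \<Longrightarrow> closed (D l) \<and> D l \<subseteq> S\<^sup>1 \<and> f ` D l \<subseteq> D l"
    and U: "\<And>l. l < N \<Longrightarrow> \<exists>U. openin (top_of_set S\<^sup>1) U \<and> U \<noteq> {} \<and> U \<subseteq> D l"
    and disj: "\<And>i j. i < N \<Longrightarrow> j < N \<Longrightarrow> i \<noteq> j \<Longrightarrow> D i \<inter> D j = {}"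
    and fin: "finite {\<mu>. physical_measure f \<mu>}"
  shows "N \<le> card {\<mu>. physical_measure f \<mu>}"
proof -
  have "\<exists>x. x \<in> D l - fixed_points" if "l < N" for l
    using U[OF that] null_set_circle_not_openin[of fixed_points] null
    by (metis DiffI null_setsI sets_lebesgue_circle subsetD)
  then obtain x where x: "\<And>l. l < N \<Longrightarrow> x l \<in> D l - fixed_points" by metis
  define \<mu> where "\<mu> l = orbit_measure f (orbit_limit (x l))" for l
  have inv: "(f ^^ n) z \<in> D l" if "l < N" "z \<in> D l" for n z l
    using D[OF that(1)] that(2) by (induction n) auto
  have lim: "orbit_limit (x l) \<in> D l" if "l < N" for l
    using D[OF that] x[OF that] inv[OF that]
    by (intro orbit_limit_in_closed) (auto simp: funpow_mult)
  have sets: "D l \<in> sets borel_circle" if "l < N" for l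
    using D[OF that] by (simp add: sets_borel_circleI)
  have per: "orbit_limit (x l) \<in> S\<^sup>1" "(f ^^ q) (orbit_limit (x l)) = orbit_limit (x l)" if "l < N" for l
  proof -
    have "x l \<in> S\<^sup>1" using D[OF that] x[OF that] by auto
    from orbit_limit_fixed[OF this] show "orbit_limit (x l) \<in> S\<^sup>1"
      "(f ^^ q) (orbit_limit (x l)) = orbit_limit (x l)" by (auto simp: fixed_points_def)
  qed
  have "inj_on \<mu> {..<N}"
  proof (rule inj_onI, rule ccontr)
    fix i j assume ij: "i \<in> {..<N}" "j \<in> {..<N}" "\<mu> i = \<mu> j" "i \<noteq> j"
    then have "emeasure (\<mu> i) (D i) = 1"
      unfolding \<mu>_def using q per sets inv lim by (intro orbit_measure_emeasure(1)[OF f]) auto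
    moreover have "(f ^^ n) (orbit_limit (x j)) \<notin> D i" for n
      using inv[of j "orbit_limit (x j)" n] lim[of j] disj[of i j] ij by auto
    then have "emeasure (\<mu> j) (D i) = 0"
      unfolding \<mu>_def using ij q per sets by (intro orbit_measure_emeasure(2)[OF f]) auto
    ultimately show False using ij by simp
  qed
  moreover have "\<mu> ` {..<N} \<subseteq> {\<mu>. physical_measure f \<mu>}"
    using x D physical_orbit_measure by (fastforce simp: \<mu>_def)
  ultimately show ?thesis using card_inj_on_le[OF _ _ fin] by fastforce
qed

end

lemma wonderful_of_null_periodic_and_traps:
  assumes f: "circle_homeo f" and p: "p \<in> S\<^sup>1" "k > 0" "(f ^^ k) p = p"
    and null: "\<And>q. q > 0 \<Longrightarrow> emeasure lebesgue_circle {x \<in> S\<^sup>1. (f ^^ q) x = x} = 0"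
    and traps: "\<And>N :: nat. \<exists>D. (\<forall>l<N. closed (D l) \<and> D l \<subseteq> S\<^sup>1 \<and> f ` D l \<subseteq> D l \<and>
        (\<exists>U. openin (top_of_set S\<^sup>1) U \<and> U \<noteq> {} \<and> U \<subseteq> D l)) \<and>
      (\<forall>i<N. \<forall>j<N. i \<noteq> j \<longrightarrow> D i \<inter> D j = {})"
  shows "wonderful f" "infinite {\<mu>. physical_measure f \<mu>}" "countable {\<mu>. physical_measure f \<mu>}"
    "\<forall>\<mu>. physical_measure f \<mu> \<longrightarrow> (\<exists>p k. periodic_point f p k \<and> \<mu> = periodic_dirac f p k)"
proof -
  obtain q H where qH: "q > 0" "(f ^^ q) p = p" "interval_homeo H"
    "\<And>t. t \<in> {0<..<1} \<Longrightarrow> (f ^^ q) (arc_point p t) = arc_point p (H t)"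
    using increasing_return_lift[OF f p] by metis
  interpret periodic_circle_homeo H f p q
    using qH f p by (auto simp: periodic_circle_homeo_def periodic_circle_homeo_axioms_def)
  have null: "emeasure lebesgue_circle fixed_points = 0"
    using null[OF q] by (simp add: fixed_points_def)
  have "closed {x \<in> S\<^sup>1. (f ^^ q) x - x = 0}"
    by (intro continuous_closed_preimage_constant continuous_intros circle_homeoD(1)[OF return_homeo] closed_sphere)
  then have "closed fixed_points"
    by (simp add: fixed_points_def)
  then have sets: "fixed_points \<in> sets borel_circle"
    by (intro sets_borel_circleI borel_closed) (auto simp: fixed_points_def)
  note phys = physical_measures_eq[OF null sets]
  have "{\<mu>. physical_measure f \<mu>} = orbit_measure f ` orbit_limit ` (S\<^sup>1 - fixed_points)"
    by (simp add: phys image_image)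
  then show count: "countable {\<mu>. physical_measure f \<mu>}"
    using countable_limits by simp
  show "infinite {\<mu>. physical_measure f \<mu>}"
  proof
    assume fin: "finite {\<mu>. physical_measure f \<mu>}"
    let ?N = "Suc (card {\<mu>. physical_measure f \<mu>})"
    define N where "N = ?N"
    from traps[of N] obtain D where D: "\<forall>l<N. closed (D l) \<and> D l \<subseteq> S\<^sup>1 \<and> f ` D l \<subseteq> D l \<and>
        (\<exists>U. openin (top_of_set S\<^sup>1) U \<and> U \<noteq> {} \<and> U \<subseteq> D l)"
      "\<forall>i<N. \<forall>j<N. i \<noteq> j \<longrightarrow> D i \<inter> D j = {}"
      by (elim exE conjE)
    have "N \<le> card {\<mu>. physical_measure f \<mu>}"
      by (rule disjoint_traps_le_card_physical[OF null sets, of N D]) (use D fin in simp_all)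
    then show False by (simp add: N_def)
  qed
  show "\<forall>\<mu>. physical_measure f \<mu> \<longrightarrow> (\<exists>p k. periodic_point f p k \<and> \<mu> = periodic_dirac f p k)"
  proof (intro allI impI)
    fix \<mu> assume "physical_measure f \<mu>"
    then have "\<mu> \<in> (\<lambda>x. orbit_measure f (orbit_limit x)) ` (S\<^sup>1 - fixed_points)"
      by (simp flip: phys)
    then obtain x where x: "x \<in> S\<^sup>1" "\<mu> = orbit_measure f (orbit_limit x)" by auto
    have "periodic_point f (orbit_limit x) (minimal_period f (orbit_limit x))"
      using orbit_limit_fixed[OF x(1)] q by (intro periodic_point_minimal_period) (auto simp: fixed_points_def)
    then show "\<exists>p k. periodic_point f p k \<and> \<mu> = periodic_dirac f p k"
      using x(2) by (auto simp: orbit_measure_def)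
  qed
  show "wonderful f"
    unfolding wonderful_def
  proof (intro exI conjI)
    \<comment> \<open>The witnessing family consists of all physical measures; each wandering point
      lies in the basin of the measure on its own limit orbit.\<close>
    let ?B = "\<Union>\<mu>\<in>{\<mu>. physical_measure f \<mu>}. basin f \<mu>"
    have B: "?B \<in> sets borel_circle"
      using count basin_measurable by (intro sets.countable_UN') auto
    have "S\<^sup>1 - fixed_points \<subseteq> ?B"
      using physical_orbit_measure by (auto simp: basin_orbit_measure)
    then have "emeasure lebesgue_circle (S\<^sup>1 - fixed_points) \<le> emeasure lebesgue_circle ?B"
      using B by (intro emeasure_mono) auto
    moreover have "emeasure lebesgue_circle (S\<^sup>1 - fixed_points) = 1"
      using emeasure_Diff_null_set[of fixed_points lebesgue_circle "S\<^sup>1"] null sets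
        lebesgue_circle.emeasure_space_1 sets.top[of lebesgue_circle]
      by (simp add: null_sets_def)
    ultimately show "emeasure lebesgue_circle ?B = 1"
      using lebesgue_circle.emeasure_le_1[of ?B] by (simp add: antisym)
  qed (use count in auto)
qed

section \<open>Traps\<close>

text \<open>Seen from a base point outside \<open>L\<close>, the coordinate is continuous on
  \<open>L\<close> and turns it into a compact interval, where Brouwer's theorem applies in
  dimension one.\<close>

lemma circle_subarc_fixed_point:
  assumes L: "compact L" "connected L" "L \<noteq> {}" "L \<subseteq> S\<^sup>1 - {a}" and a: "a \<in> S\<^sup>1"
    and g: "continuous_on L g" "g ` L \<subseteq> L"
  obtains x where "x \<in> L" "g x = x"
proof -
  have coord: "continuous_on L (arc_coord a)"
    using continuous_on_arc_coord[OF a] L(4) by (rule continuous_on_subset)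
  let ?J = "arc_coord a ` L" and ?h = "\<lambda>t. arc_coord a (g (arc_point a t))"
  have point: "arc_point a t \<in> L" if "t \<in> ?J" for t using that L(4) a by auto
  have "continuous_on ?J (\<lambda>t. g (arc_point a t))"
    by (rule continuous_on_compose2[OF g(1)]) (use point in \<open>auto intro!: continuous_intros\<close>)
  then have "continuous_on ?J ?h"
    by (rule continuous_on_compose2[OF coord]) (use point g in auto)
  moreover have "compact ?J" using coord L(1) by (rule compact_continuous_image)
  moreover have "convex ?J"
    using connected_continuous_image[OF coord L(2)] by (metis is_interval_connected_1 is_interval_convex_1)
  moreover have "?h \<in> ?J \<rightarrow> ?J" using point g by auto
  ultimately obtain t where t: "t \<in> ?J" "?h t = t"
    using brouwer[of ?J ?h] L(3) by blast
  have "g (arc_point a t) \<in> L" using point[OF t(1)] g(2) by auto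
  then have "g (arc_point a t) = arc_point a t"
    using t(2) a L(4) by (metis DiffD1 arc_point_arc_coord subsetD)
  with point[OF t(1)] that show thesis by blast
qed

text \<open>The target \<open>V\<close> is open in the plane, so that the compact image of
  \<open>K\<close> keeps a positive distance from its complement. Only the trace of \<open>V\<close>
  on the circle has to lie in \<open>K\<close>.\<close>

definition trap :: "(complex \<Rightarrow> complex) \<Rightarrow> complex set \<Rightarrow> complex set \<Rightarrow> bool" where
  "trap f K V \<longleftrightarrow> closed K \<and> K \<subseteq> S\<^sup>1 \<and> open V \<and> f ` K \<subseteq> V \<and> V \<inter> S\<^sup>1 \<subseteq> K"

lemma trap_image_subset: "circle_homeo f \<Longrightarrow> trap f K V \<Longrightarrow> f ` K \<subseteq> K"
  using circle_homeoD(4)[of f] by (fastforce simp: trap_def)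

lemma trap_robust:
  assumes f: "circle_homeo f" and "trap f K V"
  obtains \<delta> where "\<delta> > 0" "\<And>g. (\<And>x. x \<in> S\<^sup>1 \<Longrightarrow> dist (f x) (g x) < \<delta>) \<Longrightarrow> trap g K V"
proof -
  have K: "closed K" "K \<subseteq> S\<^sup>1" "open V" "f ` K \<subseteq> V" "V \<inter> S\<^sup>1 \<subseteq> K"
    using assms(2) by (auto simp: trap_def)
  have "compact K"
    using K by (metis compact_Int_closed compact_sphere inf.absorb2)
  then have "compact (f ` K)"
    using circle_homeoD(1)[OF f] K(2) by (metis compact_continuous_image continuous_on_subset)
  then obtain \<delta> where \<delta>: "\<delta> > 0" "(\<Union>y\<in>f ` K. ball y \<delta>) \<subseteq> V"
    using compact_subset_open_imp_ball_epsilon_subset[OF _ K(3,4)] by metis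
  show thesis
  proof (rule that[OF \<delta>(1)])
    fix g assume g: "\<And>x. x \<in> S\<^sup>1 \<Longrightarrow> dist (f x) (g x) < \<delta>"
    have "g x \<in> V" if "x \<in> K" for x
      using \<delta>(2) g[of x] that K(2) by fastforce
    with K show "trap g K V" by (auto simp: trap_def)
  qed
qed

lemma finite_self_map_cycle:
  assumes "finite A" "A \<noteq> {}" "\<And>x. x \<in> A \<Longrightarrow> s x \<in> A"
  obtains x k where "x \<in> A" "k > 0" "(s ^^ k) x = x"
proof -
  obtain a where a: "a \<in> A" using assms(2) by blast
  have orbit: "(s ^^ n) a \<in> A" for n by (induction n) (use a assms(3) in auto)
  then have "\<not> inj (\<lambda>n. (s ^^ n) a)"
    using assms(1) by (metis finite_subset image_subsetI range_inj_infinite)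
  then obtain i j where "i < j" "(s ^^ i) a = (s ^^ j) a"
    by (auto simp: inj_def) (metis linorder_neqE_nat)
  then have "(s ^^ (j - i)) ((s ^^ i) a) = (s ^^ i) a"
    by (metis comp_apply funpow_add le_add_diff_inverse2 less_imp_le)
  with orbit \<open>i < j\<close> that show thesis by (metis zero_less_diff)
qed

text \<open>\<open>f\<close> maps finitely many components of \<open>V \<inter> S\<^sup>1\<close> into one another, so some iterate maps the
  closure of one of them, an arc, into itself.\<close>
lemma trap_periodic_point:
  assumes f: "circle_homeo f" and trap: "trap f K V" "K \<noteq> {}" "\<not> S\<^sup>1 \<subseteq> V"
  obtains p k where "p \<in> S\<^sup>1" "k > 0" "(f ^^ k) p = p"
proof -
  have K: "closed K" "K \<subseteq> S\<^sup>1" "open V" "f ` K \<subseteq> V" "V \<inter> S\<^sup>1 \<subseteq> K"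
    using trap(1) by (auto simp: trap_def)
  define W where "W = S\<^sup>1 \<inter> V"
  have W: "openin (top_of_set S\<^sup>1) W" using K(3) by (auto simp: W_def openin_open)
  have "compact K"
    using K by (metis compact_Int_closed compact_sphere inf.absorb2)
  then have comp: "compact (f ` K)"
    using circle_homeoD(1)[OF f] K(2) by (metis compact_continuous_image continuous_on_subset)
  have fK: "f ` K \<subseteq> W" using K circle_homeoD(4)[OF f] by (auto simp: W_def)
  have "locally connected (S\<^sup>1 :: complex set)"
    by (rule locally_connected_sphere)
  then have "locally connected W" using W by (rule locally_open_subset)
  then have opn: "openin (top_of_set S\<^sup>1) C" if "C \<in> components W" for C
    using openin_components_locally_connected[OF _ that] W openin_trans by blast
  \<comment> \<open>\<open>W\<close> may have infinitely many components, but they are open and the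
    image of \<open>K\<close> is compact.\<close>
  have "\<exists>\<D>. finite \<D> \<and> \<D> \<subseteq> components W \<and> f ` K \<subseteq> \<Union>\<D>"
  proof -
    have "f ` K \<subseteq> \<Union>(components W)" using fK by (simp add: Union_components)
    moreover have "compactin (top_of_set S\<^sup>1) (f ` K)"
      using comp fK by (auto simp: compactin_subtopology W_def)
    ultimately show ?thesis
      using opn unfolding compactin_def by (metis (no_types, lifting))
  qed
  then obtain \<D> where \<D>: "finite \<D>" "\<D> \<subseteq> components W" "f ` K \<subseteq> \<Union>\<D>" by blast
  have sub: "closure C \<subseteq> K" if "C \<in> \<D>" for C
  proof (rule closure_minimal)
    have "C \<subseteq> W" using that \<D>(2) in_components_subset by blast
    then show "C \<subseteq> K" using K(5) by (auto simp: W_def)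
  qed (fact K(1))
  \<comment> \<open>The closure of \<open>C\<close> is still connected and contained in
    \<open>K\<close>, so its image is a connected part of \<open>W\<close> and stays in one
    component. Closures are carried along because the fixed point argument needs a compact
    arc.\<close>
  have "\<exists>C'\<in>\<D>. f ` closure C \<subseteq> C'" if C: "C \<in> \<D>" for C
  proof -
    have "C \<noteq> {}" using C \<D>(2) in_components_nonempty by blast
    then obtain x where x: "x \<in> C" by blast
    then have "x \<in> closure C" using closure_subset by blast
    with \<D>(3) sub[OF C] obtain C' where C': "C' \<in> \<D>" "f x \<in> C'" by blast
    have "connected C" using C \<D>(2) in_components_connected by blast
    then have "connected (f ` closure C)"
      using circle_homeoD(1)[OF f] sub[OF C] K(2)
      by (meson connected_imp_connected_closure connected_continuous_image continuous_on_subset subset_trans)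
    moreover have "f ` closure C \<subseteq> W" using sub[OF C] fK by blast
    ultimately have "f ` closure C \<subseteq> C'"
      using C' \<D>(2) \<open>x \<in> closure C\<close> by (intro components_maximal[of C' W]) auto
    with C' show ?thesis by blast
  qed
  then obtain s where s: "\<And>C. C \<in> \<D> \<Longrightarrow> s C \<in> \<D>" "\<And>C. C \<in> \<D> \<Longrightarrow> f ` closure C \<subseteq> s C" by metis
  have "\<D> \<noteq> {}" using trap(2) \<D>(3) by auto
  then obtain C k where C: "C \<in> \<D>" "k > 0" "(s ^^ k) C = C"
    using finite_self_map_cycle[of \<D> s] \<D>(1) s(1) by metis
  have sC: "(s ^^ n) C \<in> \<D>" for n by (induction n) (use C s in auto)
  have iter: "(f ^^ Suc n) ` closure C \<subseteq> (s ^^ Suc n) C" for n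
  proof (induction n)
    case 0
    then show ?case using s(2)[OF C(1)] by simp
  next
    case (Suc n)
    have "(f ^^ Suc (Suc n)) ` closure C = f ` ((f ^^ Suc n) ` closure C)"
      by (simp add: image_image)
    also have "\<dots> \<subseteq> f ` closure ((s ^^ Suc n) C)"
      using Suc closure_subset by blast
    also have "\<dots> \<subseteq> s ((s ^^ Suc n) C)" using s(2)[OF sC] .
    finally show ?case by simp
  qed
  have fk: "(f ^^ k) ` closure C \<subseteq> C"
    using iter[of "k - 1"] C by simp
  have CW: "C \<subseteq> W" using C(1) \<D>(2) in_components_subset by blast
  \<comment> \<open>A closure equal to the whole circle would be mapped onto the circle by f^k and
    at the same time into \<open>C\<close>, hence into \<open>V\<close>, which misses a
    point.\<close>
  obtain a where a: "a \<in> S\<^sup>1" "a \<notin> closure C"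
  proof -
    have "\<not> S\<^sup>1 \<subseteq> closure C"
    proof
      assume "S\<^sup>1 \<subseteq> closure C"
      then have "(f ^^ k) ` S\<^sup>1 \<subseteq> C" using fk by blast
      then have "S\<^sup>1 \<subseteq> C" using circle_homeoD(2)[OF circle_homeo_funpow[OF f]] by simp
      with CW trap(3) show False by (auto simp: W_def)
    qed
    with that show thesis by blast
  qed
  have CS: "closure C \<subseteq> S\<^sup>1" using sub[OF C(1)] K(2) by blast
  obtain x where "x \<in> closure C" "(f ^^ k) x = x"
  proof (rule circle_subarc_fixed_point[of "closure C" a "f ^^ k"])
    show "compact (closure C)"
      using CS by (metis bounded_sphere bounded_subset closed_closure compact_eq_bounded_closed)
    show "connected (closure C)"
      using C(1) \<D>(2) in_components_connected connected_imp_connected_closure by blast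
    show "closure C \<noteq> {}" using C(1) \<D>(2) in_components_nonempty by force
    show "continuous_on (closure C) (f ^^ k)"
      using circle_homeoD(1)[OF circle_homeo_funpow[OF f]] CS by (rule continuous_on_subset)
    show "(f ^^ k) ` closure C \<subseteq> closure C" using fk closure_subset by blast
  qed (use a CS in auto)
  with that C(2) CS show thesis by blast
qed

text \<open>A single index controls both the measure bounds and the number of traps, so countably
  many conditions suffice. Even for \<open>N = 0\<close> the bound is 1, which makes
  \<open>K\<close> nonempty and keeps \<open>V\<close> from covering the circle; a periodic point
  follows already then.\<close>

definition trapping :: "nat \<Rightarrow> (complex \<Rightarrow> complex) \<Rightarrow> bool" where
  "trapping N f \<longleftrightarrow>
     (\<exists>K V. trap f K V \<and> emeasure lebesgue_circle (S\<^sup>1 - K) < ennreal (inverse (Suc N)) \<and>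
        emeasure lebesgue_circle (V \<inter> S\<^sup>1) < ennreal (inverse (Suc N))) \<and>
     (\<exists>D V. (\<forall>l<N. trap f (D l) (V l) \<and> D l \<noteq> {}) \<and> (\<forall>i<N. \<forall>j<N. i \<noteq> j \<longrightarrow> D i \<inter> D j = {}))"

lemma trapping_periodic_point:
  assumes f: "circle_homeo f" and "trapping N f"
  obtains p k where "p \<in> S\<^sup>1" "k > 0" "(f ^^ k) p = p"
proof -
  obtain K V where KV: "trap f K V" "emeasure lebesgue_circle (S\<^sup>1 - K) < ennreal (inverse (Suc N))"
      "emeasure lebesgue_circle (V \<inter> S\<^sup>1) < ennreal (inverse (Suc N))"
    using assms(2) by (auto simp: trapping_def)
  have "ennreal (inverse (Suc N)) \<le> 1" by (simp add: field_simps)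
  then have less: "emeasure lebesgue_circle (S\<^sup>1 - K) < 1" "emeasure lebesgue_circle (V \<inter> S\<^sup>1) < 1"
    using KV by (auto intro: order.strict_trans2)
  have total: "emeasure lebesgue_circle S\<^sup>1 = 1"
    using lebesgue_circle.emeasure_space_1 by simp
  have "K \<noteq> {}" using less(1) total by auto
  moreover have "\<not> S\<^sup>1 \<subseteq> V" using less(2) total by (auto simp: Int_absorb1)
  ultimately show thesis using trap_periodic_point[OF f KV(1)] that by metis
qed

lemma trapping_imp_null_periodic:
  assumes f: "circle_homeo f" and "\<And>N. trapping N f" and q: "q > 0"
  shows "emeasure lebesgue_circle {x \<in> S\<^sup>1. (f ^^ q) x = x} = 0"
proof -
  define F where "F = {x \<in> S\<^sup>1. (f ^^ q) x = x}"
  have bound: "emeasure lebesgue_circle F \<le> ennreal (2 * inverse (Suc N))" for N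
  proof -
    obtain K V where KV: "trap f K V" "emeasure lebesgue_circle (S\<^sup>1 - K) < ennreal (inverse (Suc N))"
        "emeasure lebesgue_circle (V \<inter> S\<^sup>1) < ennreal (inverse (Suc N))"
      using assms(2)[of N] by (auto simp: trapping_def)
    have sets: "S\<^sup>1 - K \<in> sets lebesgue_circle" "V \<inter> S\<^sup>1 \<in> sets lebesgue_circle"
    proof -
      have "closed K" "open V" using KV(1) by (auto simp: trap_def)
      then have "S\<^sup>1 - K \<in> sets borel" "V \<inter> S\<^sup>1 \<in> sets borel"
        by (auto intro!: sets.Diff sets.Int borel_closed[of K] borel_open borel_closed[of "S\<^sup>1"])
      then show "S\<^sup>1 - K \<in> sets lebesgue_circle" "V \<inter> S\<^sup>1 \<in> sets lebesgue_circle"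
        by (simp_all add: sets_borel_circleI)
    qed
    have "F \<subseteq> (S\<^sup>1 - K) \<union> (V \<inter> S\<^sup>1)"
    proof
      fix x assume x: "x \<in> F"
      show "x \<in> (S\<^sup>1 - K) \<union> (V \<inter> S\<^sup>1)"
      proof (cases "x \<in> K")
        case True
        have inK: "(f ^^ n) x \<in> K" for n
          by (induction n) (use True trap_image_subset[OF f KV(1)] in auto)
        \<comment> \<open>A periodic point of \<open>K\<close> is the image of its own iterate of
          order \<open>q - 1\<close>, which has not left \<open>K\<close>; thus it lies in
          \<open>V\<close>.\<close>
        have "f ((f ^^ (q - 1)) x) = x"
          using x q by (cases q) (auto simp: F_def)
        then show ?thesis using inK[of "q - 1"] KV(1) x by (force simp: trap_def F_def)
      qed (use x in \<open>auto simp: F_def\<close>)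
    qed
    then have "emeasure lebesgue_circle F \<le> emeasure lebesgue_circle ((S\<^sup>1 - K) \<union> (V \<inter> S\<^sup>1))"
      using sets by (intro emeasure_mono) auto
    also have "\<dots> \<le> emeasure lebesgue_circle (S\<^sup>1 - K) + emeasure lebesgue_circle (V \<inter> S\<^sup>1)"
      using sets by (rule emeasure_subadditive)
    also have "\<dots> \<le> ennreal (inverse (Suc N)) + ennreal (inverse (Suc N))"
      using KV by (intro add_mono) auto
    also have "\<dots> = ennreal (2 * inverse (Suc N))"
      by (simp flip: ennreal_plus)
    finally show ?thesis .
  qed
  have "(\<lambda>N. ennreal (2 * inverse (Suc N))) \<longlonglongrightarrow> ennreal (2 * 0)"
    by (intro tendsto_ennrealI tendsto_mult_left LIMSEQ_inverse_real_of_nat)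
  then have "emeasure lebesgue_circle F \<le> ennreal (2 * 0)"
    using bound by (intro LIMSEQ_le_const) auto
  then show ?thesis by (simp add: F_def)
qed

lemma trapping_imp_wonderful:
  assumes f: "circle_homeo f" and trapping: "\<And>N. trapping N f"
  shows "wonderful f" "infinite {\<mu>. physical_measure f \<mu>}" "countable {\<mu>. physical_measure f \<mu>}"
    "\<forall>\<mu>. physical_measure f \<mu> \<longrightarrow> (\<exists>p k. periodic_point f p k \<and> \<mu> = periodic_dirac f p k)"
proof -
  obtain p k where p: "p \<in> S\<^sup>1" "k > 0" "(f ^^ k) p = p"
    using trapping_periodic_point[OF f trapping] by metis
  have traps: "\<exists>D. (\<forall>l<N. closed (D l) \<and> D l \<subseteq> S\<^sup>1 \<and> f ` D l \<subseteq> D l \<and>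
        (\<exists>U. openin (top_of_set S\<^sup>1) U \<and> U \<noteq> {} \<and> U \<subseteq> D l)) \<and>
      (\<forall>i<N. \<forall>j<N. i \<noteq> j \<longrightarrow> D i \<inter> D j = {})" for N :: nat
  proof -
    obtain D V where DV: "\<And>l. l < N \<Longrightarrow> trap f (D l) (V l) \<and> D l \<noteq> {}"
        "\<And>i j. i < N \<Longrightarrow> j < N \<Longrightarrow> i \<noteq> j \<Longrightarrow> D i \<inter> D j = {}"
      using trapping[of N] unfolding trapping_def by metis
    have "closed (D l) \<and> D l \<subseteq> S\<^sup>1 \<and> f ` D l \<subseteq> D l \<and>
        (\<exists>U. openin (top_of_set S\<^sup>1) U \<and> U \<noteq> {} \<and> U \<subseteq> D l)" if l: "l < N" for l
    proof -
      have tr: "trap f (D l) (V l)" "D l \<noteq> {}" using DV(1)[OF l] by auto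
      then obtain x where "x \<in> D l" by blast
      \<comment> \<open>Nonempty traps have interior: the image of any of their points lies in the
        open target, whose trace on the circle is part of the trap.\<close>
      then have "f x \<in> S\<^sup>1 \<inter> V l" using tr circle_homeoD(4)[OF f] by (auto simp: trap_def)
      then have "S\<^sup>1 \<inter> V l \<noteq> {}" by blast
      moreover have "openin (top_of_set S\<^sup>1) (S\<^sup>1 \<inter> V l)" "S\<^sup>1 \<inter> V l \<subseteq> D l"
        using tr by (auto simp: trap_def openin_open_Int)
      ultimately show ?thesis
        using tr trap_image_subset[OF f tr(1)] unfolding trap_def by blast
    qed
    with DV(2) show ?thesis by blast
  qed
  show "wonderful f" "infinite {\<mu>. physical_measure f \<mu>}" "countable {\<mu>. physical_measure f \<mu>}"
    "\<forall>\<mu>. physical_measure f \<mu> \<longrightarrow> (\<exists>p k. periodic_point f p k \<and> \<mu> = periodic_dirac f p k)"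
    using wonderful_of_null_periodic_and_traps[OF f p trapping_imp_null_periodic[OF f trapping] traps]
    by blast+
qed

text \<open>The measure bounds mention only the sets and not the map. What has to survive is a
  finite number of trap relations, so the least of their tolerances works.\<close>

lemma trapping_robust:
  assumes f: "circle_homeo f" and "trapping N f"
  obtains \<delta> where "\<delta> > 0" "\<And>g. (\<And>x. x \<in> S\<^sup>1 \<Longrightarrow> dist (f x) (g x) < \<delta>) \<Longrightarrow> trapping N g"
proof -
  obtain K V D U where KV: "trap f K V" "emeasure lebesgue_circle (S\<^sup>1 - K) < ennreal (inverse (Suc N))"
      "emeasure lebesgue_circle (V \<inter> S\<^sup>1) < ennreal (inverse (Suc N))"
    and D: "\<And>l. l < N \<Longrightarrow> trap f (D l) (U l) \<and> D l \<noteq> {}"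
        "\<And>i j. i < N \<Longrightarrow> j < N \<Longrightarrow> i \<noteq> j \<Longrightarrow> D i \<inter> D j = {}"
    using assms(2) unfolding trapping_def by metis
  obtain d where d: "d > 0" "\<And>g. (\<And>x. x \<in> S\<^sup>1 \<Longrightarrow> dist (f x) (g x) < d) \<Longrightarrow> trap g K V"
    using trap_robust[OF f KV(1)] by metis
  have "\<exists>e>0. \<forall>g. (\<forall>x\<in>S\<^sup>1. dist (f x) (g x) < e) \<longrightarrow> trap g (D l) (U l)" if "l < N" for l
    using trap_robust[OF f, of "D l" "U l"] D(1)[OF that] by metis
  then obtain e where e: "\<And>l. l < N \<Longrightarrow> e l > 0"
      "\<And>l g. l < N \<Longrightarrow> (\<forall>x\<in>S\<^sup>1. dist (f x) (g x) < e l) \<Longrightarrow> trap g (D l) (U l)"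
    by metis
  define \<delta> where "\<delta> = Min (insert d (e ` {..<N}))"
  have \<delta>: "\<delta> \<le> d" "\<And>l. l < N \<Longrightarrow> \<delta> \<le> e l" "\<delta> > 0"
    using d(1) e(1) by (auto simp: \<delta>_def)
  show thesis
  proof (rule that[OF \<delta>(3)])
    fix g assume g: "\<And>x. x \<in> S\<^sup>1 \<Longrightarrow> dist (f x) (g x) < \<delta>"
    have "trap g K V"
    proof (rule d(2))
      fix x :: complex assume "x \<in> S\<^sup>1"
      from g[OF this] \<delta>(1) show "dist (f x) (g x) < d" by linarith
    qed
    moreover have "trap g (D l) (U l)" if "l < N" for l
    proof (rule e(2)[OF that], rule ballI)
      fix x :: complex assume "x \<in> S\<^sup>1"
      from g[OF this] \<delta>(2)[OF that] show "dist (f x) (g x) < e l" by linarith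
    qed
    ultimately show "trapping N g"
      using KV D unfolding trapping_def by blast
  qed
qed

section \<open>Crushing arcs\<close>

text \<open>A strictly increasing approximation of the step function that jumps by \<open>1 / M\<close> at each \<open>z i\<close>.\<close>
definition staircase :: "nat \<Rightarrow> (nat \<Rightarrow> real) \<Rightarrow> real \<Rightarrow> real \<Rightarrow> real \<Rightarrow> real" where
  "staircase M z \<eta> \<kappa> t =
     \<kappa> * t + (1 - \<kappa>) * ((\<Sum>i<M. max 0 (min 1 ((t - z i + \<eta>) / (2 * \<eta>)))) / M)"

text \<open>Each ramp is confined to its own cell: at \<open>t\<close>, the ramps further left have
  reached 1 and those further right are still 0.\<close>

lemma staircase_in_cell:
  assumes z: "\<And>i. i < M \<Longrightarrow> i / M \<le> z i - \<eta> \<and> z i + \<eta> \<le> Suc i / M"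
    and "\<eta> > 0" "i < M" and t: "i / M \<le> t" "t \<le> Suc i / M"
  shows "staircase M z \<eta> \<kappa> t = \<kappa> * t + (1 - \<kappa>) * ((i + max 0 (min 1 ((t - z i + \<eta>) / (2 * \<eta>)))) / M)"
proof -
  let ?c = "\<lambda>j. max 0 (min 1 ((t - z j + \<eta>) / (2 * \<eta>)))"
  have "?c j = 1" if "j < i" for j
  proof -
    have "z j + \<eta> \<le> Suc j / M" using z[of j] that \<open>i < M\<close> by simp
    also have "\<dots> \<le> i / M" using that \<open>i < M\<close> by (intro divide_right_mono) auto
    finally have "2 * \<eta> \<le> t - z j + \<eta>" using t by simp
    then show ?thesis using \<open>\<eta> > 0\<close> by (simp add: field_simps)
  qed
  moreover have "?c j = 0" if "i < j" "j < M" for j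
  proof -
    have "Suc i / M \<le> j / M" using that by (intro divide_right_mono) auto
    then have "t - z j + \<eta> \<le> 0" using z[of j] that t by simp
    then have "(t - z j + \<eta>) / (2 * \<eta>) \<le> 0" using \<open>\<eta> > 0\<close> by (intro divide_nonpos_pos) auto
    then show ?thesis by simp
  qed
  ultimately have "(\<Sum>j<M. ?c j) = (\<Sum>j<M. (if j < i then 1 else 0) + (if j = i then ?c i else 0))"
    by (intro sum.cong refl) (auto simp: not_less le_less)
  also have "\<dots> = (\<Sum>j<M. if j < i then 1 else 0) + ?c i"
    using \<open>i < M\<close> by (simp add: sum.distrib)
  also have "(\<Sum>j<M. if j < i then 1 else (0::real)) = card ({..<M} \<inter> {j. j < i})"
    by (subst sum.If_cases) auto
  also have "{..<M} \<inter> {j. j < i} = {..<i}" using \<open>i < M\<close> by auto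
  finally have "(\<Sum>j<M. ?c j) = i + ?c i" by simp
  then show ?thesis by (simp add: staircase_def)
qed

text \<open>The linear summand with weight \<kappa> makes the function strictly increasing. It
  shifts the two ends of a ramp by at most \<kappa>, which is why the last clause trims the cell by
  \<kappa> on both sides; there the intermediate value theorem finds the preimage inside the
  ramp.\<close>

lemma staircase:
  assumes "M > 0" and z_all: "\<forall>i<M. i / M \<le> z i - \<eta> \<and> z i + \<eta> \<le> Suc i / M"
    and \<eta>: "\<eta> > 0" and \<kappa>: "0 < \<kappa>" "\<kappa> \<le> 1"
  shows "continuous_on {0..1} (staircase M z \<eta> \<kappa>)" "strict_mono_on {0..1} (staircase M z \<eta> \<kappa>)"
    "staircase M z \<eta> \<kappa> 0 = 0" "staircase M z \<eta> \<kappa> 1 = 1"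
    "\<And>i t. i < M \<Longrightarrow> t \<in> {i / M..Suc i / M} \<Longrightarrow> staircase M z \<eta> \<kappa> t \<in> {i / M..Suc i / M}"
    "\<And>i s. i < M \<Longrightarrow> s \<in> {i / M + \<kappa>..Suc i / M - \<kappa>} \<Longrightarrow>
       \<exists>t\<in>{z i - \<eta>..z i + \<eta>}. staircase M z \<eta> \<kappa> t = s"
proof -
  have z: "i / M \<le> z i - \<eta> \<and> z i + \<eta> \<le> Suc i / M" if "i < M" for i
    using z_all that by blast
  show cont: "continuous_on {0..1} (staircase M z \<eta> \<kappa>)"
    unfolding staircase_def using \<eta> \<open>M > 0\<close> by (intro continuous_intros) auto
  show "strict_mono_on {0..1} (staircase M z \<eta> \<kappa>)"
  proof (rule strict_mono_onI)
    fix s t :: real assume "s < t"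
    have "max 0 (min 1 ((s - z i + \<eta>) / (2 * \<eta>))) \<le> max 0 (min 1 ((t - z i + \<eta>) / (2 * \<eta>)))" for i
      using \<open>s < t\<close> \<eta> by (intro max.mono min.mono divide_right_mono) auto
    then have "(1 - \<kappa>) * ((\<Sum>i<M. max 0 (min 1 ((s - z i + \<eta>) / (2 * \<eta>)))) / M)
        \<le> (1 - \<kappa>) * ((\<Sum>i<M. max 0 (min 1 ((t - z i + \<eta>) / (2 * \<eta>)))) / M)"
      using \<kappa> by (intro mult_left_mono divide_right_mono sum_mono) auto
    moreover have "\<kappa> * s < \<kappa> * t" using \<open>s < t\<close> \<kappa> by simp
    ultimately show "staircase M z \<eta> \<kappa> s < staircase M z \<eta> \<kappa> t"
      unfolding staircase_def by linarith
  qed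
  have "(0 - z 0 + \<eta>) / (2 * \<eta>) \<le> 0"
    using z[of 0] \<open>M > 0\<close> \<eta> by (intro divide_nonpos_pos) auto
  then show "staircase M z \<eta> \<kappa> 0 = 0"
    using staircase_in_cell[OF z \<eta>, where i = 0 and t = 0 and \<kappa> = \<kappa>] \<open>M > 0\<close> by simp
  have "1 \<le> (1 - z (M - 1) + \<eta>) / (2 * \<eta>)"
    using z[of "M - 1"] \<open>M > 0\<close> \<eta> by (simp add: field_simps)
  then show "staircase M z \<eta> \<kappa> 1 = 1"
    using staircase_in_cell[OF z \<eta>, where i = "M - 1" and t = 1 and \<kappa> = \<kappa>] \<open>M > 0\<close>
    by (simp add: field_simps of_nat_diff)
  show cell: "staircase M z \<eta> \<kappa> t \<in> {i / M..Suc i / M}" if "i < M" "t \<in> {i / M..Suc i / M}" for i t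
  proof -
    define c where "c = (i + max 0 (min 1 ((t - z i + \<eta>) / (2 * \<eta>)))) / M"
    have c: "i / M \<le> c" "c \<le> Suc i / M"
      unfolding c_def using \<open>M > 0\<close> by (auto intro!: divide_right_mono)
    \<comment> \<open>For \<open>t\<close> in the cell, this is a convex combination of two points
      of the cell.\<close>
    have eq: "staircase M z \<eta> \<kappa> t = \<kappa> * t + (1 - \<kappa>) * c"
      unfolding c_def using that by (intro staircase_in_cell[OF z \<eta>]) auto
    have "\<kappa> * (i / M) + (1 - \<kappa>) * (i / M) \<le> \<kappa> * t + (1 - \<kappa>) * c"
      using that c \<kappa> by (intro add_mono mult_left_mono) auto
    moreover have "\<kappa> * t + (1 - \<kappa>) * c \<le> \<kappa> * (Suc i / M) + (1 - \<kappa>) * (Suc i / M)"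
      using that c \<kappa> by (intro add_mono mult_left_mono) auto
    moreover have "\<kappa> * A + (1 - \<kappa>) * A = A" for A by (simp add: algebra_simps)
    ultimately show ?thesis unfolding eq by (simp only: atLeastAtMost_iff)
  qed
  show "\<exists>t\<in>{z i - \<eta>..z i + \<eta>}. staircase M z \<eta> \<kappa> t = s"
    if i: "i < M" and s: "s \<in> {i / M + \<kappa>..Suc i / M - \<kappa>}" for i s
  proof -
    have bounds: "0 \<le> real i / M" "Suc i / M \<le> 1" using i by (auto simp: field_simps)
    have zi: "i / M \<le> z i - \<eta>" "z i + \<eta> \<le> Suc i / M" using z[OF i] by auto
    have "staircase M z \<eta> \<kappa> (z i - \<eta>) = \<kappa> * (z i - \<eta>) + (1 - \<kappa>) * (i / M)"
      using zi \<eta> i by (subst staircase_in_cell[OF z \<eta>, where i = i]) auto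
    also have "\<dots> \<le> \<kappa> * 1 + 1 * (i / M)"
      using zi bounds \<kappa> \<eta> by (intro add_mono mult_left_mono mult_right_mono) auto
    finally have lo: "staircase M z \<eta> \<kappa> (z i - \<eta>) \<le> s" using s by simp
    have "staircase M z \<eta> \<kappa> (z i + \<eta>) = \<kappa> * (z i + \<eta>) + (1 - \<kappa>) * (Suc i / M)"
      using zi \<eta> i by (subst staircase_in_cell[OF z \<eta>, where i = i]) (auto simp: add.commute)
    also have "\<dots> \<ge> \<kappa> * 0 + (Suc i / M - \<kappa> * 1)"
    proof -
      have "0 \<le> z i + \<eta>" using zi bounds \<eta> by linarith
      then have "\<kappa> * 0 \<le> \<kappa> * (z i + \<eta>)" using \<kappa> by (intro mult_left_mono) auto
      moreover have "\<kappa> * (Suc i / M) \<le> \<kappa> * 1" using bounds \<kappa> by (intro mult_left_mono) auto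
      ultimately show ?thesis by (simp only: left_diff_distrib mult_1)
    qed
    finally have hi: "s \<le> staircase M z \<eta> \<kappa> (z i + \<eta>)" using s by simp
    have "continuous_on {z i - \<eta>..z i + \<eta>} (staircase M z \<eta> \<kappa>)"
    proof (rule continuous_on_subset[OF cont])
      have "0 \<le> z i - \<eta>" "z i + \<eta> \<le> 1" using zi bounds by linarith+
      then show "{z i - \<eta>..z i + \<eta>} \<subseteq> {0..1}" by auto
    qed
    then show ?thesis
      using IVT'[of "staircase M z \<eta> \<kappa>" "z i - \<eta>" s "z i + \<eta>"] lo hi \<eta> by auto
  qed
qed

lemma unit_interval_cell:
  fixes M :: nat and t :: real
  assumes "0 \<le> t" "t < 1" "M > 0"
  shows "nat \<lfloor>t * M\<rfloor> < M" "t \<in> {nat \<lfloor>t * M\<rfloor> / M..Suc (nat \<lfloor>t * M\<rfloor>) / M}"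
proof -
  have "0 \<le> \<lfloor>t * M\<rfloor>" using assms by simp
  then have n: "real (nat \<lfloor>t * M\<rfloor>) = of_int \<lfloor>t * M\<rfloor>" by simp
  have "t * M < M" using assms by simp
  then show "nat \<lfloor>t * M\<rfloor> < M" using n by linarith
  have "nat \<lfloor>t * M\<rfloor> \<le> t * M" "t * M \<le> Suc (nat \<lfloor>t * M\<rfloor>)" using n by linarith+
  then show "t \<in> {nat \<lfloor>t * M\<rfloor> / M..Suc (nat \<lfloor>t * M\<rfloor>) / M}"
    using assms by (simp add: field_simps)
qed

text \<open>The contraction is the inverse of the staircase, which stretches a tiny interval around
  \<open>z i\<close> over almost the whole cell. Since the staircase maps every cell into itself,
  the inverse moves no coordinate by more than a cell length.\<close>

lemma crushing_homeo:
  fixes M :: nat and z :: "nat \<Rightarrow> real"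
  assumes a: "a \<in> S\<^sup>1" and "M > 0" and z: "\<And>i. i < M \<Longrightarrow> i / M < z i \<and> z i < Suc i / M"
    and \<eta>: "\<eta> > 0" and \<kappa>: "\<kappa> > 0"
  obtains \<phi> where "circle_homeo \<phi>" "\<And>x. x \<in> S\<^sup>1 \<Longrightarrow> dist (\<phi> x) x \<le> 2 * pi / M"
    "\<And>i s. i < M \<Longrightarrow> s \<in> {i / M + \<kappa>..Suc i / M - \<kappa>} \<Longrightarrow>
       \<exists>t\<in>{z i - \<eta>..z i + \<eta>}. \<phi> (arc_point a s) = arc_point a t"
proof -
  \<comment> \<open>Narrower ramps, and a smaller \<kappa>, only strengthen the claim. The first
    reduction fits the ramps into their cells, the second makes \<kappa> a weight of a convex
    combination.\<close>
  define \<eta>' where "\<eta>' = Min (insert \<eta> ((\<lambda>i. min (z i - real i / real M) (real (Suc i) / real M - z i)) ` {..<M}))"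
  have \<eta>'_le: "\<eta>' \<le> \<eta>" by (simp add: \<eta>'_def)
  have "\<eta>' \<le> min (z i - i / M) (Suc i / M - z i)" if "i < M" for i
    unfolding \<eta>'_def using that by (intro Min_le) auto
  then have z': "\<forall>i<M. i / M \<le> z i - \<eta>' \<and> z i + \<eta>' \<le> Suc i / M"
    by force
  have "\<eta>' > 0" using \<eta> z by (simp add: \<eta>'_def)
  define \<kappa>' where "\<kappa>' = min \<kappa> 1"
  have \<kappa>': "0 < \<kappa>'" "\<kappa>' \<le> 1" "\<kappa>' \<le> \<kappa>" using \<kappa> by (auto simp: \<kappa>'_def)
  define \<Psi> where "\<Psi> = staircase M z \<eta>' \<kappa>'"
  note \<Psi> = staircase[OF \<open>M > 0\<close> z' \<open>\<eta>' > 0\<close> \<kappa>'(1,2), folded \<Psi>_def]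
  obtain \<psi> where \<psi>: "circle_homeo \<psi>" "\<And>t. t \<in> {0..1} \<Longrightarrow> \<psi> (arc_point a t) = arc_point a (\<Psi> t)"
    using circle_homeo_of_interval_homeo[OF a \<Psi>(1,2,3,4)] by metis
  obtain \<phi> where \<phi>: "circle_homeo \<phi>" "\<And>x. x \<in> S\<^sup>1 \<Longrightarrow> \<phi> (\<psi> x) = x" "\<And>x. x \<in> S\<^sup>1 \<Longrightarrow> \<psi> (\<phi> x) = x"
    using circle_homeo_inverse[OF \<psi>(1)] by metis
  show thesis
  proof (rule that[OF \<phi>(1)])
    fix x :: complex assume x: "x \<in> S\<^sup>1"
    define t where "t = arc_coord a (\<phi> x)"
    have y: "\<phi> x \<in> S\<^sup>1" using x circle_homeoD(4)[OF \<phi>(1)] by blast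
    have t: "0 \<le> t" "t < 1" "arc_point a t = \<phi> x"
      using y a arc_coord_bounds by (auto simp: t_def)
    have eq: "arc_point a (\<Psi> t) = x" using \<psi>(2)[of t] t \<phi>(3)[OF x] by simp
    define i where "i = nat \<lfloor>t * M\<rfloor>"
    have i: "i < M" "t \<in> {i / M..Suc i / M}"
      unfolding i_def using unit_interval_cell[OF t(1,2) \<open>M > 0\<close>] by auto
    have "\<Psi> t \<in> {i / M..Suc i / M}" using \<Psi>(5)[OF i] .
    then have "\<bar>t - \<Psi> t\<bar> \<le> Suc i / M - i / M" using i(2) unfolding atLeastAtMost_iff by linarith
    also have "\<dots> = 1 / M" by (simp add: add_divide_distrib)
    finally have "2 * pi * \<bar>t - \<Psi> t\<bar> \<le> 2 * pi * (1 / M)" by (rule mult_left_mono) simp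
    then show "dist (\<phi> x) x \<le> 2 * pi / M"
      using dist_arc_point_le[OF a, of t "\<Psi> t"] t(3) eq by simp
  next
    fix i s assume i: "i < M" and s: "s \<in> {i / M + \<kappa>..Suc i / M - \<kappa>}"
    then have "s \<in> {i / M + \<kappa>'..Suc i / M - \<kappa>'}" using \<kappa>'(3) by auto
    then obtain t where t: "t \<in> {z i - \<eta>'..z i + \<eta>'}" "\<Psi> t = s"
      using \<Psi>(6)[OF i] by blast
    have "0 \<le> real i / M" "Suc i / M \<le> 1" using i by (auto simp: field_simps)
    moreover have "i / M \<le> z i - \<eta>'" "z i + \<eta>' \<le> Suc i / M" using z' i by auto
    ultimately have "t \<in> {0..1}" using t(1) unfolding atLeastAtMost_iff by linarith
    then have "\<phi> (arc_point a s) = arc_point a t"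
      using \<psi>(2)[of t] \<phi>(2)[of "arc_point a t"] t(2) a by simp
    then show "\<exists>t\<in>{z i - \<eta>..z i + \<eta>}. \<phi> (arc_point a s) = arc_point a t"
      using t(1) \<eta>'_le by force
  qed
qed

lemma infinite_circle: "infinite (S\<^sup>1 :: complex set)"
proof -
  have "inj_on (arc_point 1) {0<..<1}"
    by (rule inj_onI) (simp add: arc_point_eq_iff)
  then have "infinite (arc_point 1 ` {0<..<1})"
    by (simp add: finite_image_iff infinite_Ioo)
  then show ?thesis by (rule infinite_super[rotated]) auto
qed

section \<open>Partition of the circle into equal arcs\<close>

locale circle_partition =
  fixes a :: complex and M :: nat
  assumes a: "a \<in> S\<^sup>1" and M: "M > 0"
begin

text \<open>Index \<open>M\<close> repeats the base point, so that \<open>Suc i\<close> is a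
  legitimate index for the right end of every cell.\<close>

definition nodes :: "complex set" where
  "nodes = (\<lambda>i. arc_point a (i / M)) ` {..M}"

definition cell :: "nat \<Rightarrow> complex set" where
  "cell i = arc_point a ` {i / M..Suc i / M}"

definition cell_index :: "complex \<Rightarrow> nat" where
  "cell_index x = nat \<lfloor>arc_coord a x * M\<rfloor>"

lemma finite_nodes: "finite nodes"
  by (simp add: nodes_def)

lemma node_in_nodes: "i \<le> M \<Longrightarrow> arc_point a (real i / real M) \<in> nodes"
  by (auto simp: nodes_def)

lemma cell_bounds: "i < M \<Longrightarrow> 0 \<le> real i / M" "i < M \<Longrightarrow> Suc i / M \<le> 1"
  using M by (auto simp: field_simps)

lemma closed_cell: "closed (cell i)"
  unfolding cell_def by (intro compact_imp_closed compact_continuous_image continuous_intros) auto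

lemma cell_index: "x \<in> S\<^sup>1 \<Longrightarrow> cell_index x < M" "x \<in> S\<^sup>1 \<Longrightarrow> x \<in> cell (cell_index x)"
proof -
  assume x: "x \<in> S\<^sup>1"
  note c = unit_interval_cell[OF arc_coord_bounds(1)[of a x] arc_coord_bounds(2)[of a x] M]
  show "cell_index x < M" using c(1) by (simp add: cell_index_def)
  have "arc_point a (arc_coord a x) \<in> cell (cell_index x)"
    using c(2) by (simp only: cell_def cell_index_def imageI)
  then show "x \<in> cell (cell_index x)" using x a by simp
qed

lemma open_cell_index:
  assumes i: "i < M" and t: "i / M < t" "t < Suc i / M"
  shows "cell_index (arc_point a t) = i" "arc_point a t \<notin> nodes"
proof -
  have t01: "0 \<le> t" "t < 1" using t cell_bounds[OF i] by linarith+
  have tM: "real i < t * M" "t * M < real i + 1"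
    using t M by (auto simp: field_simps)
  then have "\<lfloor>t * M\<rfloor> = int i" by linarith
  then show "cell_index (arc_point a t) = i"
    using t01 a by (simp add: cell_index_def)
  show "arc_point a t \<notin> nodes"
  proof
    assume "arc_point a t \<in> nodes"
    then obtain j where j: "j \<le> M" "arc_point a t = arc_point a (j / M)" by (auto simp: nodes_def)
    show False
    \<comment> \<open>The last node is the base point, so its coordinate is 0 and not
      \<open>M / M\<close>.\<close>
    proof (cases "j = M")
      case True
      then have "t = 0" using j(2) M t01 a arc_point_eq_base_iff[of a t] by auto
      then show False using t cell_bounds(1)[OF i] by simp
    next
      case False
      then have "t = j / M" using j M t01 a by (simp add: arc_point_eq_iff field_simps)
      then have "real i < real j" "real j < real i + 1" using tM M by auto
      then have "real i < real j" "real j < real (Suc i)" by simp_all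
      then show False unfolding of_nat_less_iff by simp
    qed
  qed
qed

lemma cell_minus_nodes:
  assumes i: "i < M" and x: "x \<in> cell i" "x \<notin> nodes"
  obtains t where "x = arc_point a t" "i / M < t" "t < Suc i / M"
proof -
  obtain t where t: "x = arc_point a t" "i / M \<le> t" "t \<le> Suc i / M"
    using x(1) by (auto simp: cell_def)
  moreover have "t \<noteq> i / M" "t \<noteq> Suc i / M"
    using x(2) t(1) node_in_nodes[of i] node_in_nodes[of "Suc i"] i by auto
  ultimately show thesis using that by force
qed

lemma cell_index_unique: "i < M \<Longrightarrow> x \<in> cell i \<Longrightarrow> x \<notin> nodes \<Longrightarrow> cell_index x = i"
  by (metis cell_minus_nodes open_cell_index(1))

lemma cell_diameter:
  assumes "x \<in> cell i" "y \<in> cell i"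
  shows "dist x y \<le> 2 * pi / M"
proof -
  obtain s t where st: "x = arc_point a s" "y = arc_point a t"
      "s \<in> {i / M..Suc i / M}" "t \<in> {i / M..Suc i / M}"
    using assms by (auto simp: cell_def)
  have "\<bar>s - t\<bar> \<le> Suc i / M - i / M" using st(3,4) unfolding atLeastAtMost_iff by linarith
  also have "\<dots> = 1 / M" by (simp add: add_divide_distrib)
  finally have "2 * pi * \<bar>s - t\<bar> \<le> 2 * pi * (1 / M)" by (rule mult_left_mono) simp
  with dist_arc_point_le[OF a, of s t] st show ?thesis by simp
qed

lemma openin_open_cell: "i < M \<Longrightarrow> openin (top_of_set S\<^sup>1) (cell i - nodes)"
proof -
  assume i: "i < M"
  have "cell i - nodes = arc_point a ` {i / M<..<Suc i / M}"
  proof (intro equalityI subsetI)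
    fix x assume "x \<in> cell i - nodes"
    then show "x \<in> arc_point a ` {i / M<..<Suc i / M}"
      by (auto elim: cell_minus_nodes[OF i])
  next
    fix x assume "x \<in> arc_point a ` {i / M<..<Suc i / M}"
    then show "x \<in> cell i - nodes"
      using open_cell_index(2)[OF i] by (auto simp: cell_def)
  qed
  then show ?thesis
    using openin_arc_point_image[OF a cell_bounds[OF i]] by simp
qed

text \<open>The part of an arc that a crushing homeomorphism contracts.\<close>
definition core :: "real \<Rightarrow> nat \<Rightarrow> complex set" where
  "core \<rho> i = {x \<in> cell i. \<forall>c\<in>nodes. \<rho> \<le> dist x c}"

lemma closed_core: "closed (core \<rho> i)"
proof -
  have "core \<rho> i = cell i \<inter> (\<Inter>c\<in>nodes. {x. \<rho> \<le> dist x c})" by (auto simp: core_def)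
  then show ?thesis
    by (auto intro!: closed_Int closed_cell closed_INT closed_Collect_le continuous_intros)
qed

lemma core_subset: "core \<rho> i \<subseteq> S\<^sup>1"
  using a by (auto simp: core_def cell_def)

lemma core_not_node: "\<rho> > 0 \<Longrightarrow> x \<in> core \<rho> i \<Longrightarrow> x \<notin> nodes"
  by (auto simp: core_def)

lemma core_index: "\<rho> > 0 \<Longrightarrow> i < M \<Longrightarrow> x \<in> core \<rho> i \<Longrightarrow> cell_index x = i"
  using core_not_node by (auto simp: core_def intro: cell_index_unique)

text \<open>A chord is at most 2 pi times the difference of the parameters, so distance \<rho> from
  the two end nodes leaves at least \<rho> / (2 pi) in the coordinate. This value becomes the
  trimming constant of the crushing.\<close>

lemma core_coordinate:
  assumes i: "i < M" and x: "x \<in> core \<rho> i"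
  obtains s where "x = arc_point a s" "s \<in> {i / M + \<rho> / (2 * pi)..Suc i / M - \<rho> / (2 * pi)}"
proof -
  obtain s where s: "x = arc_point a s" "i / M \<le> s" "s \<le> Suc i / M"
    using x by (auto simp: core_def cell_def)
  have "\<rho> \<le> 2 * pi * \<bar>s - j / M\<bar>" if "j \<le> M" for j
    using x node_in_nodes[OF that] dist_arc_point_le[OF a, of s "j / M"] s(1)
    by (fastforce simp: core_def)
  from this[of i] this[of "Suc i"] have "\<rho> \<le> 2 * pi * (s - i / M)" "\<rho> \<le> 2 * pi * (Suc i / M - s)"
    using s i by (simp_all only: abs_of_nonneg abs_of_nonpos diff_ge_0_iff_ge diff_le_0_iff_le minus_diff_eq Suc_leI less_imp_le)
  then have "\<rho> / (2 * pi) \<le> s - i / M" "\<rho> / (2 * pi) \<le> Suc i / M - s"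
    by (simp_all add: divide_le_eq mult.commute)
  with s that show thesis by simp
qed

text \<open>The map is f after a crushing, which sends each core close to its target point, hence
  close to the value \<open>W i\<close>. Because \<open>W i\<close> is not a node, a ball around it
  fits into the core of the cell containing it. The constants are chosen in turn: \<rho> from the
  distances of the values to the nodes and the measure of the discarded part, then \<open>r\<close>
  from \<rho> and the measure of the balls, and finally \<eta> from \<open>r\<close> by continuity
  of f.\<close>

lemma crush_onto_targets:
  assumes f: "circle_homeo f" and \<epsilon>: "\<epsilon> > 0"
    and mesh: "\<And>x y. x \<in> S\<^sup>1 \<Longrightarrow> y \<in> S\<^sup>1 \<Longrightarrow> dist x y \<le> 2 * pi / M \<Longrightarrow> dist (f x) (f y) < \<epsilon>"
    and z: "\<And>i. i < M \<Longrightarrow> i / M < z i \<and> z i < Suc i / M"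
    and w: "\<And>i. i < M \<Longrightarrow> f (arc_point a (z i)) \<notin> nodes"
    and e: "e > 0"
  obtains g \<rho> r where "circle_homeo g" "\<And>x. x \<in> S\<^sup>1 \<Longrightarrow> dist (f x) (g x) < \<epsilon>" "\<rho> > 0" "r > 0"
    "\<And>i. i < M \<Longrightarrow> g ` core \<rho> i \<subseteq> ball (f (arc_point a (z i))) r"
    "\<And>i. i < M \<Longrightarrow> ball (f (arc_point a (z i))) r \<inter> S\<^sup>1 \<subseteq> core \<rho> (cell_index (f (arc_point a (z i))))"
    "emeasure lebesgue_circle (S\<^sup>1 - (\<Union>i<M. core \<rho> i)) < ennreal e"
    "emeasure lebesgue_circle ((\<Union>i<M. ball (f (arc_point a (z i))) r) \<inter> S\<^sup>1) < ennreal e"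
proof -
  define W where "W i = f (arc_point a (z i))" for i
  have W: "W i \<in> S\<^sup>1" for i unfolding W_def using circle_homeoD(4)[OF f] a by simp
  have W_node: "W i \<notin> nodes" if "i < M" for i unfolding W_def using w[OF that] .
  obtain \<rho>0 where \<rho>0: "\<rho>0 > 0" "emeasure lebesgue_circle {x \<in> S\<^sup>1. \<exists>c\<in>nodes. dist x c \<le> \<rho>0} < ennreal e"
    by (rule emeasure_lebesgue_circle_near_finite[OF finite_nodes e])
  have "\<exists>d>0. \<forall>c\<in>nodes. d < dist (W i) c" if "i < M" for i
  proof -
    obtain d where d: "d > 0" "\<forall>c\<in>nodes. c \<noteq> W i \<longrightarrow> d \<le> dist (W i) c"
      using finite_set_avoid[OF finite_nodes, of "W i"] by metis
    \<comment> \<open>Halving gives a strict inequality, so that \<rho> < \<open>dist x c\<close>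
      defines an open neighbourhood of \<open>W i\<close>.\<close>
    have "d / 2 < dist (W i) c" if c: "c \<in> nodes" for c
    proof -
      have "c \<noteq> W i" using c W_node[OF \<open>i < M\<close>] by auto
      then show ?thesis using d c by force
    qed
    with d(1) show ?thesis by (intro exI[of _ "d / 2"]) auto
  qed
  then obtain d where d: "\<And>i. i < M \<Longrightarrow> d i > 0" "\<And>i c. i < M \<Longrightarrow> c \<in> nodes \<Longrightarrow> d i < dist (W i) c"
    by metis
  define \<rho> where "\<rho> = Min (insert \<rho>0 (d ` {..<M}))"
  have \<rho>: "\<rho> > 0" "\<rho> \<le> \<rho>0" "\<And>i. i < M \<Longrightarrow> \<rho> \<le> d i"
    using \<rho>0(1) d(1) by (auto simp: \<rho>_def)
  have "\<exists>r>0. ball (W i) r \<inter> S\<^sup>1 \<subseteq> core \<rho> (cell_index (W i))" if i: "i < M" for i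
  proof -
    let ?N = "(cell (cell_index (W i)) - nodes) \<inter> (\<Inter>c\<in>nodes. {x. \<rho> < dist x c})"
    have "open (\<Inter>c\<in>nodes. {x. \<rho> < dist x c})"
      by (intro open_INT finite_nodes ballI open_Collect_less continuous_intros)
    then have "openin (top_of_set S\<^sup>1) ?N"
      using openin_open_cell[OF cell_index(1)[OF W]] by (rule openin_Int_open[rotated])
    moreover have "W i \<in> ?N"
      using cell_index(2)[OF W] W_node[OF i] d(2)[OF i] \<rho>(3)[OF i] by force
    ultimately obtain r where r: "r > 0" "ball (W i) r \<inter> S\<^sup>1 \<subseteq> ?N"
      using openin_contains_ball by metis
    moreover have "?N \<subseteq> core \<rho> (cell_index (W i))" by (force simp: core_def)
    ultimately show ?thesis by blast
  qed
  then obtain R where R: "\<And>i. i < M \<Longrightarrow> R i > 0"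
      "\<And>i. i < M \<Longrightarrow> ball (W i) (R i) \<inter> S\<^sup>1 \<subseteq> core \<rho> (cell_index (W i))"
    by metis
  obtain r0 where r0: "r0 > 0" "emeasure lebesgue_circle {x \<in> S\<^sup>1. \<exists>c\<in>W ` {..<M}. dist x c \<le> r0} < ennreal e"
    by (rule emeasure_lebesgue_circle_near_finite[of "W ` {..<M}", OF _ e]) simp
  define r where "r = Min (insert r0 (R ` {..<M}))"
  have r: "r > 0" "r \<le> r0" "\<And>i. i < M \<Longrightarrow> r \<le> R i"
    using r0(1) R(1) by (auto simp: r_def)
  have cont: "continuous_on UNIV (\<lambda>t. f (arc_point a t))"
    by (rule continuous_on_compose2[OF circle_homeoD(1)[OF f]]) (use a in \<open>auto intro!: continuous_intros\<close>)
  have "\<exists>\<eta>>0. \<forall>t. \<bar>t - z i\<bar> < \<eta> \<longrightarrow> dist (f (arc_point a t)) (W i) < r" for i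
    using cont r(1) unfolding continuous_on_iff W_def by (force simp: dist_real_def)
  then obtain h where h: "\<And>i. h i > 0" "\<And>i t. \<bar>t - z i\<bar> < h i \<Longrightarrow> dist (f (arc_point a t)) (W i) < r"
    by metis
  define m where "m = Min (insert 1 (h ` {..<M}))"
  have m: "m > 0" "\<And>i. i < M \<Longrightarrow> m \<le> h i" using h(1) by (auto simp: m_def)
  \<comment> \<open>Half of \<open>m\<close>, since the crushed points lie in a closed interval
    around \<open>z i\<close> while \<open>h i\<close> is a strict bound.\<close>
  define \<eta> where "\<eta> = m / 2"
  have \<eta>: "\<eta> > 0" using m(1) by (simp add: \<eta>_def)
  have \<eta>_less: "\<eta> < h i" if "i < M" for i using m(1) m(2)[OF that] by (simp add: \<eta>_def)
  have \<kappa>: "\<rho> / (2 * pi) > 0" using \<rho>(1) by simp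
  show thesis
  proof (rule crushing_homeo[OF a M _ \<eta> \<kappa>, of z])
    show "i / M < z i \<and> z i < Suc i / M" if "i < M" for i using z[OF that] .
  next
    fix \<phi> assume \<phi>: "circle_homeo \<phi>" "\<And>x. x \<in> S\<^sup>1 \<Longrightarrow> dist (\<phi> x) x \<le> 2 * pi / M"
      "\<And>i s. i < M \<Longrightarrow> s \<in> {i / M + \<rho> / (2 * pi)..Suc i / M - \<rho> / (2 * pi)} \<Longrightarrow>
         \<exists>t\<in>{z i - \<eta>..z i + \<eta>}. \<phi> (arc_point a s) = arc_point a t"
  show thesis
  proof (rule that[of "f \<circ> \<phi>" \<rho> r])
    show "circle_homeo (f \<circ> \<phi>)" using f \<phi>(1) by (rule circle_homeo_comp)
    show "dist (f x) ((f \<circ> \<phi>) x) < \<epsilon>" if "x \<in> S\<^sup>1" for x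
      using mesh[OF that, of "\<phi> x"] \<phi>(2)[OF that] circle_homeoD(4)[OF \<phi>(1)] that
      by (simp add: dist_commute)
    show "(f \<circ> \<phi>) ` core \<rho> i \<subseteq> ball (f (arc_point a (z i))) r" if i: "i < M" for i
    proof (rule image_subsetI)
      fix x assume "x \<in> core \<rho> i"
      then obtain s where s: "x = arc_point a s" "s \<in> {i / M + \<rho> / (2 * pi)..Suc i / M - \<rho> / (2 * pi)}"
        using core_coordinate[OF i] by metis
      obtain t where t: "t \<in> {z i - \<eta>..z i + \<eta>}" "\<phi> x = arc_point a t"
        using \<phi>(3)[OF i s(2)] s(1) by auto
      have "\<bar>t - z i\<bar> < h i" using t(1) \<eta>_less[OF i] by auto
      from h(2)[OF this] show "(f \<circ> \<phi>) x \<in> ball (f (arc_point a (z i))) r"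
        using t(2) by (simp add: W_def dist_commute)
    qed
    show "ball (f (arc_point a (z i))) r \<inter> S\<^sup>1 \<subseteq> core \<rho> (cell_index (f (arc_point a (z i))))"
      if i: "i < M" for i
      using R(2)[OF i] r(3)[OF i] by (force simp: W_def)
    have meas_near: "{x \<in> S\<^sup>1. \<exists>c\<in>X. dist x c \<le> \<theta>} \<in> sets lebesgue_circle" if "finite X" for X :: "complex set" and \<theta>
    proof -
      have "{x \<in> S\<^sup>1. \<exists>c\<in>X. dist x c \<le> \<theta>} = S\<^sup>1 \<inter> (\<Union>c\<in>X. cball c \<theta>)" by (auto simp: dist_commute)
      moreover have "closed (S\<^sup>1 \<inter> (\<Union>c\<in>X. cball c \<theta>))"
        using that by (intro closed_Int closed_UN) auto
      ultimately show ?thesis by (simp add: sets_borel_circleI borel_closed)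
    qed
    have "S\<^sup>1 - (\<Union>i<M. core \<rho> i) \<subseteq> {x \<in> S\<^sup>1. \<exists>c\<in>nodes. dist x c \<le> \<rho>0}"
    proof
      fix x assume x: "x \<in> S\<^sup>1 - (\<Union>i<M. core \<rho> i)"
      then have "x \<notin> core \<rho> (cell_index x)" using cell_index(1)[of x] by blast
      then obtain c where "c \<in> nodes" "dist x c < \<rho>"
        using cell_index(2)[of x] x by (auto simp: core_def not_le)
      then show "x \<in> {x \<in> S\<^sup>1. \<exists>c\<in>nodes. dist x c \<le> \<rho>0}" using x \<rho>(2) by force
    qed
    then show "emeasure lebesgue_circle (S\<^sup>1 - (\<Union>i<M. core \<rho> i)) < ennreal e"
      using \<rho>0(2) meas_near[OF finite_nodes] by (meson emeasure_mono order.strict_trans1)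
    have "(\<Union>i<M. ball (f (arc_point a (z i))) r) \<inter> S\<^sup>1 \<subseteq> {x \<in> S\<^sup>1. \<exists>c\<in>W ` {..<M}. dist x c \<le> r0}"
      using r(2) by (force simp: W_def dist_commute)
    then show "emeasure lebesgue_circle ((\<Union>i<M. ball (f (arc_point a (z i))) r) \<inter> S\<^sup>1) < ennreal e"
      using r0(2) meas_near[of "W ` {..<M}"] by (meson emeasure_mono finite_imageI finite_lessThan order.strict_trans1)
  qed (use \<rho>(1) r(1) in auto)
  qed
qed

end

lemma finite_set_separated:
  fixes Q :: "'a::metric_space set"
  assumes "finite Q"
  obtains d where "d > 0" "\<And>x y. x \<in> Q \<Longrightarrow> y \<in> Q \<Longrightarrow> dist x y < d \<Longrightarrow> x = y"
proof -
  let ?D = "insert 1 ((\<lambda>(x, y). dist x y) ` {(x, y) \<in> Q \<times> Q. x \<noteq> y})"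
  have "finite {(x, y) \<in> Q \<times> Q. x \<noteq> y}"
    by (rule finite_subset[of _ "Q \<times> Q"]) (use assms in auto)
  then have fin: "finite ?D" by simp
  show thesis
  proof (rule that[of "Min ?D"])
    show "Min ?D > 0" using fin by (subst Min_gr_iff) auto
    fix x y assume xy: "x \<in> Q" "y \<in> Q" "dist x y < Min ?D"
    show "x = y"
    proof (rule ccontr)
      assume "x \<noteq> y"
      then have "dist x y \<in> ?D" using xy by (intro insertI2 image_eqI[where x = "(x, y)"]) auto
      then have "Min ?D \<le> dist x y" by (rule Min_le[OF fin])
      with xy(3) show False by linarith
    qed
  qed
qed

text \<open>Rotating a point of \<open>Q\<close> back by the angle of a node gives the only base
  point for which it would become that node. Finitely many base points are excluded in this
  way.\<close>

lemma circle_base_point_avoiding: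
  assumes "finite Q"
  obtains a where "a \<in> S\<^sup>1" "\<And>i. i \<le> M \<Longrightarrow> arc_point a (real i / real M) \<notin> Q"
proof -
  define B where "B = (\<lambda>(x, i). x * cis (- (2 * pi * (real i / real M)))) ` (Q \<times> {..M})"
  have "finite B" using assms by (simp add: B_def)
  then have "infinite (S\<^sup>1 - B)" using infinite_circle by (rule Diff_infinite_finite)
  then obtain a where a: "a \<in> S\<^sup>1 - B" using infinite_imp_nonempty by blast
  show thesis
  proof (rule that)
    show "a \<in> S\<^sup>1" using a by simp
    fix i assume i: "i \<le> M"
    show "arc_point a (real i / real M) \<notin> Q"
    proof
      assume "arc_point a (real i / real M) \<in> Q"
      moreover have "a = arc_point a (real i / real M) * cis (- (2 * pi * (real i / real M)))"
        by (simp add: arc_point_def cis_mult)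
      ultimately have "a \<in> B"
        unfolding B_def using i by (intro image_eqI[where x = "(arc_point a (real i / real M), i)"]) auto
      then show False using a by simp
    qed
  qed
qed

context circle_partition
begin

text \<open>A cell that contains a point of \<open>Q\<close> must take it as its target; separation
  leaves no choice, and invariance of \<open>Q\<close> keeps the image off the nodes. In any other
  cell injectivity of f rules out only finitely many parameters.\<close>

lemma targets_exist:
  assumes f: "circle_homeo f" and Q: "finite Q" "Q \<subseteq> S\<^sup>1" "f ` Q \<subseteq> Q" "nodes \<inter> Q = {}"
    and sep: "\<And>x y. x \<in> Q \<Longrightarrow> y \<in> Q \<Longrightarrow> dist x y \<le> 2 * pi / M \<Longrightarrow> x = y"
    and i: "i < M"
  shows "\<exists>z. i / M < z \<and> z < Suc i / M \<and> f (arc_point a z) \<notin> nodes \<and>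
           (\<forall>p\<in>Q. cell_index p = i \<longrightarrow> arc_point a z = p)"
proof (cases "\<exists>p\<in>Q. cell_index p = i")
  case True
  then obtain p where p: "p \<in> Q" "cell_index p = i" by blast
  then have "p \<in> cell i" "p \<notin> nodes" using Q cell_index(2)[of p] by auto
  then obtain z where z: "p = arc_point a z" "i / M < z" "z < Suc i / M"
    using cell_minus_nodes[OF i] by blast
  have "f p \<notin> nodes" using p Q by blast
  moreover have "p' = p" if "p' \<in> Q" "cell_index p' = i" for p'
    using that p Q(2) cell_index(2)[of p'] cell_index(2)[of p]
    by (intro sep cell_diameter[of _ i]) auto
  ultimately show ?thesis using z by blast
next
  case False
  let ?I = "{i / M<..<Suc i / M}"
  have inj: "inj_on (\<lambda>t. f (arc_point a t)) ?I"
  proof (rule inj_onI)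
    fix s t assume st: "s \<in> ?I" "t \<in> ?I" "f (arc_point a s) = f (arc_point a t)"
    have "arc_point a s = arc_point a t"
      using st(3) circle_homeoD(3)[OF f] a by (metis arc_point_in_circle inj_onD)
    moreover have "0 \<le> s" "s < 1" "0 \<le> t" "t < 1"
      using st(1,2) cell_bounds[OF i] unfolding greaterThanLessThan_iff by linarith+
    ultimately show "s = t" using a by (simp add: arc_point_eq_iff)
  qed
  have "finite ((\<lambda>t. f (arc_point a t)) -` nodes \<inter> ?I)"
    by (rule finite_vimage_IntI[OF finite_nodes inj])
  moreover have "infinite ?I" using M by (intro infinite_Ioo) (simp add: field_simps)
  ultimately have "infinite (?I - ((\<lambda>t. f (arc_point a t)) -` nodes \<inter> ?I))"
    by (rule Diff_infinite_finite)
  then obtain z where "z \<in> ?I - ((\<lambda>t. f (arc_point a t)) -` nodes \<inter> ?I)"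
    using infinite_imp_nonempty by blast
  with False show ?thesis by auto
qed

end

text \<open>\<open>f\<close> is crushed onto finitely many points, among them all points of the sets \<open>P l\<close>. The
  arcs around \<open>P l\<close> then form a trap.\<close>
lemma trapping_near_invariant_sets:
  assumes f: "circle_homeo f" and \<epsilon>: "\<epsilon> > 0"
    and P: "\<And>l. l < N \<Longrightarrow> finite (P l) \<and> P l \<noteq> {} \<and> P l \<subseteq> S\<^sup>1 \<and> f ` P l \<subseteq> P l"
    and disj: "\<And>i j. i < N \<Longrightarrow> j < N \<Longrightarrow> i \<noteq> j \<Longrightarrow> P i \<inter> P j = {}"
  shows "\<exists>g. circle_homeo g \<and> (\<forall>x\<in>S\<^sup>1. dist (f x) (g x) < \<epsilon>) \<and> trapping N g"
proof -
  define Q where "Q = (\<Union>l<N. P l)"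
  have Q: "finite Q" "Q \<subseteq> S\<^sup>1" "f ` Q \<subseteq> Q"
    unfolding Q_def by (simp add: P, use P in blast, use P in blast)
  have "uniformly_continuous_on S\<^sup>1 f"
    using circle_homeoD(1)[OF f] by (intro compact_uniformly_continuous) auto
  then obtain d0 where d0: "d0 > 0"
      "\<And>x y. x \<in> S\<^sup>1 \<Longrightarrow> y \<in> S\<^sup>1 \<Longrightarrow> dist y x < d0 \<Longrightarrow> dist (f y) (f x) < \<epsilon>"
    using \<epsilon> unfolding uniformly_continuous_on_def by metis
  obtain d1 where d1: "d1 > 0" "\<And>x y. x \<in> Q \<Longrightarrow> y \<in> Q \<Longrightarrow> dist x y < d1 \<Longrightarrow> x = y"
    by (rule finite_set_separated[OF Q(1)]) blast
  \<comment> \<open>Cells have diameter at most 2 pi / \<open>M\<close>. Below \<open>d0\<close>, f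
    varies by less than \<epsilon> on a cell; below \<open>d1\<close>, a cell contains at most one
    point of \<open>Q\<close>.\<close>
  obtain M :: nat where "real M > 2 * pi / min d0 d1" using reals_Archimedean2 by blast
  then have "0 < real M" "2 * pi < real M * min d0 d1"
  proof -
    assume less: "2 * pi / min d0 d1 < real M"
    have pos: "0 < min d0 d1" using d0(1) d1(1) by simp
    then have "0 < 2 * pi / min d0 d1" by simp
    then show "0 < real M" using less by linarith
    show "2 * pi < real M * min d0 d1" using less pos_divide_less_eq[OF pos] by blast
  qed
  then have small: "M > 0" "2 * pi / M < min d0 d1"
    using pos_divide_less_eq[of "real M" "2 * pi" "min d0 d1"] by (simp_all only: of_nat_0_less_iff mult.commute)
  obtain a where base: "a \<in> S\<^sup>1" "\<And>i. i \<le> M \<Longrightarrow> arc_point a (real i / real M) \<notin> Q"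
    by (rule circle_base_point_avoiding[OF Q(1)]) blast
  interpret circle_partition a M using base small by unfold_locales auto
  have nodes: "nodes \<inter> Q = {}" using base(2) by (auto simp: nodes_def)
  have sep: "x = y" if "x \<in> Q" "y \<in> Q" "dist x y \<le> 2 * pi / M" for x y
    using that small(2) by (intro d1(2)) auto
  have "\<forall>i\<in>{..<M}. \<exists>z. i / M < z \<and> z < Suc i / M \<and> f (arc_point a z) \<notin> nodes \<and>
      (\<forall>p\<in>Q. cell_index p = i \<longrightarrow> arc_point a z = p)"
    by (intro ballI targets_exist[OF f Q nodes] sep) simp_all
  from bchoice[OF this] obtain z where z_all: "\<forall>i\<in>{..<M}. i / M < z i \<and> z i < Suc i / M \<and>
      f (arc_point a (z i)) \<notin> nodes \<and> (\<forall>p\<in>Q. cell_index p = i \<longrightarrow> arc_point a (z i) = p)"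
    by blast
  have z: "i / M < z i \<and> z i < Suc i / M" "f (arc_point a (z i)) \<notin> nodes"
      "\<And>p. p \<in> Q \<Longrightarrow> cell_index p = i \<Longrightarrow> arc_point a (z i) = p" if "i < M" for i
    using z_all that by auto
  define W where "W i = f (arc_point a (z i))" for i
  have W: "W i \<in> S\<^sup>1" for i unfolding W_def using circle_homeoD(4)[OF f] a by simp
  have mesh: "dist (f x) (f y) < \<epsilon>" if "x \<in> S\<^sup>1" "y \<in> S\<^sup>1" "dist x y \<le> 2 * pi / M" for x y
    using that small(2) by (intro d0(2)) auto
  have e: "inverse (real (Suc N)) > 0" by simp
  show ?thesis
  proof (rule crush_onto_targets[OF f \<epsilon> _ _ _ e, of z])
    show "dist (f x) (f y) < \<epsilon>" if "x \<in> S\<^sup>1" "y \<in> S\<^sup>1" "dist x y \<le> 2 * pi / M" for x y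
      using mesh[OF that] .
    show "i / M < z i \<and> z i < Suc i / M" if "i < M" for i using z(1)[OF that] .
    show "f (arc_point a (z i)) \<notin> nodes" if "i < M" for i using z(2)[OF that] .
  next
    fix g \<rho> r
    assume g: "circle_homeo g" "\<And>x. x \<in> S\<^sup>1 \<Longrightarrow> dist (f x) (g x) < \<epsilon>" and \<rho>: "\<rho> > 0" and r: "r > 0"
      and img: "\<And>i. i < M \<Longrightarrow> g ` core \<rho> i \<subseteq> ball (f (arc_point a (z i))) r"
      and sub: "\<And>i. i < M \<Longrightarrow> ball (f (arc_point a (z i))) r \<inter> S\<^sup>1 \<subseteq> core \<rho> (cell_index (f (arc_point a (z i))))"
      and thin: "emeasure lebesgue_circle (S\<^sup>1 - (\<Union>i<M. core \<rho> i)) < ennreal (inverse (real (Suc N)))"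
        "emeasure lebesgue_circle ((\<Union>i<M. ball (f (arc_point a (z i))) r) \<inter> S\<^sup>1) < ennreal (inverse (real (Suc N)))"
    have sub': "ball (W i) r \<inter> S\<^sup>1 \<subseteq> core \<rho> (cell_index (W i))" if "i < M" for i
      using sub[OF that] by (simp only: W_def)
    have img': "g ` core \<rho> i \<subseteq> ball (W i) r" if "i < M" for i
      using img[OF that] by (simp only: W_def)
    \<comment> \<open>On the level of indices the map is \<open>i\<close> to
      \<open>cell_index (W i)\<close>. Every set of indices invariant under it gives a trap: all
      indices give the large one, and the cells around a single \<open>P l\<close> give the small
      ones.\<close>
    have trap: "trap g (\<Union>i\<in>I. core \<rho> i) (\<Union>i\<in>I. ball (W i) r)"
      if I: "I \<subseteq> {..<M}" "\<And>i. i \<in> I \<Longrightarrow> cell_index (W i) \<in> I" for I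
      unfolding trap_def
    proof (intro conjI)
      have "finite I" using I(1) by (rule finite_subset) simp
      then show "closed (\<Union>i\<in>I. core \<rho> i)" using closed_core by (intro closed_UN) auto
      show "(\<Union>i\<in>I. core \<rho> i) \<subseteq> S\<^sup>1" using core_subset by blast
      show "open (\<Union>i\<in>I. ball (W i) r)" by auto
      show "g ` (\<Union>i\<in>I. core \<rho> i) \<subseteq> (\<Union>i\<in>I. ball (W i) r)"
        using img' I(1) by blast
      show "(\<Union>i\<in>I. ball (W i) r) \<inter> S\<^sup>1 \<subseteq> (\<Union>i\<in>I. core \<rho> i)"
        using sub' I by blast
    qed
    define I where "I l = cell_index ` P l" for l
    have PQ: "p \<in> Q" "p \<in> S\<^sup>1" if "l < N" "p \<in> P l" for l p
      using P[OF that(1)] that by (auto simp: Q_def)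
    have target: "arc_point a (z (cell_index p)) = p" if "l < N" "p \<in> P l" for l p
      using PQ[OF that] by (intro z(3) cell_index(1)) auto
    have W_point: "W (cell_index p) = f p" if "l < N" "p \<in> P l" for l p
      unfolding W_def target[OF that] by (rule refl)
    \<comment> \<open>The target in the cell of a point \<open>p\<close> of \<open>P l\<close> is
      \<open>p\<close>, so the associated value is \<open>f p\<close>, again a point of
      \<open>P l\<close>.\<close>
    have I_closed: "cell_index (W i) \<in> I l" if l: "l < N" and i: "i \<in> I l" for i l
      using i W_point[OF l] P[OF l] by (force simp: I_def)
    have I_sub: "I l \<subseteq> {..<M}" if "l < N" for l
      using PQ[OF that] cell_index(1) by (auto simp: I_def)
    have I_disj: "I i \<inter> I j = {}" if ij: "i < N" "j < N" "i \<noteq> j" for i j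
    proof (rule ccontr)
      assume "I i \<inter> I j \<noteq> {}"
      then obtain p p' where pp: "p \<in> P i" "p' \<in> P j" "cell_index p = cell_index p'"
        by (auto simp: I_def)
      have "p = p'"
        using target[OF ij(1) pp(1)] target[OF ij(2) pp(2)] pp(3) by metis
      then show False using pp disj[OF ij] by blast
    qed
    have traps: "(\<forall>l<N. trap g (\<Union>i\<in>I l. core \<rho> i) (\<Union>i\<in>I l. ball (W i) r) \<and> (\<Union>i\<in>I l. core \<rho> i) \<noteq> {}) \<and>
      (\<forall>i<N. \<forall>j<N. i \<noteq> j \<longrightarrow> (\<Union>i\<in>I i. core \<rho> i) \<inter> (\<Union>i\<in>I j. core \<rho> i) = {})"
    proof (intro conjI allI impI)
      fix l assume l: "l < N"
      show "trap g (\<Union>i\<in>I l. core \<rho> i) (\<Union>i\<in>I l. ball (W i) r)"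
        using I_sub[OF l] I_closed[OF l] by (rule trap)
      obtain i where i: "i \<in> I l" using P[OF l] by (auto simp: I_def)
      have "i < M" using I_sub[OF l] i by auto
      moreover have "W i \<in> ball (W i) r \<inter> S\<^sup>1" using W[of i] r by simp
      ultimately have "W i \<in> core \<rho> (cell_index (W i))" using sub' by blast
      with I_closed[OF l i] show "(\<Union>i\<in>I l. core \<rho> i) \<noteq> {}" by blast
    next
      fix i j assume ij: "i < N" "j < N" "i \<noteq> j"
      show "(\<Union>i\<in>I i. core \<rho> i) \<inter> (\<Union>i\<in>I j. core \<rho> i) = {}"
      proof (rule ccontr)
        assume "(\<Union>i\<in>I i. core \<rho> i) \<inter> (\<Union>i\<in>I j. core \<rho> i) \<noteq> {}"
        then obtain k k' x where "k \<in> I i" "k' \<in> I j" "x \<in> core \<rho> k" "x \<in> core \<rho> k'" by blast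
        then have "k = k'" using core_index[OF \<rho>] I_sub ij(1,2) by (metis lessThan_iff subsetD)
        with \<open>k \<in> I i\<close> \<open>k' \<in> I j\<close> I_disj[OF ij] show False by blast
      qed
    qed
    have big: "trap g (\<Union>i<M. core \<rho> i) (\<Union>i<M. ball (W i) r)"
      by (rule trap) (use cell_index(1)[OF W] in auto)
    have "trapping N g"
      unfolding trapping_def
    proof (rule conjI)
      show "\<exists>K V. trap g K V \<and> emeasure lebesgue_circle (S\<^sup>1 - K) < ennreal (inverse (real (Suc N))) \<and>
          emeasure lebesgue_circle (V \<inter> S\<^sup>1) < ennreal (inverse (real (Suc N)))"
        by (rule exI[of _ "\<Union>i<M. core \<rho> i"], rule exI[of _ "\<Union>i<M. ball (W i) r"])
          (intro conjI big thin[folded W_def])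
      show "\<exists>D V. (\<forall>l<N. trap g (D l) (V l) \<and> D l \<noteq> {}) \<and>
          (\<forall>i<N. \<forall>j<N. i \<noteq> j \<longrightarrow> D i \<inter> D j = {})"
        by (rule exI[of _ "\<lambda>l. \<Union>i\<in>I l. core \<rho> i"], rule exI[of _ "\<lambda>l. \<Union>i\<in>I l. ball (W i) r"])
          (rule traps)
    qed
    with g show ?thesis by blast
  qed
qed

section \<open>Density\<close>

text \<open>Extended by the identity, the inverse becomes an increasing surjection of the real line.
  Monotone surjections are continuous, so no estimate at 0 and 1 is required.\<close>

lemma interval_homeo_inverse:
  assumes "interval_homeo H"
  obtains k where "continuous_on UNIV k" "strict_mono k" "\<And>t. t \<notin> {0<..<1} \<Longrightarrow> k t = t"
    "\<And>t. t \<in> {0<..<1} \<Longrightarrow> k t \<in> {0<..<1} \<and> H (k t) = t \<and> k (H t) = t"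
proof -
  interpret interval_homeo H by fact
  define k where "k t = (if t \<in> {0<..<1} then the_inv_into {0<..<1} H t else t)" for t
  have inj: "inj_on H {0<..<1}" and img: "H ` {0<..<1} = {0<..<1}" using bij by (auto simp: bij_betw_def)
  have k1: "k t = t" if "t \<notin> {0<..<1}" for t using that by (simp only: k_def if_False)
  have k2: "k t \<in> {0<..<1}" "H (k t) = t" "k (H t) = t" if t: "t \<in> {0<..<1}" for t
  proof -
    have t': "t \<in> H ` {0<..<1}" using t img by simp
    have kt: "k t = the_inv_into {0<..<1} H t" using t by (simp only: k_def if_True)
    show "k t \<in> {0<..<1}" unfolding kt by (rule the_inv_into_into[OF inj t' subset_refl])
    show "H (k t) = t" unfolding kt by (rule f_the_inv_into_f[OF inj t'])
    show "k (H t) = t"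
      using the_inv_into_f_f[OF inj t] in_interval[OF t] by (simp only: k_def if_True)
  qed
  have sm: "k s < k t" if st: "s < t" for s t
  proof (cases "s \<in> {0<..<1} \<and> t \<in> {0<..<1}")
    case True
    show ?thesis
    proof (rule ccontr)
      assume "\<not> k s < k t"
      then have "H (k t) \<le> H (k s)"
        using True k2(1) by (intro strict_mono_on_leD[OF mono]) auto
      with True k2(2) st show False by auto
    qed
  next
    case False
    then show ?thesis
      using st k1[of s] k1[of t] k2(1)[of s] k2(1)[of t]
      by (cases "s \<in> {0<..<1}"; cases "t \<in> {0<..<1}") auto
  qed
  have "y \<in> range k" for y
  proof (cases "y \<in> {0<..<1}")
    case True
    then show ?thesis using k2(3)[OF True] by (metis rangeI)
  next
    case False
    then show ?thesis using k1[OF False] by (metis rangeI)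
  qed
  then have surj: "range k = UNIV" by blast
  have "continuous_on UNIV k"
  proof (rule continuous_onI_mono)
    show "k s \<le> k t" if "s \<le> t" for s t using sm[of s t] that by (cases "s = t") auto
  qed (simp add: surj)
  moreover have "strict_mono k" using sm by (rule strict_monoI)
  ultimately show thesis by (rule that) (use k1 k2 in auto)
qed

text \<open>Maxima and minima of increasing functions are increasing, so no pieces have to be glued.\<close>
lemma inverse_germ_extension:
  assumes H: "interval_homeo H" and s: "0 < s" "s < 1"
  obtains \<xi> s' where "continuous_on {0..1} \<xi>" "strict_mono_on {0..1} \<xi>" "\<xi> 0 = 0" "\<xi> 1 = 1"
    "0 < s'" "s' \<le> s" "\<And>t. t \<in> {0<..<s'} \<Longrightarrow> \<xi> t \<in> {0<..<1} \<and> H (\<xi> t) = t"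
    "\<And>t. t \<in> {s..1} \<Longrightarrow> \<xi> t = t"
proof -
  obtain k where k: "continuous_on UNIV k" "strict_mono k" "\<And>t. t \<notin> {0<..<1} \<Longrightarrow> k t = t"
    "\<And>t. t \<in> {0<..<1} \<Longrightarrow> k t \<in> {0<..<1} \<and> H (k t) = t \<and> k (H t) = t"
    using interval_homeo_inverse[OF H] by metis
  have k01: "k 0 = 0" "k 1 = 1" using k(3)[of 0] k(3)[of 1] by auto
  \<comment> \<open>The inverse \<open>k\<close> is clamped between two increasing functions. For
    \<open>t\<close> at least \<open>s\<close> both bounds equal \<open>t\<close>; near 0 the lower
    bound is negative and the upper one exceeds \<open>s / 2\<close>, so \<open>k\<close> is left
    unchanged there.\<close>
  define \<xi> where "\<xi> t = max (min t (2 * t - s)) (min (max t ((t + s) / 2)) (k t))" for t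
  have s2: "s / 2 \<in> {0<..<1}" using s by simp
  \<comment> \<open>Below \<open>H (s / 2)\<close> the inverse takes values below
    \<open>s / 2\<close>, so the upper bound is inactive; below \<open>s / 2\<close> the lower bound
    is negative.\<close>
  define s' where "s' = min (s / 2) (H (s / 2))"
  have s'_pos: "0 < s'" using s interval_homeo.in_interval[OF H s2] by (simp add: s'_def)
  have near: "\<xi> t = k t" "t \<in> {0<..<1}" if t: "t \<in> {0<..<s'}" for t
  proof -
    show t1: "t \<in> {0<..<1}" using t s by (auto simp: s'_def)
    have "t < H (s / 2)" using t by (auto simp: s'_def)
    then have "k t < k (H (s / 2))" using strict_monoD[OF k(2)] by blast
    then have "k t < s / 2" using k(4)[OF s2] by simp
    moreover have "0 < k t" using k(4)[OF t1] by simp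
    moreover have "t < s / 2" "0 < t" using t by (auto simp: s'_def)
    ultimately show "\<xi> t = k t" unfolding \<xi>_def by (auto simp: max_def min_def)
  qed
  show thesis
  proof (rule that[of \<xi> s'])
    show "continuous_on {0..1} \<xi>"
      unfolding \<xi>_def by (intro continuous_intros continuous_on_subset[OF k(1)]) auto
    show "strict_mono_on {0..1} \<xi>"
    proof (rule strict_mono_onI)
      fix u v :: real assume "u < v"
      moreover have "k u < k v" using strict_monoD[OF k(2) \<open>u < v\<close>] .
      ultimately show "\<xi> u < \<xi> v" unfolding \<xi>_def by (auto simp: max_def min_def)
    qed
    show "\<xi> 0 = 0" "\<xi> 1 = 1" using s k01 by (auto simp: \<xi>_def max_def min_def)
    show "\<xi> t = t" if "t \<in> {s..1}" for t using that by (auto simp: \<xi>_def max_def min_def)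
    show "\<xi> t \<in> {0<..<1} \<and> H (\<xi> t) = t" if "t \<in> {0<..<s'}" for t
      using near[OF that] k(4) by simp
  qed (use s'_pos s in \<open>auto simp: s'_def\<close>)
qed

text \<open>If \<open>f\<^bsup>m\<^esup>\<close> fixes \<open>p\<close> without preserving the orientation, it swaps the two sides of \<open>p\<close>.\<close>
lemma one_sided_arc_displaced:
  assumes f: "circle_homeo f" and p: "p \<in> S\<^sup>1"
    and no_lift: "(f ^^ m) p = p \<Longrightarrow>
      \<not> (\<exists>H. interval_homeo H \<and> (\<forall>t\<in>{0<..<1}. (f ^^ m) (arc_point p t) = arc_point p (H t)))"
  shows "\<exists>c>0. c \<le> 1 \<and> (\<forall>t\<in>{0<..<c}. \<forall>u\<in>{0<..<c}. (f ^^ m) (arc_point p t) \<noteq> arc_point p u)"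
proof (cases "(f ^^ m) p = p")
  case True
  obtain H where H: "\<And>t. t \<in> {0<..<1} \<Longrightarrow> (f ^^ m) (arc_point p t) = arc_point p (H t)"
      "bij_betw H {0<..<1} {0<..<1}" "strict_mono_on {0<..<1} H \<or> strict_antimono_on {0<..<1} H"
    using circle_homeo_fixing_lift[OF circle_homeo_funpow[OF f] p True] by metis
  have anti: "strict_antimono_on {0<..<1} H"
    using H no_lift[OF True] by (auto simp: interval_homeo_def)
  have into: "H t \<in> {0<..<1}" if "t \<in> {0<..<1}" for t using H(2) that by (auto simp: bij_betw_def)
  \<comment> \<open>A decreasing lift sends parameters below 1/2 above \<open>H (1/2)\<close>, hence
    above \<open>c\<close>.\<close>
  define c where "c = min (1/2) (H (1/2))"
  have c: "0 < c" "c \<le> 1/2" "c \<le> H (1/2)" using into[of "1/2"] by (auto simp: c_def)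
  have "(f ^^ m) (arc_point p t) \<noteq> arc_point p u" if t: "t \<in> {0<..<c}" and u: "u \<in> {0<..<c}" for t u
  proof
    have t1: "t \<in> {0<..<1}" "u \<in> {0<..<1}" using t u c by auto
    have "H (1/2) < H t" using monotone_onD[OF anti, of t "1/2"] t t1 c by auto
    then have "u < H t" using u c by auto
    moreover assume "(f ^^ m) (arc_point p t) = arc_point p u"
    then have "H t = u"
      using H(1)[OF t1(1)] into[OF t1(1)] t1 p by (simp add: arc_point_eq_iff)
    ultimately show False by simp
  qed
  with c show ?thesis by (intro exI[of _ c]) auto
next
  case False
  \<comment> \<open>If \<open>p\<close> is moved, continuity keeps a short arc within
    \<open>d / 2\<close> of \<open>p\<close> and its image within \<open>d / 2\<close> of the image
    of \<open>p\<close>.\<close>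
  define d where "d = dist ((f ^^ m) p) p"
  have d: "d > 0" using False by (simp add: d_def)
  have "continuous_on UNIV (\<lambda>t. (f ^^ m) (arc_point p t))"
    by (rule continuous_on_compose2[OF circle_homeoD(1)[OF circle_homeo_funpow[OF f]]])
      (use p in \<open>auto intro!: continuous_intros\<close>)
  then obtain c1 where c1: "c1 > 0" "\<And>t. dist t 0 < c1 \<Longrightarrow> dist ((f ^^ m) (arc_point p t)) ((f ^^ m) (arc_point p 0)) < d / 2"
    using d unfolding continuous_on_iff by (metis UNIV_I half_gt_zero)
  have "continuous_on UNIV (arc_point p)" by (intro continuous_intros)
  then obtain c2 where c2: "c2 > 0" "\<And>t. dist t 0 < c2 \<Longrightarrow> dist (arc_point p t) (arc_point p 0) < d / 2"
    using d unfolding continuous_on_iff by (metis UNIV_I half_gt_zero)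
  define c where "c = min 1 (min c1 c2)"
  have c: "0 < c" "c \<le> 1" "c \<le> c1" "c \<le> c2" using c1(1) c2(1) by (auto simp: c_def)
  have "(f ^^ m) (arc_point p t) \<noteq> arc_point p u" if t: "t \<in> {0<..<c}" and u: "u \<in> {0<..<c}" for t u
  proof
    assume eq: "(f ^^ m) (arc_point p t) = arc_point p u"
    have "dist ((f ^^ m) (arc_point p t)) ((f ^^ m) p) < d / 2"
      using c1(2)[of t] t c by simp
    moreover have "dist (arc_point p u) p < d / 2"
      using c2(2)[of u] u c by simp
    ultimately show False
      using dist_triangle_half_r[of "arc_point p u" "(f ^^ m) p" d p] eq by (simp add: d_def)
  qed
  with c show ?thesis by (intro exI[of _ c]) auto
qed

text \<open>Composing with a perturbation supported in \<open>f\<^bsup>q - 1\<^esup>(U)\<close>, where \<open>U\<close> is a short arc on one side of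
  the periodic point, turns the return map to \<open>U\<close> into the identity near \<open>p\<close>.\<close>
lemma identity_return_near:
  assumes f: "circle_homeo f" and p: "p \<in> S\<^sup>1" "k > 0" "(f ^^ k) p = p" and \<epsilon>: "\<epsilon> > 0"
  shows "\<exists>g q s. circle_homeo g \<and> (\<forall>x\<in>S\<^sup>1. dist (f x) (g x) < \<epsilon>) \<and> q > 0 \<and> 0 < s \<and> s < 1 \<and>
           (\<forall>t\<in>{0<..<s}. (g ^^ q) (arc_point p t) = arc_point p t)"
proof -
  define lifts where "lifts q \<longleftrightarrow>
    (\<exists>H. interval_homeo H \<and> (\<forall>t\<in>{0<..<1}. (f ^^ q) (arc_point p t) = arc_point p (H t)))" for q
  define good where "good q \<longleftrightarrow> q > 0 \<and> (f ^^ q) p = p \<and> lifts q" for q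
  have "\<exists>q. good q"
    using increasing_return_lift[OF f p] unfolding good_def lifts_def by metis
  \<comment> \<open>Minimality ranges over the returns with an increasing lift, so \<open>q\<close>
    can be twice the period of \<open>p\<close>. Every earlier iterate moves \<open>p\<close> or
    exchanges its sides, and so displaces a short one-sided arc from itself.\<close>
  define q where "q = (LEAST q. good q)"
  have good: "good q" unfolding q_def using \<open>\<exists>q. good q\<close> by (rule LeastI_ex)
  have min: "\<not> good m" if "m < q" for m using that unfolding q_def by (rule not_less_Least)
  have q: "q > 0" "(f ^^ q) p = p" using good by (auto simp: good_def)
  obtain H where H: "interval_homeo H" "\<And>t. t \<in> {0<..<1} \<Longrightarrow> (f ^^ q) (arc_point p t) = arc_point p (H t)"
    using good by (auto simp: good_def lifts_def)
  have "\<exists>c>0. c \<le> 1 \<and> (\<forall>t\<in>{0<..<c}. \<forall>u\<in>{0<..<c}. (f ^^ m) (arc_point p t) \<noteq> arc_point p u)"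
    if m: "0 < m" "m < q" for m
    using min[OF m(2)] m(1) by (intro one_sided_arc_displaced[OF f p(1)]) (auto simp: good_def lifts_def)
  then obtain c where c: "\<And>m. 0 < m \<Longrightarrow> m < q \<Longrightarrow> c m > 0"
    "\<And>m t u. 0 < m \<Longrightarrow> m < q \<Longrightarrow> t \<in> {0<..<c m} \<Longrightarrow> u \<in> {0<..<c m} \<Longrightarrow> (f ^^ m) (arc_point p t) \<noteq> arc_point p u"
    by metis
  have "continuous_on UNIV (\<lambda>t. (f ^^ q) (arc_point p t))"
    by (rule continuous_on_compose2[OF circle_homeoD(1)[OF circle_homeo_funpow[OF f]]])
      (use p in \<open>auto intro!: continuous_intros\<close>)
  then obtain d where d: "d > 0" "\<And>t. dist t 0 < d \<Longrightarrow> dist ((f ^^ q) (arc_point p t)) ((f ^^ q) (arc_point p 0)) < \<epsilon> / 2"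
    using \<epsilon> unfolding continuous_on_iff by (metis UNIV_I half_gt_zero)
  \<comment> \<open>The bound \<open>d\<close> makes the image of the arc under f^q small, the
    bounds \<open>c m\<close> prevent early returns, and 1/2 keeps \<open>s\<close> below 1.\<close>
  define s where "s = Min (insert (1/2) (insert d (c ` {0<..<q})))"
  have s: "0 < s" "s < 1" "s \<le> d" "\<And>m. 0 < m \<Longrightarrow> m < q \<Longrightarrow> s \<le> c m"
  proof -
    let ?A = "insert (1/2) (insert d (c ` {0<..<q}))"
    have fin: "finite ?A" by simp
    show "0 < s" unfolding s_def using d(1) c(1) by (subst Min_gr_iff) auto
    have "s \<le> 1/2" unfolding s_def by (rule Min_le[OF fin]) simp
    then show "s < 1" by simp
    show "s \<le> d" unfolding s_def by (rule Min_le[OF fin]) simp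
    show "s \<le> c m" if "0 < m" "m < q" for m
      unfolding s_def by (rule Min_le[OF fin]) (use that in auto)
  qed
  define U where "U = arc_point p ` {0<..<s}"
  have US: "U \<subseteq> S\<^sup>1" using p by (auto simp: U_def)
  have displaced: "(f ^^ m) x \<notin> U" if "0 < m" "m < q" "x \<in> U" for m x
  proof
    assume "(f ^^ m) x \<in> U"
    with that(3) obtain t u where "t \<in> {0<..<s}" "u \<in> {0<..<s}" "(f ^^ m) (arc_point p t) = arc_point p u"
      by (auto simp: U_def)
    moreover have "s \<le> c m" using s(4)[OF that(1,2)] .
    ultimately show False using c(2)[OF that(1,2), of t u] by auto
  qed
  obtain \<xi> s' where \<xi>: "continuous_on {0..1} \<xi>" "strict_mono_on {0..1} \<xi>" "\<xi> 0 = 0" "\<xi> 1 = 1"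
    and s': "0 < s'" "s' \<le> s" "\<And>t. t \<in> {0<..<s'} \<Longrightarrow> \<xi> t \<in> {0<..<1} \<and> H (\<xi> t) = t"
    and \<xi>_id: "\<And>t. t \<in> {s..1} \<Longrightarrow> \<xi> t = t"
    using inverse_germ_extension[OF H(1) s(1,2)] by metis
  obtain X where X: "circle_homeo X" "\<And>t. t \<in> {0..1} \<Longrightarrow> X (arc_point p t) = arc_point p (\<xi> t)"
    using circle_homeo_of_interval_homeo[OF p(1) \<xi>] by metis
  have X_id: "X x = x" if x: "x \<in> S\<^sup>1" "x \<notin> U" for x
  proof -
    define t where "t = arc_coord p x"
    have t: "0 \<le> t" "t < 1" "arc_point p t = x"
      using x p arc_coord_bounds by (auto simp: t_def)
    have "\<xi> t = t"
    proof (cases "t = 0")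
      case False
      then have "\<not> t < s" using x(2) t by (force simp: U_def)
      then show ?thesis using t by (intro \<xi>_id) auto
    qed (simp add: \<xi>(3))
    then show ?thesis using X(2)[of t] t by simp
  qed
  have X_U: "X x \<in> U" if "x \<in> U" for x
  proof -
    from that obtain t where t: "x = arc_point p t" "0 < t" "t < s" by (auto simp: U_def)
    have "\<xi> 0 < \<xi> t" "\<xi> t < \<xi> s" using t s by (auto intro!: strict_mono_onD[OF \<xi>(2)])
    then have "\<xi> t \<in> {0<..<s}" using \<xi>(3) \<xi>_id[of s] s by auto
    then show ?thesis using X(2)[of t] t s by (auto simp: U_def)
  qed
  have small: "dist ((f ^^ q) x) ((f ^^ q) y) < \<epsilon>" if "x \<in> U" "y \<in> U" for x y
  proof -
    have "dist ((f ^^ q) z) ((f ^^ q) p) < \<epsilon> / 2" if "z \<in> U" for z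
    proof -
      from that obtain t where t: "z = arc_point p t" "0 < t" "t < s" by (auto simp: U_def)
      then show ?thesis using d(2)[of t] s(3) by simp
    qed
    from this[OF that(1)] this[OF that(2)] show ?thesis by (rule dist_triangle_half_l)
  qed
  \<comment> \<open>The perturbation is inserted before the last application of f in the return.
    There f and \<open>g\<close> take the values of f^q at \<open>u\<close> and at
    \<open>X u\<close> for some \<open>u\<close> in \<open>U\<close>, and \<open>X u\<close> is
    again in \<open>U\<close>. Hence only the image of \<open>U\<close> under f^q has to be small,
    and not its image under \<open>F\<close>.\<close>
  define F where "F = f ^^ (q - 1)"
  have F: "circle_homeo F" unfolding F_def using f by (rule circle_homeo_funpow)
  have fF: "f (F x) = (f ^^ q) x" for x unfolding F_def using q(1) by (cases q) auto
  obtain F' where F': "circle_homeo F'" "\<And>x. x \<in> S\<^sup>1 \<Longrightarrow> F' (F x) = x" "\<And>x. x \<in> S\<^sup>1 \<Longrightarrow> F (F' x) = x"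
    using circle_homeo_inverse[OF F] by metis
  define g where "g = f \<circ> (F \<circ> (X \<circ> F'))"
  have g: "circle_homeo g"
    unfolding g_def by (intro circle_homeo_comp f F X(1) F'(1))
  have g_eq: "g y = (f ^^ q) (X (F' y))" for y by (simp add: g_def fF)
  have g_off: "g y = f y" if "y \<in> S\<^sup>1" "F' y \<notin> U" for y
  proof -
    have "X (F' y) = F' y" using that circle_homeoD(4)[OF F'(1)] by (intro X_id) auto
    then show ?thesis using F'(3)[OF that(1)] by (simp add: g_def)
  qed
  have "dist (f y) (g y) < \<epsilon>" if y: "y \<in> S\<^sup>1" for y
  proof (cases "F' y \<in> U")
    case True
    have "f y = (f ^^ q) (F' y)" using F'(3)[OF y] fF[of "F' y"] by simp
    then show ?thesis using small[OF True X_U[OF True]] by (simp add: g_eq)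
  qed (use g_off[OF y] \<epsilon> in simp)
  moreover have "(g ^^ q) (arc_point p t) = arc_point p t" if t: "t \<in> {0<..<s'}" for t
  proof -
    define x where "x = arc_point p t"
    have x: "x \<in> U" "x \<in> S\<^sup>1" using t s' p by (auto simp: x_def U_def)
    \<comment> \<open>If the f-orbit of \<open>x\<close> met the support, which is the image of
      \<open>U\<close> under \<open>F\<close>, before time \<open>q - 1\<close>, then cancelling f^j
      would exhibit a return to \<open>U\<close> after \<open>q - 1 - j\<close> steps. So
      \<open>g\<close> agrees with f along the orbit until the last step.\<close>
    have iter: "(g ^^ j) x = (f ^^ j) x" if "j \<le> q - 1" for j
      using that
    proof (induction j)
      case (Suc j)
      have fj: "(f ^^ j) x \<in> S\<^sup>1" using circle_homeoD(4)[OF circle_homeo_funpow[OF f] x(2)] .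
      have "F' ((f ^^ j) x) \<notin> U"
      proof
        assume y: "F' ((f ^^ j) x) \<in> U"
        let ?y = "F' ((f ^^ j) x)"
        have "(f ^^ j) ((f ^^ (q - 1 - j)) ?y) = F ?y"
          unfolding F_def using Suc.prems by (simp flip: funpow_add[unfolded o_def, THEN fun_cong])
        also have "\<dots> = (f ^^ j) x" using F'(3)[OF fj] .
        finally have "(f ^^ (q - 1 - j)) ?y = x"
          using circle_homeoD(3)[OF circle_homeo_funpow[OF f]] x(2) y US
            circle_homeoD(4)[OF circle_homeo_funpow[OF f]] by (meson inj_onD subsetD)
        moreover have "0 < q - 1 - j" "q - 1 - j < q" using Suc.prems by auto
        ultimately show False using displaced[OF _ _ y, of "q - 1 - j"] x(1) by simp
      qed
      then have "g ((f ^^ j) x) = f ((f ^^ j) x)" by (rule g_off[OF fj])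
      then show ?case using Suc by simp
    qed simp
    have "(g ^^ q) x = g ((g ^^ (q - 1)) x)" using q(1) by (cases q) auto
    also have "\<dots> = g (F x)" using iter[of "q - 1"] by (simp add: F_def)
    also have "\<dots> = (f ^^ q) (X x)" using F'(2)[OF x(2)] by (simp add: g_eq)
    also have "X x = arc_point p (\<xi> t)" unfolding x_def using t s' s by (intro X(2)) auto
    also have "(f ^^ q) (arc_point p (\<xi> t)) = x"
      using H(2)[of "\<xi> t"] s'(3)[OF t] by (simp add: x_def)
    finally show ?thesis by (simp add: x_def)
  qed
  ultimately show ?thesis
    using g q(1) s' s by (intro exI[of _ g] exI[of _ q] exI[of _ s']) auto
qed

text \<open>Orbits of points of \<open>T\<close> are finite, so infinitely many of them are needed
  to cover \<open>T\<close>. Two that meet coincide, because every point of a periodic orbit leads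
  back to its start.\<close>

lemma periodic_orbits_family:
  assumes g: "circle_homeo g" and T: "infinite T" "T \<subseteq> S\<^sup>1" "\<And>x. x \<in> T \<Longrightarrow> (g ^^ q) x = x" and q: "q > 0"
  obtains P :: "nat \<Rightarrow> complex set"
  where "\<And>l. finite (P l) \<and> P l \<noteq> {} \<and> P l \<subseteq> S\<^sup>1 \<and> g ` P l \<subseteq> P l"
    "\<And>i j. i \<noteq> j \<Longrightarrow> P i \<inter> P j = {}"
proof -
  define orb where "orb x = range (\<lambda>n. (g ^^ n) x)" for x
  have self: "x \<in> orb x" for x unfolding orb_def by (metis funpow_0 rangeI)
  have fin: "finite (orb x)" if "x \<in> T" for x
  proof -
    have "orb x \<subseteq> (\<lambda>n. (g ^^ n) x) ` {..<q}"
      using funpow_mod_eq[OF T(3)[OF that]] q unfolding orb_def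
      by (metis (no_types, lifting) image_eqI image_subsetI lessThan_iff mod_less_divisor)
    then show ?thesis by (rule finite_subset) simp
  qed
  have inv: "g ` orb x \<subseteq> orb x" for x
    unfolding orb_def by (auto intro!: image_eqI[where x = "Suc _"])
  have sub: "orb y \<subseteq> orb x" if x: "x \<in> T" and y: "y \<in> T" and meet: "orb x \<inter> orb y \<noteq> {}" for x y
  proof -
    obtain i j where ij: "(g ^^ i) x = (g ^^ j) y" using meet by (auto simp: orb_def)
    have mult: "(g ^^ (j * q)) y = y"
      using T(3)[OF y] by (induction j) (simp_all add: funpow_add)
    have "(g ^^ n) y \<in> orb x" for n
    proof -
      have "(g ^^ n) y = (g ^^ n) ((g ^^ (j * q - j)) ((g ^^ j) y))"
        using mult q by (simp flip: funpow_add[unfolded o_def, THEN fun_cong])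
      also have "\<dots> = (g ^^ (n + (j * q - j) + i)) x" by (simp add: funpow_add flip: ij)
      finally show ?thesis by (simp add: orb_def)
    qed
    then show ?thesis by (auto simp: orb_def)
  qed
  have "infinite (orb ` T)"
  proof
    assume "finite (orb ` T)"
    then have "finite (\<Union>(orb ` T))" using fin by (intro finite_Union) auto
    moreover have "T \<subseteq> \<Union>(orb ` T)" using self by blast
    ultimately show False using T(1) finite_subset by blast
  qed
  then obtain P :: "nat \<Rightarrow> complex set" where P: "inj P" "range P \<subseteq> orb ` T"
    using infinite_countable_subset by blast
  show thesis
  proof (rule that[of P])
    fix l
    obtain x where x: "x \<in> T" "P l = orb x" using P(2) by blast
    have "orb x \<subseteq> S\<^sup>1"
      using x(1) T(2) circle_homeoD(4)[OF circle_homeo_funpow[OF g]] by (auto simp: orb_def simp del: mem_sphere_0)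
    then show "finite (P l) \<and> P l \<noteq> {} \<and> P l \<subseteq> S\<^sup>1 \<and> g ` P l \<subseteq> P l"
      using fin[OF x(1)] inv[of x] self[of x] unfolding x(2) by blast
  next
    fix i j :: nat assume "i \<noteq> j"
    have "P i \<in> orb ` T" "P j \<in> orb ` T" using P(2) by auto
    then obtain x y where xy: "x \<in> T" "P i = orb x" "y \<in> T" "P j = orb y" by auto
    show "P i \<inter> P j = {}"
    proof (rule ccontr)
      assume "P i \<inter> P j \<noteq> {}"
      then have "orb x = orb y" using sub[OF xy(1,3)] sub[OF xy(3,1)] xy by (simp add: Int_commute subset_antisym)
      then show False using P(1) xy \<open>i \<noteq> j\<close> by (metis injD)
    qed
  qed
qed

lemma trapping_dense:
  assumes f: "circle_homeo f" and \<epsilon>: "\<epsilon> > 0"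
  obtains g where "circle_homeo g" "\<And>x. x \<in> S\<^sup>1 \<Longrightarrow> dist (f x) (g x) < \<epsilon>" "trapping N g"
proof -
  have \<epsilon>3: "\<epsilon> / 3 > 0" using \<epsilon> by simp
  \<comment> \<open>With \<open>N = 0\<close> there are no prescribed invariant sets, so this
    applies to any homeomorphism; the large trap alone yields a periodic point.\<close>
  obtain f1 where f1: "circle_homeo f1" "\<forall>x\<in>S\<^sup>1. dist (f x) (f1 x) < \<epsilon> / 3" "trapping 0 f1"
    using trapping_near_invariant_sets[OF f \<epsilon>3, of 0 "\<lambda>_. {}"] by auto
  obtain p k where p: "p \<in> S\<^sup>1" "k > 0" "(f1 ^^ k) p = p"
    using trapping_periodic_point[OF f1(1,3)] by metis
  obtain f2 q s where f2: "circle_homeo f2" "\<forall>x\<in>S\<^sup>1. dist (f1 x) (f2 x) < \<epsilon> / 3" "q > 0" "0 < s" "s < 1"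
    "\<forall>t\<in>{0<..<s}. (f2 ^^ q) (arc_point p t) = arc_point p t"
    using identity_return_near[OF f1(1) p \<epsilon>3] by blast
  have "inj_on (arc_point p) {0<..<s}"
    by (rule inj_onI) (use p f2(5) in \<open>simp add: arc_point_eq_iff\<close>)
  then have "infinite (arc_point p ` {0<..<s})"
    using f2(4) by (simp add: finite_image_iff infinite_Ioo)
  then obtain P :: "nat \<Rightarrow> complex set" where P: "\<And>l. finite (P l) \<and> P l \<noteq> {} \<and> P l \<subseteq> S\<^sup>1 \<and> f2 ` P l \<subseteq> P l"
    "\<And>i j. i \<noteq> j \<Longrightarrow> P i \<inter> P j = {}"
    by (rule periodic_orbits_family[OF f2(1) _ _ _ f2(3)]) (use p f2(6) in auto)
  obtain g where g: "circle_homeo g" "\<forall>x\<in>S\<^sup>1. dist (f2 x) (g x) < \<epsilon> / 3" "trapping N g"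
    using trapping_near_invariant_sets[OF f2(1) \<epsilon>3, of N P] P by blast
  show thesis
  proof (rule that[OF g(1) _ g(3)])
    fix x :: complex assume x: "x \<in> S\<^sup>1"
    have "dist (f x) (g x) \<le> dist (f x) (f1 x) + dist (f1 x) (f2 x) + dist (f2 x) (g x)"
      using dist_triangle[of "f x" "g x" "f2 x"] dist_triangle[of "f x" "f2 x" "f1 x"] by linarith
    moreover have "dist (f x) (f1 x) < \<epsilon> / 3" "dist (f1 x) (f2 x) < \<epsilon> / 3" "dist (f2 x) (g x) < \<epsilon> / 3"
      using x f1(2) f2(2) g(2) by blast+
    ultimately show "dist (f x) (g x) < \<epsilon>" by linarith
  qed
qed

section \<open>The C^0 metric and residuality\<close>

lemma mspace_Homeo_circle_iff: "f \<in> mspace Homeo_circle \<longleftrightarrow> f \<in> extensional S\<^sup>1 \<and> circle_homeo f"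
  by (simp add: mspace_Homeo_circle homeomorphic_map_circle_iff)

lemma dist_le_mdist_Homeo_circle:
  assumes "f \<in> mspace Homeo_circle" "g \<in> mspace Homeo_circle" "x \<in> S\<^sup>1"
  shows "dist (f x) (g x) \<le> mdist Homeo_circle f g"
proof -
  \<comment> \<open>A real supremum dominates its family only if the family is bounded above; two
    points of the circle are at distance at most 2.\<close>
  have "dist (f y) (g y) \<le> 2" if "y \<in> S\<^sup>1" for y
  proof -
    have "norm (f y) = 1" "norm (g y) = 1"
      using assms(1,2) that circle_homeoD(4)[of f y] circle_homeoD(4)[of g y]
      by (auto simp: mspace_Homeo_circle_iff)
    then show ?thesis using norm_triangle_ineq4[of "f y" "g y"] by (simp add: dist_norm)
  qed
  then have "bdd_above ((\<lambda>y. dist (f y) (g y)) ` S\<^sup>1)" by (intro bdd_aboveI[of _ 2]) auto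
  then show ?thesis
    unfolding mdist_Homeo_circle[OF assms(1,2)] by (rule cSUP_upper[OF assms(3)])
qed

lemma mdist_Homeo_circle_le:
  assumes "f \<in> mspace Homeo_circle" "g \<in> mspace Homeo_circle" "\<And>x. x \<in> S\<^sup>1 \<Longrightarrow> dist (f x) (g x) \<le> e"
  shows "mdist Homeo_circle f g \<le> e"
proof -
  have "S\<^sup>1 \<noteq> ({} :: complex set)" by simp
  then show ?thesis
    using assms by (simp only: mdist_Homeo_circle) (rule cSUP_least)
qed

lemma openin_trapping: "openin (mtopology_of Homeo_circle) {f \<in> mspace Homeo_circle. trapping N f}"
proof -
  interpret H: Metric_space "mspace Homeo_circle" "mdist Homeo_circle" by simp
  show ?thesis
    unfolding mtopology_of_def H.openin_mtopology
  proof (intro conjI allI impI)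
    fix f assume "f \<in> {f \<in> mspace Homeo_circle. trapping N f}"
    then have f: "f \<in> mspace Homeo_circle" "circle_homeo f" "trapping N f"
      by (auto simp: mspace_Homeo_circle_iff)
    obtain \<delta> where \<delta>: "\<delta> > 0" "\<And>g. (\<And>x. x \<in> S\<^sup>1 \<Longrightarrow> dist (f x) (g x) < \<delta>) \<Longrightarrow> trapping N g"
      by (rule trapping_robust[OF f(2,3)]) blast
    have "H.mball f \<delta> \<subseteq> {f \<in> mspace Homeo_circle. trapping N f}"
    proof
      fix g assume "g \<in> H.mball f \<delta>"
      then have g: "g \<in> mspace Homeo_circle" "mdist Homeo_circle f g < \<delta>" by (auto simp: H.in_mball)
      have "trapping N g"
      proof (rule \<delta>(2))
        fix x :: complex assume "x \<in> S\<^sup>1"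
        from dist_le_mdist_Homeo_circle[OF f(1) g(1) this] g(2) show "dist (f x) (g x) < \<delta>" by linarith
      qed
      with g(1) show "g \<in> {f \<in> mspace Homeo_circle. trapping N f}" by simp
    qed
    with \<delta>(1) show "\<exists>r>0. H.mball f r \<subseteq> {f \<in> mspace Homeo_circle. trapping N f}" by blast
  qed auto
qed

lemma closure_of_trapping:
  "mtopology_of Homeo_circle closure_of {f \<in> mspace Homeo_circle. trapping N f} = mspace Homeo_circle"
proof -
  interpret H: Metric_space "mspace Homeo_circle" "mdist Homeo_circle" by simp
  have "\<exists>g\<in>{f \<in> mspace Homeo_circle. trapping N f}. g \<in> H.mball f r"
    if f: "f \<in> mspace Homeo_circle" and r: "r > 0" for f r
  proof -
    have homeo: "circle_homeo f" using f by (simp add: mspace_Homeo_circle_iff)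
    \<comment> \<open>Pointwise strict bounds give only a weak bound for the supremum, and the open
      ball needs a strict one.\<close>
    have r2: "r / 2 > 0" using r by simp
    obtain g where g: "circle_homeo g" "\<And>x. x \<in> S\<^sup>1 \<Longrightarrow> dist (f x) (g x) < r / 2" "trapping N g"
      by (rule trapping_dense[OF homeo r2]) blast
    define g' where "g' = restrict g S\<^sup>1"
    have eq: "g' x = g x" if "x \<in> S\<^sup>1" for x using that by (simp only: g'_def restrict_apply if_True)
    have g': "g' \<in> mspace Homeo_circle"
      using circle_homeo_cong[OF g(1), of g'] eq by (simp add: mspace_Homeo_circle_iff g'_def)
    \<comment> \<open>The extensional representative agrees with \<open>g\<close> on the circle but
      is another function on the plane. Robustness, applied at distance 0, transfers the property to
      it.\<close>
    obtain \<delta> where \<delta>: "\<delta> > 0" "\<And>h. (\<And>x. x \<in> S\<^sup>1 \<Longrightarrow> dist (g x) (h x) < \<delta>) \<Longrightarrow> trapping N h"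
      by (rule trapping_robust[OF g(1,3)]) blast
    have "trapping N g'" by (rule \<delta>(2)) (use eq \<delta>(1) in simp)
    moreover have "mdist Homeo_circle f g' \<le> r / 2"
      by (rule mdist_Homeo_circle_le[OF f g']) (use eq g(2) in \<open>simp add: less_imp_le\<close>)
    then have "g' \<in> H.mball f r" using f g' r by (simp add: H.in_mball)
    ultimately show ?thesis using g' by blast
  qed
  then show ?thesis
    unfolding mtopology_of_def H.metric_closure_of by blast
qed

theorem theorem3p8:
  shows "\<exists>R. residual (mtopology_of Homeo_circle) R \<and>
    (\<forall>f\<in>R. wonderful f \<and>
       infinite {\<mu>. physical_measure f \<mu>} \<and> countable {\<mu>. physical_measure f \<mu>} \<and>
       (\<forall>\<mu>. physical_measure f \<mu> \<longrightarrow> (\<exists>p k. periodic_point f p k \<and> \<mu> = periodic_dirac f p k)))"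
proof (intro exI conjI ballI)
  define R where "R N = {f \<in> mspace Homeo_circle. trapping N f}" for N
  show "residual (mtopology_of Homeo_circle) (mspace Homeo_circle \<inter> (\<Inter>N. R N))"
    unfolding residual_def
  proof (intro conjI exI)
    show "countable (range R)" by simp
    show "\<forall>U\<in>range R. openin (mtopology_of Homeo_circle) U \<and>
        mtopology_of Homeo_circle closure_of U = topspace (mtopology_of Homeo_circle)"
      using openin_trapping closure_of_trapping by (auto simp: R_def)
  qed auto
  fix f assume f: "f \<in> mspace Homeo_circle \<inter> (\<Inter>N. R N)"
  then have homeo: "circle_homeo f" and trapping: "trapping N f" for N
    by (auto simp: R_def mspace_Homeo_circle_iff)
  note result = trapping_imp_wonderful[OF homeo trapping]
  show "wonderful f" by (rule result(1))
  show "infinite {\<mu>. physical_measure f \<mu>}" by (rule result(2))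
  show "countable {\<mu>. physical_measure f \<mu>}" by (rule result(3))
  show "\<forall>\<mu>. physical_measure f \<mu> \<longrightarrow> (\<exists>p k. periodic_point f p k \<and> \<mu> = periodic_dirac f p k)"
    by (rule result(4))
qed

end
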